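(* Assume the following, for all $j\in\mathcal J$ in (P1), (P2), (X), where $\pi_M=\sup_{\Theta\in\mathbb R^{k_j\times p}}\pi(\Theta\mid I_p)$ and all limits are in the asymptotic framework $n\to\infty$, $p/n\to c_0\in[0,1)$: (P1) $\pi(\Theta\mid\Sigma)\,|\Sigma|^{k_j/2}=\pi(\Theta\Sigma^{-1/2}\mid I_p)$ for every $k_j\times p$ matrix $\Theta$ and every $p\times p$ positive definite matrix $\Sigma$; (P2) there exists a sequence $\{\ell_{n,p}\}$ of positive numbers such that $\ell_{n,p}\to\infty$ and $$\sup\frac{(1-w_j)\,\ell_{n,p}^{pk_j/2}}{w_j\,n^{pk_j/2}}\,\pi_M<\infty,$$ where the supremum is over $\{(n,p)\in\mathbb N^2\mid p=p(n)\}$; (X) $\liminf\left|X_j^\top X_j/n\right|>0$; (A1) $j_\ast\in\mathcal J$; (A2) for every $j\in\mathcal J_-$, the rank $\gamma_j$ is constant (and positive) and $\liminf\,(np)^{-1}\lambda_j>0$. Then the criteria $\mathrm{MPIC}_\pi$ and $\mathrm{MPIC}_{\mathrm{Approx}}$ are consistent in this asymptotic framework, i.e. for $\mathrm{IC}=\mathrm{MPIC}_\pi$ and for $\mathrm{IC}=\mathrm{MPIC}_{\mathrm{Approx}}$ the selection $\hat j_\ast=\arg\min_{j\in\mathcal J}\mathrm{IC}(j)$ satisfies $\mathbb P(\hat j_\ast=j_\ast)\to1$, if either of the following two conditions holds: (1) $p$ is unbounded, and (HD-1') $\lim\,(n\log p)^{-1}\log(w_\ast/w_j)>-\gamma_j/2$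 for all $j\in\mathcal J_-$, and (HD-2') $\lim\,p^{-1}\log(w_\ast/w_j)>-2^{-1}(k_j-k_\ast)\left\{c_0^{-1}\log(1-c_0)+(2-c_0)(1-c_0)^{-2}\right\}$ for all $j\in\mathcal J_+\setminus\{j_\ast\}$; (2) $p$ is bounded, and (LS-1') $\lim\,n^{-1}\log(w_\ast/w_j)\ge0$ for all $j\in\mathcal J_-$, and (LS-2') $\lim\,\log(w_\ast/w_j)=\infty$ for all $j\in\mathcal J_+\setminus\{j_\ast\}$. Here $c_0^{-1}\log(1-c_0)$ is read as $-1$ when $c_0=0$.
   Context: Model. $Y$ is an $n\times p$ random matrix of responses, $X$ is an $n\times k$ matrix of explanatory variables with $\operatorname{rank}X=k<n$ ($k$ fixed), and $\omega=\{1,\dots,k\}$. For $j\subset\omega$, $k_j$ is the number of elements of $j$ and $X_j$ is the $n\times k_j$ matrix of the columns of $X$ indexed by $j$. $N_{n\times p}(M,\Sigma\otimes I_n)$ is the matrix normal distribution (rows independent, each with covariance $\Sigma$, mean matrix $M$), with density $f(\cdot\mid M,\Sigma)$. The data are generated from the true model $Y\sim N_{n\times p}(X_\ast\Theta_\ast,\Sigma_\ast\otimes I_n)$, where $j_\ast\subset\omega$, $X_\ast=X_{j_\ast}$, $k_\ast=k_{j_\ast}$, $\Theta_\ast$ is a $k_\ast\times p$ matrix and $\Sigma_\ast$ is a $p\times p$ positive definite matrix. $\mathcal J\subset 2^\omega$ is the set of candidate models, $\mathcal J_+=\{j\in\mathcal J\mid j_\ast\subset j\}$ and $\mathcal J_-=\{j\in\mathcal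 J\mid j_\ast\not\subset j\}$. $\omega,\mathcal J,j_\ast$ do not depend on $n$. $|A|$ denotes the determinant of a square matrix $A$. Estimators. $\hat\Theta_j=(X_j^\top X_j)^{-1}X_j^\top Y$, $\hat\Sigma_j=\frac1nY^\top(I_n-P_j)Y$ with $P_j=X_j(X_j^\top X_j)^{-1}X_j^\top$. Noncentrality matrix. $\gamma_j$ is the rank of $\Sigma_\ast^{-1/2}\Theta_\ast^\top X_\ast^\top(I_n-P_j)X_\ast\Theta_\ast\Sigma_\ast^{-1/2}$. When $\gamma_j>0$, this matrix is written as $\Gamma_j\Gamma_j^\top$ with $\Gamma_j$ a $p\times\gamma_j$ matrix of full rank, and $\lambda_j$ is the smallest eigenvalue of the positive definite matrix $\Gamma_j^\top\Gamma_j$. Criteria. For each $j$, $w_j\in(0,1)$ is a weight that may depend on $n,p$ (and $w_\ast=w_{j_\ast}$), and $\pi(\cdot\mid\Sigma)$ is a smooth (possibly improper) prior density on $\mathbb R^{k_j\times p}$ depending on a positive definite $p\times p$ matrix $\Sigma$. Put $f_\pi(Y\mid\Sigma)=\int f(Y\mid X_j\Theta,\Sigma)\,\pi(\Theta\mid\Sigma)\,d\Theta$. Then $$\mathrm{MPIC}_\pi(j)=n\log|\hat\Sigma_j|+np(\log2\pi+1)+\frac{np(2k_j+p+1)}{n-p-k_j-1}-2\log\left\{\frac{(1-w_j)f_\pi(Y\mid\hat\Sigma_j)}{f(Y\mid X_j\hat\Theta_j,\hat\Sigma_j)}+w_j\right\},$$ $$\mathrm{MPIC}_{\mathrm{Approx}}(j)=n\log|\hat\Sigma_j|+np(\log2\pi+1)+\frac{np(2k_j+p+1)}{n-p-k_j-1}-2\log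 w_j .$$ Asymptotic framework. $p=p(n)$ is a nondecreasing function of $n$ (bounded or divergent), $n\to\infty$, and $c_{n,p}=p/n\to c_0\in[0,1)$; $X,\Theta_\ast,\Sigma_\ast,w_j,\pi$ may vary with $n$. *)

theory Defs
  imports
    "HOL-Probability.Probability"
    "Jordan_Normal_Form.Gauss_Jordan_Elimination"
    "Jordan_Normal_Form.Char_Poly"
    "Jordan_Normal_Form.DL_Rank"
    "Jordan_Normal_Form.DL_Submatrix"
begin

hide_const (open) Determinants.det Finite_Cartesian_Product.mat Cartesian_Space.rank

text \<open>Since the dimensions \<open>n\<close> and \<open>p\<close> vary with the sample size, matrices are those of
  \<^theory>\<open>Jordan_Normal_Form.Matrix\<close>, whose dimensions are values. Indices start at \<open>0\<close>, so
  that \<open>\<omega>\<close> is \<open>{..<k}\<close>.\<close>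

text \<open>Meaningful for invertible matrices only.\<close>

definition minv :: "real mat \<Rightarrow> real mat" where
  "minv A = the (mat_inverse A)"

definition mtrace :: "real mat \<Rightarrow> real" where
  "mtrace A = (\<Sum>i<dim_row A. A $$ (i, i))"

definition pos_def :: "nat \<Rightarrow> real mat \<Rightarrow> bool" where
  "pos_def p A \<longleftrightarrow> A \<in> carrier_mat p p \<and> transpose_mat A = A \<and>
     (\<forall>v\<in>carrier_vec p. v \<noteq> 0\<^sub>v p \<longrightarrow> scalar_prod v (A *\<^sub>v v) > 0)"

definition pd_sqrt :: "real mat \<Rightarrow> real mat" where
  "pd_sqrt A = (THE B. pos_def (dim_row A) B \<and> B * B = A)"

definition inv_sqrt :: "real mat \<Rightarrow> real mat" where
  "inv_sqrt A = minv (pd_sqrt A)"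

definition mrank :: "real mat \<Rightarrow> nat" where
  "mrank A = vec_space.rank (dim_row A) A"

definition min_eigenvalue :: "real mat \<Rightarrow> real" where
  "min_eigenvalue A = Min {e. eigenvalue A e}"

definition cols_sub :: "real mat \<Rightarrow> nat set \<Rightarrow> real mat" where
  "cols_sub X j = submatrix X UNIV j"

definition proj_mat :: "real mat \<Rightarrow> real mat" where
  "proj_mat X = X * minv (transpose_mat X * X) * transpose_mat X"


abbreviation entries_measure :: "nat \<Rightarrow> nat \<Rightarrow> (nat \<times> nat \<Rightarrow> real) measure" where
  "entries_measure r c \<equiv> PiM ({..<r} \<times> {..<c}) (\<lambda>_. lborel)"

definition entries :: "real mat \<Rightarrow> nat \<times> nat \<Rightarrow> real" where
  "entries A = restrict (($$) A) ({..<dim_row A} \<times> {..<dim_col A})"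

definition normal_mat_density :: "real mat \<Rightarrow> real mat \<Rightarrow> real mat \<Rightarrow> real" where
  "normal_mat_density M S Y =
     (let n = real (dim_row Y); p = real (dim_col Y) in
      (2 * pi) powr (- (n * p) / 2) * det S powr (- n / 2) *
      exp (- (1 / 2) * mtrace (minv S * (transpose_mat (Y - M) * (Y - M)))))"

definition matrix_normal ::
  "'a measure \<Rightarrow> nat \<Rightarrow> nat \<Rightarrow> ('a \<Rightarrow> real mat) \<Rightarrow> real mat \<Rightarrow> real mat \<Rightarrow> bool" where
  "matrix_normal P n p Y M S \<longleftrightarrow>
     (\<forall>x\<in>space P. Y x \<in> carrier_mat n p) \<and>
     distributed P (entries_measure n p) (\<lambda>x. entries (Y x))
       (\<lambda>y. ennreal (normal_mat_density M S (mat n p y)))"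


definition Theta_hat :: "real mat \<Rightarrow> real mat \<Rightarrow> nat set \<Rightarrow> real mat" where
  "Theta_hat X Y j =
     (let Xj = cols_sub X j in minv (transpose_mat Xj * Xj) * transpose_mat Xj * Y)"

definition Sigma_hat :: "real mat \<Rightarrow> real mat \<Rightarrow> nat set \<Rightarrow> real mat" where
  "Sigma_hat X Y j =
     (1 / real (dim_row Y)) \<cdot>\<^sub>m
       (transpose_mat Y * (1\<^sub>m (dim_row Y) - proj_mat (cols_sub X j)) * Y)"

text \<open>Here \<open>jst\<close>, \<open>T\<close>, \<open>S\<close> are the true model, coefficients and covariance.\<close>

definition noncentrality :: "real mat \<Rightarrow> nat set \<Rightarrow> real mat \<Rightarrow> real mat \<Rightarrow> nat set \<Rightarrow> real mat" where
  "noncentrality X jst T S j =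
     (let Xs = cols_sub X jst in
      inv_sqrt S * transpose_mat T * transpose_mat Xs *
      (1\<^sub>m (dim_row X) - proj_mat (cols_sub X j)) * Xs * T * inv_sqrt S)"


text \<open>\<open>Ck m I g\<close>: the function \<open>g\<close> has continuous partial derivatives of all orders up to \<open>m\<close>
  in the coordinates from \<open>I\<close>. It is only applied to functions \<open>g\<close> that do not depend on the
  coordinates outside the finite set \<open>I\<close>, for which continuity with respect to the product
  topology is continuity on \<open>\<real>\<close> to the power \<open>I\<close>.\<close>

primrec Ck :: "nat \<Rightarrow> 'i set \<Rightarrow> (('i \<Rightarrow> real) \<Rightarrow> real) \<Rightarrow> bool" where
  "Ck 0 I g \<longleftrightarrow> continuous_on UNIV g"
| "Ck (Suc m) I g \<longleftrightarrow> continuous_on UNIV g \<and>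
     (\<forall>a\<in>I. \<exists>g'. (\<forall>x. ((\<lambda>t. g (x(a := t))) has_real_derivative g' x) (at (x a))) \<and> Ck m I g')"

definition smooth_mat_fun :: "nat \<Rightarrow> nat \<Rightarrow> (real mat \<Rightarrow> real) \<Rightarrow> bool" where
  "smooth_mat_fun r c g \<longleftrightarrow> (\<forall>m. Ck m ({..<r} \<times> {..<c}) (\<lambda>t. g (mat r c t)))"

text \<open>A possibly improper prior density \<open>\<pi>(\<Theta> | \<Sigma>)\<close> for \<open>q \<times> p\<close> matrices \<open>\<Theta>\<close>; there is no
  condition on its total mass.\<close>

definition prior_density :: "nat \<Rightarrow> nat \<Rightarrow> (real mat \<Rightarrow> real mat \<Rightarrow> real) \<Rightarrow> bool" where
  "prior_density q p \<pi> \<longleftrightarrow> (\<forall>S. pos_def p S \<longrightarrow>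
     (\<forall>T\<in>carrier_mat q p. \<pi> T S \<ge> 0) \<and> smooth_mat_fun q p (\<lambda>T. \<pi> T S))"

text \<open>The supremum \<open>\<pi>\<^sub>M\<close>, possibly infinite.\<close>

definition prior_sup :: "nat \<Rightarrow> nat \<Rightarrow> (real mat \<Rightarrow> real mat \<Rightarrow> real) \<Rightarrow> ereal" where
  "prior_sup q p \<pi> = (SUP T\<in>carrier_mat q p. ereal (\<pi> T (1\<^sub>m p)))"

text \<open>A prior is specified for positive definite \<open>S\<close> only. The value \<open>0\<close> for other \<open>S\<close> makes the
  criterion \<open>MPIC\<close> a measurable function of \<open>Y\<close> regardless of \<open>\<pi>\<close> there; \<open>Sigma_hat\<close> is almost surely positive
  definite once \<open>n \<ge> p + card j\<close>.\<close>

definition marginal_density ::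
  "(real mat \<Rightarrow> real mat \<Rightarrow> real) \<Rightarrow> real mat \<Rightarrow> nat set \<Rightarrow> real mat \<Rightarrow> real mat \<Rightarrow> real" where
  "marginal_density \<pi> X j Y S =
     (let q = card j; p = dim_col Y in
      if pos_def p S
      then \<integral>t. normal_mat_density (cols_sub X j * mat q p t) S Y * \<pi> (mat q p t) S
             \<partial>entries_measure q p
      else 0)"


definition MPIC_main :: "real mat \<Rightarrow> real mat \<Rightarrow> nat set \<Rightarrow> real" where
  "MPIC_main X Y j =
     (let n = real (dim_row Y); p = real (dim_col Y); kj = real (card j) in
      n * ln (det (Sigma_hat X Y j)) + n * p * (ln (2 * pi) + 1) +
      n * p * (2 * kj + p + 1) / (n - p - kj - 1))"

definition MPIC ::
  "(nat set \<Rightarrow> real mat \<Rightarrow> real mat \<Rightarrow> real) \<Rightarrow> (nat set \<Rightarrow> real) \<Rightarrow>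
   real mat \<Rightarrow> real mat \<Rightarrow> nat set \<Rightarrow> real" where
  "MPIC \<pi> w X Y j = MPIC_main X Y j -
     2 * ln ((1 - w j) * marginal_density (\<pi> j) X j Y (Sigma_hat X Y j) /
             normal_mat_density (cols_sub X j * Theta_hat X Y j) (Sigma_hat X Y j) Y + w j)"

definition MPIC_Approx ::
  "(nat set \<Rightarrow> real) \<Rightarrow> real mat \<Rightarrow> real mat \<Rightarrow> nat set \<Rightarrow> real" where
  "MPIC_Approx w X Y j = MPIC_main X Y j - 2 * ln (w j)"

definition models_plus :: "nat set set \<Rightarrow> nat set \<Rightarrow> nat set set" where
  "models_plus J jst = {j\<in>J. jst \<subseteq> j}"

definition models_minus :: "nat set set \<Rightarrow> nat set \<Rightarrow> nat set set" where
  "models_minus J jst = {j\<in>J. \<not> jst \<subseteq> j}"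

text \<open>\<open>IC n Y j\<close> is the value of the criterion at model \<open>j\<close> for sample size \<open>n\<close> and data \<open>Y\<close>.
  The event \<open>argmin = jst\<close> is read as: \<open>jst\<close> is the only minimizer, so that the outcome does not
  depend on how ties are broken.\<close>

definition consistent ::
  "(nat \<Rightarrow> 'a measure) \<Rightarrow> (nat \<Rightarrow> 'a \<Rightarrow> real mat) \<Rightarrow> nat set set \<Rightarrow> nat set \<Rightarrow>
   (nat \<Rightarrow> real mat \<Rightarrow> nat set \<Rightarrow> real) \<Rightarrow> bool" where
  "consistent P Y J jst IC \<longleftrightarrow>
     (\<lambda>n. measure (P n)
        {x\<in>space (P n). {j. is_arg_min (IC n (Y n x)) (\<lambda>j. j \<in> J) j} = {jst}}) \<longlonglongrightarrow> 1"

text \<open>\<open>c\<inverse> log (1 - c)\<close>, continuously extended to \<open>c = 0\<close>.\<close>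

definition log_ratio :: "real \<Rightarrow> real" where
  "log_ratio c = (if c = 0 then - 1 else ln (1 - c) / c)"

end

theory Submission
  imports Defs
begin

text \<open>Up to deterministic terms, the difference of the criteria of \<open>j\<close> and of the true model is \<open>n\<close> times the log ratio of
  the determinants of the residual matrices \<open>Y\<^sup>T (I - P\<^sub>j) Y\<close>. In an orthonormal basis adapted to the nested model
  spaces these are Gram matrices of rows of a Gaussian matrix.

  If \<open>j\<close> contains the true model, dropping the additional rows one by one multiplies the determinant by \<open>1 - h\<close>, with
  \<open>h\<close> the leverage of the dropped row. Rotation invariance of the noise gives the first two moments of a leverage, whose
  mean is \<open>p / N\<close> for \<open>N\<close> rows: Chebyshev's inequality for unbounded \<open>p\<close> and Markov's inequality for bounded \<open>p\<close> yield the
  logarithmic term of (HD-2') and a bounded log ratio, respectively.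

  If \<open>j\<close> does not contain the true model, the model is compared with the union of both. By (A2) the signal makes the
  residual quadratic form on a \<open>\<gamma>\<^sub>j\<close>-dimensional subspace larger by a factor of order \<open>p\<close>, hence the determinant
  larger by a factor of order \<open>p\<close> to the power \<open>\<gamma>\<^sub>j\<close>; only second moments of the noise are needed.

  Finally, by (P1) the quotient of \<open>f\<^sub>\<pi>\<close> and the maximal likelihood is at most \<open>\<pi>\<^sub>M\<close> times a Gaussian integral that
  depends on the design only. With (P2) and (X), \<open>MPIC\<close> then differs from \<open>MPIC_Approx\<close> by a bounded amount,
  whereas the differences between models diverge.\<close>

section \<open>Real matrices\<close>

declare sum.lessThan_Suc [simp del] prod.lessThan_Suc [simp del]

lemma mat_mult_assoc_dim:
  "dim_col A = dim_row B \<Longrightarrow> dim_col B = dim_row C \<Longrightarrow> A * B * C = A * (B * C)"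
  for A B C :: "'a::semiring_0 mat"
  by (rule assoc_mult_mat[of _ "dim_row A" "dim_col A" _ "dim_col B" _ "dim_col C"]) auto

lemma mat_transpose_mult_dim: "dim_col A = dim_row B \<Longrightarrow> (A * B)\<^sup>T = B\<^sup>T * A\<^sup>T"
  for A B :: "'a::comm_semiring_0 mat"
  by (rule transpose_mult[of _ "dim_row A" "dim_col A" _ "dim_col B"]) auto

lemma mult_index_sum: "i < dim_row A \<Longrightarrow> j < dim_col B \<Longrightarrow> dim_col A = dim_row B \<Longrightarrow>
   (A * B) $$ (i, j) = (\<Sum>l<dim_row B. A $$ (i, l) * B $$ (l, j))"
  by (auto simp: scalar_prod_def atLeast0LessThan intro!: sum.cong)

lemma orthogonal_mat_swap: "A \<in> carrier_mat n n \<Longrightarrow> B \<in> carrier_mat n n \<Longrightarrow> A * B = 1\<^sub>m n \<Longrightarrow> B * A = 1\<^sub>m n"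
  for A :: "'a::field mat"
  using mat_mult_left_right_inverse by blast

lemma invertible_cancel:
  fixes A :: "'a::semiring_1 mat"
  assumes "A * B = 1\<^sub>m n" "A \<in> carrier_mat n m" "B \<in> carrier_mat m n" "dim_row C = n"
  shows "A * (B * C) = C"
  using assms by (subst mat_mult_assoc_dim[symmetric]) auto

lemma mat_diag_dims [simp]: "dim_row (mat_diag n d) = n" "dim_col (mat_diag n d) = n"
  by (simp_all add: mat_diag_def)

lemma mat_diag_transpose [simp]: "(mat_diag n d)\<^sup>T = mat_diag n d"
  by (rule eq_matI) (auto simp: mat_diag_def)

lemma det_mat_diag: "det (mat_diag n d) = (\<Prod>i<n. d i)" for d :: "nat \<Rightarrow> real"
proof -
  have "det (mat_diag n d) = prod_list (diag_mat (mat_diag n d))"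
    by (rule det_upper_triangular[of _ n]) (auto simp: mat_diag_def)
  also have "diag_mat (mat_diag n d) = map d [0..<n]"
    by (auto simp: diag_mat_def mat_diag_def)
  also have "prod_list \<dots> = (\<Prod>i<n. d i)"
    by (simp add: prod.distinct_set_conv_list[symmetric] atLeast0LessThan)
  finally show ?thesis .
qed

lemma householder:
  assumes v: "(\<Sum>i<Suc n. (v i)\<^sup>2) = (1::real)"
  shows "\<exists>H\<in>carrier_mat (Suc n) (Suc n). H\<^sup>T * H = 1\<^sub>m (Suc n) \<and> (\<forall>i<Suc n. H $$ (i, 0) = v i)"
proof -
  define w where "w i = v i - (if i = 0 then 1 else 0)" for i
  define s where "s = (\<Sum>i<Suc n. (w i)\<^sup>2)"
  define c where "c = 2 / s"
  define H where "H = Matrix.mat (Suc n) (Suc n) (\<lambda>(i,j). (if i = j then 1 else 0) - c * w i * w j)"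
  have s: "s = - 2 * w 0"
  proof -
    have "s = (\<Sum>i<Suc n. (v i)\<^sup>2) + (w 0)\<^sup>2 - (v 0)\<^sup>2"
      unfolding s_def lessThan_Suc_eq_insert_0 by (simp add: sum.reindex w_def)
    then show ?thesis unfolding v by (simp add: w_def power2_eq_square algebra_simps)
  qed
  have w0: "w i = 0" if "s = 0" "i < Suc n" for i
    using that unfolding s_def by (subst (asm) sum_nonneg_eq_0_iff) auto
  have col: "H $$ (i, 0) = v i" if "i < Suc n" for i
  proof (cases "s = 0")
    case True
    then show ?thesis using that w0[OF True] by (auto simp: H_def w_def split: if_splits)
  next
    case False
    then have "c * w 0 = -1" by (simp add: c_def s)
    then have "c * w i * w 0 = - w i" by (metis (no_types) mult.commute mult.left_commute mult_minus1)
    then show ?thesis using that by (auto simp: H_def w_def)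
  qed
  have "(H\<^sup>T * H) $$ (i,j) = (if i = j then 1 else 0)" if ij: "i < Suc n" "j < Suc n" for i j
  proof -
    have "(H\<^sup>T * H) $$ (i,j) = (\<Sum>l<Suc n. ((if l = i then 1 else 0) - c * w l * w i) * ((if l = j then 1 else 0) - c * w l * w j))"
      using ij by (subst mult_index_sum) (auto simp: H_def intro!: sum.cong)
    also have "\<dots> = (\<Sum>l<Suc n. (if l = i then (if l = j then 1 else 0) else 0)) - (\<Sum>l<Suc n. if l = i then c * w l * w j else 0)
       - (\<Sum>l<Suc n. if l = j then c * w l * w i else 0) + (\<Sum>l<Suc n. c * c * w i * w j * (w l)\<^sup>2)"
      unfolding sum_subtractf[symmetric] sum.distrib[symmetric]
      by (rule sum.cong) (auto simp: algebra_simps power2_eq_square)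
    also have "(\<Sum>l<Suc n. c * c * w i * w j * (w l)\<^sup>2) = c * w i * w j * (c * s)"
      unfolding s_def sum_distrib_left by (rule sum.cong) (auto simp: algebra_simps)
    also have "(\<Sum>l<Suc n. (if l = i then (if l = j then 1 else 0) else 0)) = (if i = j then 1 else (0::real))"
      using ij by (subst sum.delta) auto
    also have "(\<Sum>l<Suc n. if l = i then c * w l * w j else 0) = c * w i * w j"
      using ij by (subst sum.delta) auto
    also have "(\<Sum>l<Suc n. if l = j then c * w l * w i else 0) = c * w j * w i"
      using ij by (subst sum.delta) auto
    finally show ?thesis using w0[of i] ij
      by (cases "s = 0") (auto simp: c_def)
  qed
  then have "H\<^sup>T * H = 1\<^sub>m (Suc n)"
    by (intro eq_matI) (auto simp: H_def)
  then show ?thesis using col by (intro bexI[of _ H]) (auto simp: H_def)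
qed

lemma symmetric_real_eigenvector:
  assumes A: "A \<in> carrier_mat (Suc n) (Suc n)" and sym: "A\<^sup>T = (A::real mat)"
  shows "\<exists>v r. (\<Sum>i<Suc n. (v i)\<^sup>2) = 1 \<and> (\<forall>i<Suc n. (\<Sum>j<Suc n. A $$ (i,j) * v j) = r * v i)"
proof -
  let ?N = "Suc n"
  let ?C = "map_mat complex_of_real A"
  have C: "?C \<in> carrier_mat ?N ?N" using A by auto
  have "degree (char_poly ?C) \<noteq> 0" using degree_monic_char_poly[OF C] by auto
  then obtain z where "poly (char_poly ?C) z = 0"
    using fundamental_theorem_of_algebra[of "char_poly ?C"] by (auto simp: constant_degree)
  then have "eigenvalue ?C z" using eigenvalue_root_char_poly[OF C] by simp
  then obtain u where u: "u \<in> carrier_vec ?N" "u \<noteq> 0\<^sub>v ?N" "?C *\<^sub>v u = z \<cdot>\<^sub>v u"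
    using C unfolding eigenvalue_def eigenvector_def by auto
  have sy: "A $$ (i,j) = A $$ (j,i)" if "i < ?N" "j < ?N" for i j
    using sym that A by (metis carrier_matD index_transpose_mat(1))
  define f where "f i = vec_index u i" for i
  have ev: "(\<Sum>j<?N. of_real (A $$ (i,j)) * f j) = z * f i" if "i < ?N" for i
  proof -
    have "vec_index (?C *\<^sub>v u) i = vec_index (z \<cdot>\<^sub>v u) i" using u by simp
    then show ?thesis using that A u(1) by (simp add: scalar_prod_def f_def atLeast0LessThan)
  qed
  have "\<exists>i<?N. f i \<noteq> 0"
  proof (rule ccontr)
    assume "\<not> ?thesis"
    then have "u = 0\<^sub>v ?N" using u(1) by (intro eq_vecI) (auto simp: f_def)
    then show False using u by simp
  qed
  then obtain i0 where i0: "i0 < ?N" "f i0 \<noteq> 0" by blast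
  define S where "S = (\<Sum>i<?N. (cmod (f i))\<^sup>2)"
  have S: "S > 0" unfolding S_def using i0 by (intro sum_pos2[of _ i0]) auto
  define q where "q = (\<Sum>i<?N. \<Sum>j<?N. cnj (f i) * of_real (A $$ (i,j)) * f j)"
  have "q = (\<Sum>i<?N. cnj (f i) * (z * f i))"
    unfolding q_def using ev by (simp add: sum_distrib_left[symmetric] mult.assoc)
  also have "\<dots> = z * of_real S"
    unfolding S_def of_real_sum sum_distrib_left complex_norm_square by (rule sum.cong) auto
  finally have q: "q = z * of_real S" .
  have "cnj q = (\<Sum>i<?N. \<Sum>j<?N. cnj (f j) * of_real (A $$ (j,i)) * f i)"
    unfolding q_def cnj_sum by (intro sum.cong refl) (simp add: sy algebra_simps)
  also have "\<dots> = q" unfolding q_def by (rule sum.swap)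
  finally have "Im q = 0" by (metis cnj.simps(2) neg_equal_zero)
  then have "Im z = 0" using S by (simp add: q)
  then obtain r where r: "z = of_real r" by (metis complex_is_Real_iff Reals_cases)
  have re: "(\<Sum>j<?N. A $$ (i,j) * Re (f j)) = r * Re (f i)" "(\<Sum>j<?N. A $$ (i,j) * Im (f j)) = r * Im (f i)" if "i < ?N" for i
    using arg_cong[OF ev[OF that], of Re] arg_cong[OF ev[OF that], of Im] by (simp_all add: r)
  have "Re (f i0) \<noteq> 0 \<or> Im (f i0) \<noteq> 0" using i0(2) by (auto simp: complex_eq_iff)
  then have "\<exists>g. (\<forall>i<?N. (\<Sum>j<?N. A $$ (i,j) * g j) = r * g i) \<and> g i0 \<noteq> 0"
  proof
    assume "Re (f i0) \<noteq> 0"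
    then show ?thesis using re(1) by (intro exI[of _ "\<lambda>i. Re (f i)"]) simp
  next
    assume "Im (f i0) \<noteq> 0"
    then show ?thesis using re(2) by (intro exI[of _ "\<lambda>i. Im (f i)"]) simp
  qed
  then obtain g where g: "\<And>i. i < ?N \<Longrightarrow> (\<Sum>j<?N. A $$ (i,j) * g j) = r * g i" "g i0 \<noteq> 0"
    by auto
  define s where "s = sqrt (\<Sum>i<?N. (g i)\<^sup>2)"
  have pos: "(\<Sum>i<?N. (g i)\<^sup>2) > 0" using g(2) i0 by (intro sum_pos2[of _ i0]) auto
  then have s: "s > 0" "(\<Sum>i<?N. (g i)\<^sup>2) = s\<^sup>2" unfolding s_def by auto
  show ?thesis
  proof (intro exI conjI allI impI)
    show "(\<Sum>i<?N. (g i / s)\<^sup>2) = 1" using s by (simp add: power_divide sum_divide_distrib[symmetric])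
    show "(\<Sum>j<?N. A $$ (i,j) * (g j / s)) = r * (g i / s)" if "i < ?N" for i
      using g(1)[OF that] by (simp add: sum_divide_distrib[symmetric])
  qed
qed

theorem spectral_theorem:
  assumes "A \<in> carrier_mat n n" "A\<^sup>T = (A::real mat)"
  shows "\<exists>U\<in>carrier_mat n n. \<exists>d. U\<^sup>T * U = 1\<^sub>m n \<and> A = U * mat_diag n d * U\<^sup>T"
  using assms
proof (induction n arbitrary: A)
  case 0
  then show ?case by (intro bexI[of _ A] exI[of _ "\<lambda>_. 0"]) (auto intro!: eq_matI)
next
  case (Suc n)
  let ?N = "Suc n"
  note A = Suc.prems(1)
  from symmetric_real_eigenvector[OF Suc.prems] obtain v r where v: "(\<Sum>i<?N. (v i)\<^sup>2) = 1"
    and r: "\<And>i. i < ?N \<Longrightarrow> (\<Sum>j<?N. A $$ (i,j) * v j) = r * v i" by blast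
  from householder[OF v] obtain H where H: "H \<in> carrier_mat ?N ?N" "H\<^sup>T * H = 1\<^sub>m ?N" "\<And>i. i < ?N \<Longrightarrow> H $$ (i,0) = v i"
    by auto
  have H': "H * H\<^sup>T = 1\<^sub>m ?N" by (rule orthogonal_mat_swap[OF _ H(1,2)]) (use H(1) in auto)
  define B where "B = H\<^sup>T * (A * H)"
  have B: "B \<in> carrier_mat ?N ?N" using A H(1) by (auto simp: B_def)
  have Bsym: "B\<^sup>T = B" unfolding B_def using A H(1)
    by (simp add: mat_transpose_mult_dim mat_mult_assoc_dim Suc.prems(2) del: assoc_mult_mat)
  have AH0: "(A * H) $$ (i,0) = r * H $$ (i,0)" if "i < ?N" for i
  proof -
    have "(A * H) $$ (i,0) = (\<Sum>j<?N. A $$ (i,j) * H $$ (j,0))"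
      using that A H(1) by (subst mult_index_sum) auto
    also have "\<dots> = (\<Sum>j<?N. A $$ (i,j) * v j)"
      by (intro sum.cong) (auto simp: H(3))
    finally show ?thesis using r[OF that] H(3)[OF that] by simp
  qed
  have B0: "B $$ (i,0) = (if i = 0 then r else 0)" if i: "i < ?N" for i
  proof -
    have "B $$ (i,0) = (\<Sum>l<?N. H\<^sup>T $$ (i,l) * (r * H $$ (l,0)))"
      unfolding B_def using i A H(1) by (subst mult_index_sum) (auto simp: AH0 intro!: sum.cong simp del: index_mult_mat(1))
    also have "\<dots> = r * (H\<^sup>T * H) $$ (i,0)"
      using i H(1) by (subst mult_index_sum) (auto simp: sum_distrib_left algebra_simps intro!: sum.cong)
    finally show ?thesis using i by (simp add: H(2))
  qed
  have B0': "B $$ (0,i) = (if i = 0 then r else 0)" if i: "i < ?N" for i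
    using B0[OF i] Bsym B i by (metis carrier_matD index_transpose_mat(1) zero_less_Suc)
  define C where "C = Matrix.mat n n (\<lambda>(i,j). B $$ (Suc i, Suc j))"
  have C: "C \<in> carrier_mat n n" by (simp add: C_def)
  have "C\<^sup>T = C"
  proof (rule eq_matI)
    fix i j assume "i < dim_row C" "j < dim_col C"
    then have ij: "i < n" "j < n" using C by auto
    have "B\<^sup>T $$ (Suc i, Suc j) = B $$ (Suc j, Suc i)" using ij B by auto
    then show "C\<^sup>T $$ (i,j) = C $$ (i,j)" using Bsym ij by (simp add: C_def)
  qed (use C in auto)
  from Suc.IH[OF C this] obtain U d where U: "U \<in> carrier_mat n n" "U\<^sup>T * U = 1\<^sub>m n" "C = U * mat_diag n d * U\<^sup>T"
    by blast
  let ?o = "1\<^sub>m 1 :: real mat" and ?z = "0\<^sub>m 1 n :: real mat" and ?z' = "0\<^sub>m n 1 :: real mat"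
  define F where "F = four_block_mat ?o ?z ?z' U"
  define d' where "d' i = (case i of 0 \<Rightarrow> r | Suc i \<Rightarrow> d i)" for i
  have F: "F \<in> carrier_mat ?N ?N" unfolding F_def using U by auto
  have FT: "F\<^sup>T = four_block_mat ?o ?z ?z' (U\<^sup>T)"
    unfolding F_def using U(1) by (subst transpose_four_block_mat) auto
  have FF: "F\<^sup>T * F = 1\<^sub>m ?N"
    unfolding FT unfolding F_def using U(1,2) by (subst mult_four_block_mat[of _ 1 1 _ n _ n]) (auto intro!: eq_matI)
  have D: "mat_diag ?N d' = four_block_mat (r \<cdot>\<^sub>m ?o) ?z ?z' (mat_diag n d)"
    by (rule eq_matI) (auto simp: d'_def mat_diag_def split: nat.splits)
  have "F * mat_diag ?N d' * F\<^sup>T = four_block_mat (r \<cdot>\<^sub>m ?o) ?z ?z' C"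
  proof -
    have z: "0\<^sub>m (Suc 0) n * mat_diag n d = 0\<^sub>m (Suc 0) n" by (rule left_mult_zero_mat) simp
    have "F * mat_diag ?N d' = four_block_mat (r \<cdot>\<^sub>m ?o) ?z ?z' (U * mat_diag n d)"
      unfolding D F_def using U(1) by (subst mult_four_block_mat) (auto simp: z)
    moreover have "\<dots> * F\<^sup>T = four_block_mat (r \<cdot>\<^sub>m ?o) ?z ?z' C"
    proof -
      have "U * mat_diag n d * ?z' = ?z'" by (rule right_mult_zero_mat) (use U in auto)
      moreover have "0\<^sub>m n n + U * mat_diag n d * U\<^sup>T = U * mat_diag n d * U\<^sup>T"
        by (rule left_add_zero_mat) (use U(1) in auto)
      ultimately show ?thesis
        unfolding FT U(3) using U(1) by (subst mult_four_block_mat[of _ 1 1 _ n _ n]) auto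
    qed
    ultimately show ?thesis by simp
  qed
  also have "\<dots> = B"
    using B C by (intro eq_matI) (auto simp: B0 B0' C_def)
  finally have FB: "F * mat_diag ?N d' * F\<^sup>T = B" .
  have "A = H * B * H\<^sup>T"
    using A H(1) H' by (simp add: B_def mat_mult_assoc_dim invertible_cancel[OF H'])
  also have "\<dots> = (H * F) * mat_diag ?N d' * (H * F)\<^sup>T"
    unfolding FB[symmetric] using F H(1)
    by (simp add: mat_transpose_mult_dim mat_mult_assoc_dim mat_diag_def del: assoc_mult_mat)
  finally have "A = (H * F) * mat_diag ?N d' * (H * F)\<^sup>T" .
  moreover have "(H * F)\<^sup>T * (H * F) = 1\<^sub>m ?N"
    using F H(1) FF by (simp add: mat_mult_assoc_dim mat_transpose_mult_dim invertible_cancel[OF H(2)])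
  ultimately show ?case using F H(1) by (intro bexI[of _ "H * F"] exI[of _ d']) auto
qed

lemma minv:
  assumes A: "A \<in> carrier_mat n n" and d: "det A \<noteq> 0"
  shows "minv A \<in> carrier_mat n n" "A * minv A = 1\<^sub>m n" "minv A * A = 1\<^sub>m n"
    "minv A = (1 / det A) \<cdot>\<^sub>m adj_mat A"
proof -
  let ?B = "(1 / det A) \<cdot>\<^sub>m adj_mat A"
  note adj = adj_mat[OF A]
  have B: "?B \<in> carrier_mat n n" using adj by auto
  have AB: "A * ?B = 1\<^sub>m n" "?B * A = 1\<^sub>m n"
    using adj(2,3) d by (auto simp: mult_smult_distrib[OF A adj(1)] mult_smult_assoc_mat[OF adj(1) A] intro!: eq_matI)
  have "A \<in> Units (ring_mat TYPE(real) n ())"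
    using A B AB unfolding Units_def ring_mat_def by auto
  then obtain C where C: "mat_inverse A = Some C" using mat_inverse(1)[OF A, of "()"] by (cases "mat_inverse A") auto
  note inv = mat_inverse(2)[OF A C]
  have "C * (A * ?B) = C" unfolding AB by (rule right_mult_one_mat) (use inv in auto)
  then have "C = C * (A * ?B)" by (rule sym)
  also have "\<dots> = ?B" using inv A B by (subst assoc_mult_mat[symmetric, of _ n n _ n _ n]) auto
  finally have "C = ?B" .
  then show "minv A \<in> carrier_mat n n" "A * minv A = 1\<^sub>m n" "minv A * A = 1\<^sub>m n" "minv A = ?B"
    using B AB C by (auto simp: minv_def)
qed

lemma minv_unique:
  assumes A: "A \<in> carrier_mat n n" and B: "B \<in> carrier_mat n n" and AB: "A * B = 1\<^sub>m n"
  shows "minv A = B" "det A \<noteq> 0"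
proof -
  show d: "det A \<noteq> 0" using det_mult[OF A B] AB by auto
  note m = minv[OF A d]
  have "minv A * (A * B) = minv A" unfolding AB by (rule right_mult_one_mat) (use m in auto)
  then have "minv A = minv A * (A * B)" by (rule sym)
  also have "\<dots> = B" using m A B by (subst assoc_mult_mat[symmetric, of _ n n _ n _ n]) auto
  finally show "minv A = B" .
qed

definition mv :: "real mat \<Rightarrow> (nat \<Rightarrow> real) \<Rightarrow> nat \<Rightarrow> real" where
  "mv A x i = (\<Sum>j<dim_col A. A $$ (i, j) * x j)"

definition qf :: "nat \<Rightarrow> real mat \<Rightarrow> (nat \<Rightarrow> real) \<Rightarrow> real" where
  "qf n A x = (\<Sum>i<n. \<Sum>j<n. x i * A $$ (i, j) * x j)"

lemma vec_mv: "A \<in> carrier_mat m n \<Longrightarrow> Matrix.vec m (mv A x) = A *\<^sub>v Matrix.vec n x"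
  by (rule eq_vecI) (auto simp: mv_def scalar_prod_def atLeast0LessThan)

lemma qf_scalar_prod: "A \<in> carrier_mat n n \<Longrightarrow> qf n A x = scalar_prod (Matrix.vec n x) (A *\<^sub>v Matrix.vec n x)"
  by (auto simp: qf_def scalar_prod_def atLeast0LessThan sum_distrib_left mult.assoc intro!: sum.cong)

lemma qf_cong: "(\<And>i. i < n \<Longrightarrow> x i = y i) \<Longrightarrow> qf n A x = qf n A y"
  by (simp add: qf_def)

lemma mv_mult:
  assumes "A \<in> carrier_mat m n" "B \<in> carrier_mat n l" "i < m"
  shows "mv (A * B) x i = mv A (mv B x) i"
proof -
  have "Matrix.vec m (mv (A * B) x) = Matrix.vec m (mv A (mv B x))"
    using assms(1,2) by (simp add: vec_mv[OF mult_carrier_mat[OF assms(1,2)]] vec_mv[OF assms(1)] vec_mv[OF assms(2)])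
  then have "vec_index (Matrix.vec m (mv (A * B) x)) i = vec_index (Matrix.vec m (mv A (mv B x))) i" by simp
  then show ?thesis using assms(3) by simp
qed

lemma mv_one: "i < n \<Longrightarrow> mv (1\<^sub>m n) x i = x i"
  by (simp add: mv_def if_distrib[of "\<lambda>a. a * _"] cong: if_cong)

lemma qf_congruence:
  assumes A: "A \<in> carrier_mat m m" and T: "T \<in> carrier_mat m n"
  shows "qf n (T\<^sup>T * (A * T)) x = qf m A (mv T x)"
proof -
  have c: "T\<^sup>T * (A * T) \<in> carrier_mat n n" using A T by auto
  have "(T\<^sup>T * (A * T)) *\<^sub>v Matrix.vec n x = T\<^sup>T *\<^sub>v (A *\<^sub>v (T *\<^sub>v Matrix.vec n x))"
    using A T by (simp add: assoc_mult_mat_vec[of _ n m _ n] assoc_mult_mat_vec[of _ m m _ n])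
  then show ?thesis
    unfolding qf_scalar_prod[OF c] qf_scalar_prod[OF A] vec_mv[OF T]
    using transpose_vec_mult_scalar[OF T, of "Matrix.vec n x" "A *\<^sub>v (T *\<^sub>v Matrix.vec n x)"] A T
    by (simp add: comm_scalar_prod[of _ n] comm_scalar_prod[of _ m])
qed

lemma qf_diag: "qf n (mat_diag n d) x = (\<Sum>i<n. d i * (x i)\<^sup>2)"
  unfolding qf_def mat_diag_def
  by (intro sum.cong refl) (simp add: if_distrib[of "\<lambda>a. a * _"] if_distrib[of "\<lambda>a. _ * a"] power2_eq_square mult_ac cong: if_cong)

lemma qf_one: "qf n (1\<^sub>m n) x = (\<Sum>i<n. (x i)\<^sup>2)"
  using qf_diag[of n "\<lambda>_. 1" x] by (simp add: mat_diag_def one_mat_def)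

lemma qf_gram: "G \<in> carrier_mat n p \<Longrightarrow> qf p (G\<^sup>T * G) x = (\<Sum>i<n. (mv G x i)\<^sup>2)"
  using qf_congruence[of "1\<^sub>m n" n G p x] by (simp add: qf_one)

lemma pos_def_iff_qf:
  "pos_def n A \<longleftrightarrow> A \<in> carrier_mat n n \<and> A\<^sup>T = A \<and> (\<forall>x. (\<exists>i<n. x i \<noteq> 0) \<longrightarrow> qf n A x > 0)"
proof (cases "A \<in> carrier_mat n n \<and> A\<^sup>T = A")
  case True
  then have A: "A \<in> carrier_mat n n" by simp
  have nz: "Matrix.vec n x \<noteq> 0\<^sub>v n \<longleftrightarrow> (\<exists>i<n. x i \<noteq> 0)" for x :: "nat \<Rightarrow> real"
    by (auto simp: vec_eq_iff)
  have "(\<forall>v\<in>carrier_vec n. v \<noteq> 0\<^sub>v n \<longrightarrow> scalar_prod v (A *\<^sub>v v) > 0) \<longleftrightarrow> (\<forall>x. (\<exists>i<n. x i \<noteq> 0) \<longrightarrow> qf n A x > 0)"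
    unfolding qf_scalar_prod[OF A] nz[symmetric]
  proof (intro iffI allI ballI impI)
    fix v :: "real Matrix.vec" assume *: "\<forall>x. Matrix.vec n x \<noteq> 0\<^sub>v n \<longrightarrow> 0 < scalar_prod (Matrix.vec n x) (A *\<^sub>v Matrix.vec n x)"
      and v: "v \<in> carrier_vec n" "v \<noteq> 0\<^sub>v n"
    have "Matrix.vec n (vec_index v) = v" using v by (intro eq_vecI) auto
    then show "0 < scalar_prod v (A *\<^sub>v v)" using *[rule_format, of "vec_index v"] v by simp
  qed auto
  then show ?thesis using True by (simp add: pos_def_def)
qed (auto simp: pos_def_def)

lemma pos_defI: "A \<in> carrier_mat n n \<Longrightarrow> A\<^sup>T = A \<Longrightarrow> (\<And>x. \<exists>i<n. x i \<noteq> 0 \<Longrightarrow> qf n A x > 0) \<Longrightarrow> pos_def n A"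
  unfolding pos_def_iff_qf by blast

lemma pos_defD:
  assumes "pos_def n A"
  shows "A \<in> carrier_mat n n" "A\<^sup>T = A" "\<exists>i<n. x i \<noteq> 0 \<Longrightarrow> qf n A x > 0"
  using assms unfolding pos_def_iff_qf by blast+

definition spectral :: "nat \<Rightarrow> real mat \<Rightarrow> (nat \<Rightarrow> real) \<Rightarrow> real mat" where
  "spectral n U d = U * mat_diag n d * U\<^sup>T"

locale orth =
  fixes n :: nat and U :: "real mat"
  assumes U: "U \<in> carrier_mat n n" and UU: "U\<^sup>T * U = 1\<^sub>m n"
begin

lemma UU': "U * U\<^sup>T = 1\<^sub>m n"
  by (rule orthogonal_mat_swap[OF _ U UU]) (use U in simp)

lemma carrier [simp]: "spectral n U d \<in> carrier_mat n n"
  unfolding spectral_def by (rule carrier_matI) (use U in auto)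

lemma sym: "(spectral n U d)\<^sup>T = spectral n U d"
  unfolding spectral_def using U by (simp add: mat_transpose_mult_dim mat_mult_assoc_dim del: assoc_mult_mat)

lemma mult: "spectral n U d * spectral n U e = spectral n U (\<lambda>i. d i * e i)"
proof -
  have "spectral n U d * spectral n U e = U * (mat_diag n d * (U\<^sup>T * (U * (mat_diag n e * U\<^sup>T))))"
    unfolding spectral_def using U mat_diag_dim[of n d] mat_diag_dim[of n e]
    by (simp add: mat_mult_assoc_dim del: assoc_mult_mat mat_diag_diag)
  also have "U\<^sup>T * (U * (mat_diag n e * U\<^sup>T)) = mat_diag n e * U\<^sup>T"
    by (rule invertible_cancel[OF UU, of n]) (use U mat_diag_dim[of n e] in \<open>auto simp del: mat_diag_dim\<close>)
  also have "U * (mat_diag n d * (mat_diag n e * U\<^sup>T)) = U * (mat_diag n d * mat_diag n e) * U\<^sup>T"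
    using U mat_diag_dim[of n d] mat_diag_dim[of n e]
    by (simp add: mat_mult_assoc_dim del: assoc_mult_mat mat_diag_diag)
  finally show ?thesis by (simp add: spectral_def)
qed

lemma one: "spectral n U (\<lambda>_. 1) = 1\<^sub>m n"
proof -
  have "mat_diag n (\<lambda>_. 1::real) = 1\<^sub>m n" by (rule eq_matI) (auto simp: mat_diag_def)
  then show ?thesis using U UU' by (simp add: spectral_def)
qed

lemma det: "det (spectral n U d) = (\<Prod>i<n. d i)"
proof -
  have "det (spectral n U d) = det U * det (mat_diag n d) * det (U\<^sup>T)"
    unfolding spectral_def using U by (simp add: det_mult[of _ n])
  moreover have "det U * det (U\<^sup>T) = 1" using U UU' by (subst det_mult[symmetric]) auto
  ultimately show ?thesis by (simp add: det_mat_diag mult.commute mult.left_commute)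
qed

lemma qf: "qf n (spectral n U d) x = (\<Sum>i<n. d i * (mv (U\<^sup>T) x i)\<^sup>2)"
  using qf_congruence[of "mat_diag n d" n "U\<^sup>T" n x] U
  by (simp add: spectral_def qf_diag mat_mult_assoc_dim del: assoc_mult_mat)

lemma mv_nonzero: "\<exists>i<n. x i \<noteq> 0 \<Longrightarrow> \<exists>i<n. mv (U\<^sup>T) x i \<noteq> 0"
proof (rule ccontr)
  assume x: "\<exists>i<n. x i \<noteq> 0" and "\<not> (\<exists>i<n. mv (U\<^sup>T) x i \<noteq> 0)"
  then have "(\<Sum>i<n. 1 * (mv (U\<^sup>T) x i)\<^sup>2) = 0" by simp
  then have "(\<Sum>i<n. (x i)\<^sup>2) = 0" using qf[of "\<lambda>_. 1" x] by (simp add: one qf_one)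
  then show False using x by (subst (asm) sum_nonneg_eq_0_iff) auto
qed

lemma pos_def: "(\<And>i. i < n \<Longrightarrow> d i > 0) \<Longrightarrow> pos_def n (spectral n U d)"
proof (rule pos_defI[OF carrier sym])
  fix x :: "nat \<Rightarrow> real" assume d: "\<And>i. i < n \<Longrightarrow> d i > 0" and x: "\<exists>i<n. x i \<noteq> 0"
  then obtain i where "i < n" "mv (U\<^sup>T) x i \<noteq> 0" using mv_nonzero by blast
  then show "qf n (spectral n U d) x > 0"
    unfolding qf using d by (intro sum_pos2[of _ i]) (auto simp: less_imp_le)
qed

lemma spectral_cong: "(\<And>i. i < n \<Longrightarrow> d i = e i) \<Longrightarrow> spectral n U d = spectral n U e"
proof -
  assume "\<And>i. i < n \<Longrightarrow> d i = e i"
  then have "mat_diag n d = mat_diag n e" by (intro eq_matI) (auto simp: mat_diag_def)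
  then show ?thesis by (simp add: spectral_def)
qed

lemma spectral_minv: "(\<And>i. i < n \<Longrightarrow> d i \<noteq> 0) \<Longrightarrow> minv (spectral n U d) = spectral n U (\<lambda>i. 1 / d i)"
  by (rule minv_unique[of _ n]) (auto simp: mult one[symmetric] intro!: spectral_cong)

lemma entry: "i < n \<Longrightarrow> j < n \<Longrightarrow> spectral n U d $$ (i, j) = (\<Sum>l<n. d l * U $$ (i,l) * U $$ (j,l))"
  unfolding spectral_def using U
  by (subst mult_index_sum) (auto simp: mat_diag_mult_right[OF U] mult_ac intro!: sum.cong)

lemma minus: "spectral n U d - spectral n U e = spectral n U (\<lambda>i. d i - e i)"
  by (rule eq_matI) (auto simp: carrier_matD[OF carrier] entry sum_subtractf algebra_simps simp del: carrier)

lemma plus: "spectral n U d + spectral n U e = spectral n U (\<lambda>i. d i + e i)"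
  by (rule eq_matI) (auto simp: carrier_matD[OF carrier] entry sum.distrib algebra_simps simp del: carrier)

lemma smult: "c \<cdot>\<^sub>m spectral n U d = spectral n U (\<lambda>i. c * d i)"
  by (rule eq_matI) (auto simp: carrier_matD[OF carrier] entry sum_distrib_left algebra_simps simp del: carrier)

lemma col_eigen: "j < n \<Longrightarrow> i < n \<Longrightarrow> mv (spectral n U d) (\<lambda>l. U $$ (l, j)) i = d j * U $$ (i, j)"
proof -
  assume ij: "j < n" "i < n"
  have "spectral n U d * U = U * mat_diag n d"
    unfolding spectral_def using U UU mat_diag_dim[of n d]
    by (simp add: mat_mult_assoc_dim del: assoc_mult_mat mat_diag_diag)
  then have "(spectral n U d * U) $$ (i, j) = d j * U $$ (i, j)"
    using ij U by (simp add: mat_diag_mult_right[OF U])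
  then show ?thesis using ij U by (simp add: mv_def carrier_matD[OF carrier] mult_index_sum del: index_mult_mat(1))
qed

end

lemma symmetric_spectral:
  assumes "A \<in> carrier_mat n n" "A\<^sup>T = A"
  obtains U d where "orth n U" "A = spectral n U d"
  using spectral_theorem[OF assms] unfolding orth_def spectral_def by blast

lemma pos_def_spectral:
  assumes "pos_def n A"
  obtains U d where "orth n U" "A = spectral n U d" "\<And>i. i < n \<Longrightarrow> d i > 0"
proof -
  obtain U d where 1: "orth n U" and A: "A = spectral n U d"
    using symmetric_spectral[OF pos_defD(1,2)[OF assms]] .
  interpret orth n U by fact
  have "d i > 0" if i: "i < n" for i
  proof -
    define x where "x l = U $$ (l, i)" for l
    have x: "mv (U\<^sup>T) x l = (if l = i then 1 else 0)" if "l < n" for l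
    proof -
      have "mv (U\<^sup>T) x l = (U\<^sup>T * U) $$ (l, i)"
        using U i that by (subst mult_index_sum) (auto simp: mv_def x_def)
      then show ?thesis using that i by (simp add: UU)
    qed
    have "\<exists>l<n. x l \<noteq> 0"
    proof (rule ccontr)
      assume "\<not> ?thesis"
      then have "mv (U\<^sup>T) x i = 0" using U i by (simp add: mv_def)
      then show False using x[OF i] by simp
    qed
    then have "qf n A x > 0" using pos_defD(3)[OF assms] by blast
    also have "qf n A x = (\<Sum>l<n. if l = i then d l else 0)"
      unfolding A qf by (intro sum.cong) (auto simp: x)
    finally show ?thesis using i by simp
  qed
  with that 1 A show thesis by blast
qed

lemma pos_def_det: "pos_def n A \<Longrightarrow> det A > 0"
  by (erule pos_def_spectral) (auto simp: orth.det intro!: prod_pos)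

lemma pd_sqrt_unique:
  assumes B: "pos_def n B" and C: "pos_def n C" and eq: "B * B = C * C"
  shows "B = C"
proof -
  obtain U b where U: "orth n U" and Bs: "B = spectral n U b" and b: "\<And>i. i < n \<Longrightarrow> b i > 0"
    using pos_def_spectral[OF B] by metis
  interpret orth n U by fact
  note Cc = pos_defD(1)[OF C]
  define E where "E = U\<^sup>T * (C * U)"
  have E: "E \<in> carrier_mat n n" using U Cc by (auto simp: E_def orth_def)
  have Un: "U \<in> carrier_mat n n" "U\<^sup>T \<in> carrier_mat n n" using U by (auto simp: orth_def)
  have CE: "C = U * E * U\<^sup>T"
    unfolding E_def using Un Cc
    by (simp add: mat_mult_assoc_dim UU' invertible_cancel[OF UU' Un] del: assoc_mult_mat)
  have BD: "mat_diag n b = U\<^sup>T * (B * U)"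
    unfolding Bs spectral_def using Un mat_diag_dim[of n b]
    by (simp add: mat_mult_assoc_dim UU invertible_cancel[OF UU Un(2,1)] del: assoc_mult_mat mat_diag_diag)
  have EE: "E * E = U\<^sup>T * (C * C * U)"
    unfolding E_def using Un Cc
    by (simp add: mat_mult_assoc_dim invertible_cancel[OF UU' Un] del: assoc_mult_mat)
  also have "\<dots> = mat_diag n b * mat_diag n b"
    unfolding BD eq[symmetric] using Un pos_defD(1)[OF B]
    by (simp add: mat_mult_assoc_dim invertible_cancel[OF UU' Un] del: assoc_mult_mat)
  finally have EE: "E * E = mat_diag n (\<lambda>i. b i * b i)" by simp
  have comm: "E * (E * E) = (E * E) * E" using E by simp
  have off: "E $$ (i,j) * b i = E $$ (i,j) * b j" if ij: "i < n" "j < n" for i j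
  proof -
    have "E $$ (i,j) * (b j * b j) = (b i * b i) * E $$ (i,j)"
      using arg_cong[OF comm, of "\<lambda>M. M $$ (i,j)"] ij E unfolding EE
      by (simp add: mat_diag_mult_right[OF E] mat_diag_mult_left[OF E])
    then have "E $$ (i,j) * ((b j - b i) * (b j + b i)) = 0" by (simp add: algebra_simps)
    moreover have "b j + b i \<noteq> 0" using b[OF ij(1)] b[OF ij(2)] by simp
    ultimately show ?thesis by auto
  qed
  then have off': "E $$ (i,j) = 0 \<or> b j = b i" if "i < n" "j < n" for i j using that by fastforce
  let ?D = "mat_diag n b"
  have DE: "E * ?D = ?D * E"
    using off' E by (intro eq_matI) (simp_all add: mat_diag_mult_right[OF E] mat_diag_mult_left[OF E] mult.commute del: mult_cancel_left)
  have P: "pos_def n (E + ?D)"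
  proof (rule pos_defI)
    show "(E + ?D)\<^sup>T = E + ?D"
      using E Un Cc pos_defD(2)[OF C]
      by (subst transpose_add[of _ n n]) (auto simp: E_def mat_transpose_mult_dim mat_mult_assoc_dim simp del: assoc_mult_mat)
    fix x :: "nat \<Rightarrow> real" assume x: "\<exists>i<n. x i \<noteq> 0"
    then obtain i0 where i0: "i0 < n" "x i0 \<noteq> 0" by blast
    interpret o': orth n "U\<^sup>T" using Un UU' by unfold_locales auto
    have "qf n (E + ?D) x = qf n E x + qf n ?D x"
      using E mat_diag_dim[of n b] by (simp add: qf_def sum.distrib algebra_simps del: mat_diag_dim)
    also have "qf n E x = qf n C (mv U x)" unfolding E_def by (rule qf_congruence[OF Cc Un(1)])
    finally have "qf n (E + ?D) x = qf n C (mv U x) + (\<Sum>i<n. b i * (x i)\<^sup>2)" by (simp add: qf_diag)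
    moreover have "qf n C (mv U x) > 0" using pos_defD(3)[OF C, of "mv U x"] o'.mv_nonzero[OF x] by simp
    moreover have "(\<Sum>i<n. b i * (x i)\<^sup>2) \<ge> 0" using b by (intro sum_nonneg) (simp add: less_imp_le)
    ultimately show "qf n (E + ?D) x > 0" by linarith
  qed (use E in auto)
  have M: "(E + ?D) * (E - ?D) = 0\<^sub>m n n"
  proof -
    have "(E + ?D) * (E - ?D) = E * E - E * ?D + (?D * E - ?D * ?D)"
      using E by (subst add_mult_distrib_mat[of _ n n]) (auto simp: mult_minus_distrib_mat[of _ n n])
    also have "\<dots> = 0\<^sub>m n n" unfolding EE DE mat_diag_diag using E
      by (intro eq_matI) (auto simp: mat_diag_mult_left[OF E] mat_diag_def)
    finally show ?thesis .
  qed
  note inv = minv[OF pos_defD(1)[OF P] pos_def_det[OF P, THEN less_imp_neq, THEN not_sym]]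
  have "E - ?D = minv (E + ?D) * ((E + ?D) * (E - ?D))"
    by (rule invertible_cancel[symmetric, OF inv(3,1) pos_defD(1)[OF P]]) (use E in \<open>auto simp: mat_diag_def\<close>)
  also have "\<dots> = 0\<^sub>m n n" unfolding M using inv(1) by simp
  finally have Z: "E - ?D = 0\<^sub>m n n" .
  have "E = ?D"
  proof (rule eq_matI)
    fix i j assume "i < dim_row ?D" "j < dim_col ?D"
    then have ij: "i < n" "j < n" by (auto simp: mat_diag_def)
    then show "E $$ (i,j) = ?D $$ (i,j)"
      using arg_cong[OF Z, of "\<lambda>M. M $$ (i,j)"] E by (simp add: mat_diag_def)
  qed (use E in \<open>auto simp: mat_diag_def\<close>)
  then show ?thesis using CE by (simp add: Bs spectral_def)
qed

lemma (in orth) pd_sqrt: "(\<And>i. i < n \<Longrightarrow> d i > 0) \<Longrightarrow> pd_sqrt (spectral n U d) = spectral n U (\<lambda>i. sqrt (d i))"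
proof -
  assume d: "\<And>i. i < n \<Longrightarrow> d i > 0"
  have 1: "pos_def n (spectral n U (\<lambda>i. sqrt (d i)))" using d by (intro pos_def) auto
  have 2: "spectral n U (\<lambda>i. sqrt (d i)) * spectral n U (\<lambda>i. sqrt (d i)) = spectral n U d"
    unfolding mult using d by (intro spectral_cong) (simp add: less_imp_le)
  show ?thesis unfolding pd_sqrt_def carrier_matD[OF carrier]
    using 1 2 pd_sqrt_unique by (intro the_equality) auto
qed

lemma (in orth) inv_sqrt: "(\<And>i. i < n \<Longrightarrow> d i > 0) \<Longrightarrow> inv_sqrt (spectral n U d) = spectral n U (\<lambda>i. 1 / sqrt (d i))"
  unfolding inv_sqrt_def by (subst pd_sqrt) (auto simp: less_imp_neq[THEN not_sym] intro!: spectral_minv)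

lemma inv_sqrt_pos_def:
  assumes S: "pos_def n S"
  shows "inv_sqrt S \<in> carrier_mat n n" "(inv_sqrt S)\<^sup>T = inv_sqrt S" "inv_sqrt S * S * inv_sqrt S = 1\<^sub>m n"
    "inv_sqrt S * inv_sqrt S = minv S"
proof -
  obtain U d where U: "orth n U" and Ss: "S = spectral n U d" and d: "\<And>i. i < n \<Longrightarrow> d i > 0"
    using pos_def_spectral[OF S] by metis
  interpret orth n U by fact
  have i: "inv_sqrt (spectral n U d) = spectral n U (\<lambda>i. 1 / sqrt (d i))" using d by (rule inv_sqrt)
  show "inv_sqrt S \<in> carrier_mat n n" "(inv_sqrt S)\<^sup>T = inv_sqrt S" unfolding Ss i by (auto simp: sym)
  show "inv_sqrt S * S * inv_sqrt S = 1\<^sub>m n"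
    unfolding Ss i mult one[symmetric]
  proof (rule spectral_cong)
    fix i assume "i < n"
    then have "d i > 0" by (rule d)
    then show "1 / sqrt (d i) * d i * (1 / sqrt (d i)) = 1" by (simp add: field_simps)
  qed
  have "d i \<noteq> 0" if "i < n" for i using d[OF that] by simp
  then show "inv_sqrt S * inv_sqrt S = minv S"
    unfolding Ss i mult using d by (subst spectral_minv) (auto intro!: spectral_cong simp: less_imp_le)
qed

lemma simultaneous_diagonalization:
  assumes W: "pos_def p W" and A: "A \<in> carrier_mat p p" "A\<^sup>T = A"
  obtains T e where "T \<in> carrier_mat p p" "T\<^sup>T * (W * T) = 1\<^sub>m p" "T\<^sup>T * (A * T) = mat_diag p e"
proof -
  define R where "R = inv_sqrt W"
  note R = inv_sqrt_pos_def(1-3)[OF W, folded R_def]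
  note Wc = pos_defD(1)[OF W]
  have "R * A * R \<in> carrier_mat p p" "(R * A * R)\<^sup>T = R * A * R"
    using R(1,2) A by (auto simp: mat_transpose_mult_dim mat_mult_assoc_dim simp del: assoc_mult_mat)
  then obtain U e where U: "orth p U" and e: "R * A * R = spectral p U e"
    using symmetric_spectral by blast
  interpret orth p U by fact
  show thesis
  proof (rule that)
    show "R * U \<in> carrier_mat p p" using R(1) U by (simp add: orth_def)
    have "(R * U)\<^sup>T * (W * (R * U)) = U\<^sup>T * (R * W * R * U)"
      using R(1,2) U Wc by (simp add: orth_def mat_transpose_mult_dim mat_mult_assoc_dim del: assoc_mult_mat)
    then show "(R * U)\<^sup>T * (W * (R * U)) = 1\<^sub>m p"
      unfolding R(3) using U UU by (simp add: orth_def)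
    have "(R * U)\<^sup>T * (A * (R * U)) = U\<^sup>T * (R * A * R * U)"
      using R(1,2) U A by (simp add: orth_def mat_transpose_mult_dim mat_mult_assoc_dim del: assoc_mult_mat)
    also have "\<dots> = U\<^sup>T * (U * (mat_diag p e * (U\<^sup>T * U)))"
      unfolding e spectral_def using U by (simp add: orth_def mat_mult_assoc_dim del: assoc_mult_mat)
    also have "\<dots> = mat_diag p e"
      using U UU by (subst invertible_cancel[of _ _ p p]) (auto simp: orth_def)
    finally show "(R * U)\<^sup>T * (A * (R * U)) = mat_diag p e" .
  qed
qed

lemma underdetermined_system:
  fixes c :: "nat \<Rightarrow> nat \<Rightarrow> real"
  assumes "finite I" "card I < g"
  shows "\<exists>y. (\<exists>a<g. y a \<noteq> 0) \<and> (\<forall>i\<in>I. (\<Sum>a<g. c i a * y a) = 0)"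
proof -
  obtain f where f: "bij_betw f {..<card I} I"
    using ex_bij_betw_nat_finite[OF assms(1)] by (auto simp: atLeast0LessThan)
  define M where "M = Matrix.mat g g (\<lambda>(i,a). if i < card I then c (f i) a else 0)"
  have M: "M \<in> carrier_mat g g" by (simp add: M_def)
  have "M\<^sup>T *\<^sub>v unit_vec g (card I) = 0\<^sub>v g"
    using assms(2) by (intro eq_vecI) (auto simp: M_def)
  then have "det (M\<^sup>T) = 0"
    using assms(2) M by (subst det_0_iff_vec_prod_zero[of _ g]) (auto intro!: exI[of _ "unit_vec g (card I)"])
  then have "det M = 0" using det_transpose[OF M] by simp
  then obtain v where v: "v \<in> carrier_vec g" "v \<noteq> 0\<^sub>v g" "M *\<^sub>v v = 0\<^sub>v g"
    using det_0_iff_vec_prod_zero[OF M] by blast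
  show ?thesis
  proof (intro exI[of _ "vec_index v"] conjI ballI)
    show "\<exists>a<g. vec_index v a \<noteq> 0" using v(1,2) by (auto simp: vec_eq_iff)
    fix i assume "i \<in> I"
    then obtain l where l: "l < card I" "i = f l" using f unfolding bij_betw_def by blast
    have "vec_index (M *\<^sub>v v) l = 0" using v(3) l assms(2) by simp
    then show "(\<Sum>a<g. c i a * vec_index v a) = 0"
      using l assms(2) v(1) by (simp add: M_def scalar_prod_def atLeast0LessThan)
  qed
qed

text \<open>Courant--Fischer counting: if \<open>A\<close> dominates \<open>W\<close>, and dominates \<open>(1 + t) W\<close> on the image of the
  \<open>g\<close>-dimensional map \<open>V\<close>, then at least \<open>g\<close> eigenvalues of \<open>A\<close> relative to \<open>W\<close> are \<open>\<ge> 1 + t\<close>.\<close>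

lemma det_ge_of_qf_ge_on_subspace:
  assumes W: "pos_def p W" and A: "A \<in> carrier_mat p p" "A\<^sup>T = A"
    and V: "V \<in> carrier_mat p g"
    and ge: "\<And>x. qf p A x \<ge> qf p W x" and t: "t \<ge> 0"
    and ge_V: "\<And>y. qf p A (mv V y) \<ge> (1 + t) * qf p W (mv V y)"
    and inj: "\<And>y. \<exists>a<g. y a \<noteq> 0 \<Longrightarrow> \<exists>i<p. mv V y i \<noteq> 0"
  shows "det A \<ge> (1 + t) ^ g * det W"
proof -
  obtain T e where T: "T \<in> carrier_mat p p" and TW: "T\<^sup>T * (W * T) = 1\<^sub>m p" and TA: "T\<^sup>T * (A * T) = mat_diag p e"
    using simultaneous_diagonalization[OF W A] .
  note Wc = pos_defD(1)[OF W]
  have qW: "qf p W (mv T z) = (\<Sum>i<p. (z i)\<^sup>2)" for z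
    using qf_congruence[OF Wc T, of z] by (simp add: TW qf_one)
  have qA: "qf p A (mv T z) = (\<Sum>i<p. e i * (z i)\<^sup>2)" for z
    using qf_congruence[OF A(1) T, of z] by (simp add: TA qf_diag)
  have e1: "e i \<ge> 1" if "i < p" for i
    using ge[of "mv T (\<lambda>l. if l = i then 1 else 0)"] that
    by (simp add: qW qA if_distrib[of "\<lambda>a. a\<^sup>2"] if_distrib[of "\<lambda>a. _ * a"] cong: if_cong)
  define I where "I = {i. i < p \<and> e i \<ge> 1 + t}"
  have fI: "finite I" by (simp add: I_def)
  have Ti: "T\<^sup>T * W * T = 1\<^sub>m p"
    using TW T Wc by (simp add: mat_mult_assoc_dim del: assoc_mult_mat)
  have "card I \<ge> g"
  proof (rule ccontr)
    assume "\<not> card I \<ge> g"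
    let ?N = "T\<^sup>T * W * V"
    have Nc: "?N \<in> carrier_mat p g" using T Wc V by simp
    obtain y where y: "\<exists>a<g. y a \<noteq> 0" and y0: "\<And>i. i \<in> I \<Longrightarrow> mv ?N y i = 0"
      using underdetermined_system[OF fI, of g "\<lambda>i a. ?N $$ (i,a)"] \<open>\<not> card I \<ge> g\<close> Nc
      unfolding mv_def by (metis carrier_matD(2) not_le)
    define z where "z = mv ?N y"
    have TT: "T * (T\<^sup>T * W) = 1\<^sub>m p"
      by (rule orthogonal_mat_swap[OF _ T Ti]) (use T Wc in simp)
    have TN: "T * ?N = V"
      using T Wc V by (subst invertible_cancel[OF TT]) auto
    have x: "mv T z i = mv V y i" if "i < p" for i
      unfolding z_def using mv_mult[OF T Nc that, of y] by (simp add: TN)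
    have "\<exists>i<p. mv T z i \<noteq> 0" using inj[OF y] x by auto
    then have "qf p W (mv T z) > 0" using pos_defD(3)[OF W, of "mv T z"] by blast
    then have "\<exists>i<p. z i \<noteq> 0" unfolding qW by (metis (mono_tags, lifting) lessThan_iff less_irrefl power_zero_numeral sum.neutral)
    then obtain i0 where i0: "i0 < p" "z i0 \<noteq> 0" by blast
    have "(\<Sum>i<p. e i * (z i)\<^sup>2) < (\<Sum>i<p. (1 + t) * (z i)\<^sup>2)"
    proof (rule sum_strict_mono_ex1; (intro ballI bexI[of _ i0])?)
      fix i assume "i \<in> {..<p}"
      then show "e i * (z i)\<^sup>2 \<le> (1 + t) * (z i)\<^sup>2"
        using y0[of i] by (cases "i \<in> I") (auto simp: I_def z_def intro!: mult_right_mono)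
    next
      show "i0 \<in> {..<p}" using i0 by simp
      show "e i0 * (z i0)\<^sup>2 < (1 + t) * (z i0)\<^sup>2"
        using y0[of i0] i0 by (cases "i0 \<in> I") (auto simp: I_def z_def)
    qed simp
    also have "\<dots> = (1 + t) * qf p W (mv T z)" by (simp add: qW sum_distrib_left)
    also have "\<dots> = (1 + t) * qf p W (mv V y)" using qf_cong[of p "mv T z" "mv V y", OF x] by simp
    also have "\<dots> \<le> qf p A (mv V y)" by (rule ge_V)
    also have "\<dots> = qf p A (mv T z)" using qf_cong[of p "mv T z" "mv V y", OF x] by simp
    finally show False by (simp add: qA)
  qed
  have dW: "det W * (det T)\<^sup>2 = 1"
    using arg_cong[OF TW, of det] T Wc by (simp add: det_mult[of _ p] det_transpose[OF T] power2_eq_square mult_ac)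
  have dA: "det A * (det T)\<^sup>2 = (\<Prod>i<p. e i)"
    using arg_cong[OF TA, of det] T A by (simp add: det_mult[of _ p] det_transpose[OF T] det_mat_diag power2_eq_square mult_ac)
  have "(1 + t) ^ g \<le> (1 + t) ^ card I" using \<open>card I \<ge> g\<close> t by (intro power_increasing) auto
  also have "\<dots> = (\<Prod>i\<in>I. 1 + t)" by simp
  also have "\<dots> \<le> (\<Prod>i\<in>I. e i)" using t by (intro prod_mono) (auto simp: I_def)
  also have "\<dots> \<le> (\<Prod>i\<in>I. e i) * (\<Prod>i\<in>{..<p} - I. e i)"
  proof -
    have "1 \<le> (\<Prod>i\<in>{..<p} - I. e i)" using e1 by (intro prod_ge_1) auto
    moreover have "0 \<le> (\<Prod>i\<in>I. e i)" using e1 by (intro prod_nonneg) (force simp: I_def)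
    ultimately show ?thesis by (simp add: mult_le_cancel_left1)
  qed
  also have "\<dots> = (\<Prod>i<p. e i)"
    by (subst prod.subset_diff[of I "{..<p}"]) (auto simp: I_def mult.commute)
  finally have "(1 + t) ^ g \<le> det A * (det T)\<^sup>2" by (simp add: dA)
  then have "(1 + t) ^ g * det W \<le> det A * (det T)\<^sup>2 * det W"
    using pos_def_det[OF W] by (intro mult_right_mono) auto
  also have "\<dots> = det A" using dW by (simp add: mult_ac)
  finally show ?thesis .
qed

lemma det_rank_one_downdate:
  assumes S: "S \<in> carrier_mat p p" and d: "det S \<noteq> 0"
  shows "det (Matrix.mat p p (\<lambda>(a,b). S $$ (a,b) - g a * g b)) = det S * (1 - qf p (minv S) g)"
proof -
  note m = minv[OF S d]
  define G where "G = Matrix.mat p 1 (\<lambda>(a,b). g a :: real)"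
  have G: "G \<in> carrier_mat p 1" "G\<^sup>T \<in> carrier_mat 1 p" by (simp_all add: G_def)
  let ?A = "Matrix.mat p p (\<lambda>(a,b). S $$ (a,b) - g a * g b)"
  have A: "?A \<in> carrier_mat p p" by simp
  have AG: "?A + G * G\<^sup>T = S"
    using S by (intro eq_matI) (auto simp: G_def scalar_prod_def)
  let ?s = "Matrix.mat 1 1 (\<lambda>_. 1 - qf p (minv S) g)"
  have GS: "G\<^sup>T * (minv S * G) + ?s = 1\<^sub>m 1"
  proof (rule eq_matI)
    fix i j assume "i < dim_row (1\<^sub>m 1 :: real mat)" "j < dim_col (1\<^sub>m 1 :: real mat)"
    then have ij: "i = 0" "j = 0" by auto
    have "(G\<^sup>T * (minv S * G)) $$ (0,0) = qf p (minv S) g"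
      using m(1) by (subst mult_index_sum) (auto simp: G_def qf_def scalar_prod_def atLeast0LessThan sum_distrib_left mult.assoc intro!: sum.cong)
    then show "(G\<^sup>T * (minv S * G) + ?s) $$ (i,j) = 1\<^sub>m 1 $$ (i,j)" by (simp add: ij)
  qed (use G m(1) in auto)
  have e: "four_block_mat ?A G (0\<^sub>m 1 p) (1\<^sub>m 1) * four_block_mat (1\<^sub>m p) (0\<^sub>m p 1) (G\<^sup>T) (1\<^sub>m 1)
    = four_block_mat S G (G\<^sup>T) (1\<^sub>m 1)"
    using G S by (subst mult_four_block_mat[of _ p p _ 1 _ 1]) (auto simp: AG)
  have e': "four_block_mat S (0\<^sub>m p 1) (G\<^sup>T) ?s * four_block_mat (1\<^sub>m p) (minv S * G) (0\<^sub>m 1 p) (1\<^sub>m 1)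
    = four_block_mat S G (G\<^sup>T) (1\<^sub>m 1)"
  proof -
    have "S * (minv S * G) = G" by (rule invertible_cancel[OF m(2) S m(1)]) (use G in simp)
    moreover have "?s * 0\<^sub>m 1 p = 0\<^sub>m 1 p" by (rule right_mult_zero_mat) simp
    moreover have "?s * 1\<^sub>m 1 = ?s" by (rule right_mult_one_mat[of _ 1]) simp
    ultimately show ?thesis
      using G S m(1) GS by (subst mult_four_block_mat[of _ p p _ 1 _ 1]) (auto simp del: assoc_mult_mat)
  qed
  have "det ?A = det (four_block_mat S G (G\<^sup>T) (1\<^sub>m 1))"
    unfolding e[symmetric] using G A
    by (subst det_mult[of _ "p + 1"])
       (auto simp: det_four_block_mat_lower_left_zero[of _ p _ 1] det_four_block_mat_upper_right_zero[of _ p _ 1])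
  also have "\<dots> = det S * (1 - qf p (minv S) g)"
    unfolding e'[symmetric] using G S m(1)
    by (subst det_mult[of _ "p + 1"])
       (auto simp: det_four_block_mat_lower_left_zero[of _ p _ 1] det_four_block_mat_upper_right_zero[of _ p _ 1] det_single)
  finally show ?thesis .
qed

definition gram :: "real mat \<Rightarrow> nat set \<Rightarrow> real mat" where
  "gram G B = Matrix.mat (dim_col G) (dim_col G) (\<lambda>(a,b). \<Sum>i\<in>B. G $$ (i,a) * G $$ (i,b))"

lemma gram_carrier [simp]: "G \<in> carrier_mat n p \<Longrightarrow> gram G B \<in> carrier_mat p p"
  "dim_row (gram G B) = dim_col G" "dim_col (gram G B) = dim_col G"
  by (simp_all add: gram_def)

lemma gram_sym: "(gram G B)\<^sup>T = gram G B"
  by (rule eq_matI) (auto simp: gram_def mult.commute)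

lemma gram_qf: "dim_col G = p \<Longrightarrow> qf p (gram G B) x = (\<Sum>i\<in>B. (mv G x i)\<^sup>2)"
proof -
  assume p: "dim_col G = p"
  have "qf p (gram G B) x = (\<Sum>a<p. \<Sum>b<p. \<Sum>i\<in>B. (G $$ (i,a) * x a) * (G $$ (i,b) * x b))"
    using p by (auto simp: qf_def gram_def sum_distrib_left sum_distrib_right mult_ac intro!: sum.cong)
  also have "\<dots> = (\<Sum>i\<in>B. \<Sum>a<p. \<Sum>b<p. (G $$ (i,a) * x a) * (G $$ (i,b) * x b))"
    by (subst sum.swap[of _ B]) (intro sum.cong refl sum.swap)
  also have "\<dots> = (\<Sum>i\<in>B. (mv G x i)\<^sup>2)"
    using p by (auto simp: mv_def power2_eq_square sum_product intro!: sum.cong)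
  finally show ?thesis .
qed

section \<open>Lebesgue measure on finite products\<close>

abbreviation Leb :: "'i set \<Rightarrow> ('i \<Rightarrow> real) measure" where
  "Leb I \<equiv> PiM I (\<lambda>_. lborel)"

lemma Leb_sigma_finite: "finite I \<Longrightarrow> sigma_finite_measure (Leb I :: ('i \<Rightarrow> real) measure)"
proof -
  assume "finite I"
  then interpret finite_product_sigma_finite "\<lambda>_::'i. lborel :: real measure" I by unfold_locales
  show ?thesis by unfold_locales
qed

lemma measurable_Leb_add [measurable]:
  assumes f: "f \<in> measurable M (Leb I)" and g: "g \<in> measurable M (Leb I)"
  shows "(\<lambda>x. \<lambda>i\<in>I. f x i + g x i) \<in> measurable M (Leb I)"
    "(\<lambda>x. \<lambda>i\<in>I. f x i - g x i) \<in> measurable M (Leb I)"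
proof -
  have [measurable]: "(\<lambda>x. f x i) \<in> borel_measurable M" "(\<lambda>x. g x i) \<in> borel_measurable M" if "i \<in> I" for i
    using measurable_compose[OF f measurable_component_singleton[OF that]]
      measurable_compose[OF g measurable_component_singleton[OF that]] by auto
  show "(\<lambda>x. \<lambda>i\<in>I. f x i + g x i) \<in> measurable M (Leb I)"
    "(\<lambda>x. \<lambda>i\<in>I. f x i - g x i) \<in> measurable M (Leb I)"
    by (rule measurable_restrict; measurable)+
qed

lemma distr_Leb_translation:
  assumes I: "finite I"
  shows "distr (Leb I) (Leb I) (\<lambda>x. \<lambda>i\<in>I. x i + c i) = Leb I"
proof -
  interpret product_sigma_finite "\<lambda>_. lborel :: real measure" by unfold_locales
  have m: "(\<lambda>x. \<lambda>i\<in>I. x i + c i) \<in> measurable (Leb I) (Leb I)"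
    by (rule measurable_restrict) measurable
  show ?thesis
  proof (rule PiM_eqI[OF I])
    fix A :: "'a \<Rightarrow> real set" assume A: "\<And>i. i \<in> I \<Longrightarrow> A i \<in> sets lborel"
    let ?B = "\<lambda>i. (\<lambda>x. x + c i) -` A i"
    have B: "?B i \<in> sets lborel" if "i \<in> I" for i
      using measurable_sets[of "\<lambda>x. x + c i" lborel lborel "A i"] A[OF that] by simp
    have "emeasure (distr (Leb I) (Leb I) (\<lambda>x. \<lambda>i\<in>I. x i + c i)) (Pi\<^sub>E I A)
      = emeasure (Leb I) ((\<lambda>x. \<lambda>i\<in>I. x i + c i) -` Pi\<^sub>E I A \<inter> space (Leb I))"
      using A I by (intro emeasure_distr m sets_PiM_I_finite) auto
    also have "(\<lambda>x. \<lambda>i\<in>I. x i + c i) -` Pi\<^sub>E I A \<inter> space (Leb I) = Pi\<^sub>E I ?B"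
      by (auto simp: space_PiM PiE_def Pi_def extensional_def)
    also have "emeasure (Leb I) (Pi\<^sub>E I ?B) = (\<Prod>i\<in>I. emeasure lborel (?B i))"
      using B I by (intro emeasure_PiM) auto
    also have "\<dots> = (\<Prod>i\<in>I. emeasure lborel (A i))"
    proof (intro prod.cong refl)
      fix i assume i: "i \<in> I"
      have "emeasure lborel (A i) = emeasure (distr lborel borel ((+) (c i))) (A i)"
        by (simp add: lborel_distr_plus)
      also have "\<dots> = emeasure lborel ((+) (c i) -` A i)"
        using A[OF i] by (subst emeasure_distr) auto
      also have "(+) (c i) -` A i = ?B i" by (auto simp: add.commute)
      finally show "emeasure lborel (?B i) = emeasure lborel (A i)" ..
    qed
    finally show "emeasure (distr (Leb I) (Leb I) (\<lambda>x. \<lambda>i\<in>I. x i + c i)) (Pi\<^sub>E I A) = (\<Prod>i\<in>I. emeasure lborel (A i))" .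
  qed simp
qed

lemma nn_integral_Leb_translation:
  assumes I: "finite I" and [measurable]: "f \<in> borel_measurable (Leb I)"
  shows "(\<integral>\<^sup>+x. f (\<lambda>i\<in>I. x i + c i) \<partial>Leb I) = (\<integral>\<^sup>+x. f x \<partial>Leb I)"
proof -
  have m: "(\<lambda>x. \<lambda>i\<in>I. x i + c i) \<in> measurable (Leb I) (Leb I)"
    by (rule measurable_restrict) measurable
  show ?thesis
    by (subst (2) distr_Leb_translation[OF I, of c, symmetric], subst nn_integral_distr[OF m]) auto
qed

text \<open>By Tonelli and translation invariance, the image of Lebesgue measure under an additive bijection is a multiple of
  Lebesgue measure; a rotation invariant probability density shows that the factor is \<open>1\<close> for an isometry.\<close>

lemma nn_integral_Leb_isometry:
  fixes T :: "('i \<Rightarrow> real) \<Rightarrow> 'i \<Rightarrow> real"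
  assumes I: "finite I" and T [measurable]: "T \<in> measurable (Leb I) (Leb I)"
    and add: "\<And>x y. x \<in> space (Leb I) \<Longrightarrow> y \<in> space (Leb I) \<Longrightarrow> T (\<lambda>i\<in>I. x i + y i) = (\<lambda>i\<in>I. T x i + T y i)"
    and norm: "\<And>x. x \<in> space (Leb I) \<Longrightarrow> (\<Sum>i\<in>I. (T x i)\<^sup>2) = (\<Sum>i\<in>I. (x i)\<^sup>2)"
    and surj: "\<And>y. y \<in> space (Leb I) \<Longrightarrow> \<exists>x\<in>space (Leb I). T x = y"
    and f [measurable]: "f \<in> borel_measurable (Leb I)"
  shows "(\<integral>\<^sup>+x. f (T x) \<partial>Leb I) = (\<integral>\<^sup>+x. f x \<partial>Leb I)"
proof -
  let ?L = "Leb I :: ('i \<Rightarrow> real) measure"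
  interpret product_sigma_finite "\<lambda>_::'i. lborel :: real measure" by unfold_locales
  interpret L: sigma_finite_measure ?L by (rule Leb_sigma_finite[OF I])
  interpret pair_sigma_finite ?L ?L by unfold_locales
  define g where "g x = (\<Prod>i\<in>I. ennreal (std_normal_density (x i)))" for x :: "'i \<Rightarrow> real"
  have g_eq: "g x = ennreal ((1 / sqrt (2 * pi)) ^ card I * exp (- (\<Sum>i\<in>I. (x i)\<^sup>2) / 2))" for x
    using I by (simp add: g_def std_normal_density_def prod_ennreal prod.distrib exp_sum[symmetric] power_divide
        sum_divide_distrib sum_negf prod_dividef)
  have [measurable]: "g \<in> borel_measurable ?L" unfolding g_def by measurable
  have "(\<integral>\<^sup>+x. ennreal (std_normal_density x) \<partial>lborel) = 1"
    using prob_space.emeasure_space_1[OF prob_space_normal_density[of 1 0]]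
    by (simp add: emeasure_density cong: nn_integral_cong)
  then have g1: "(\<integral>\<^sup>+x. g x \<partial>?L) = 1"
    unfolding g_def using I by (subst product_nn_integral_prod) auto
  have gT: "g (T x) = g x" if "x \<in> space ?L" for x using norm[OF that] by (simp add: g_eq)
  have sp: "(\<lambda>i\<in>I. u i) \<in> space ?L" for u by (simp add: space_PiM)
  have Tsp: "T x \<in> space ?L" if "x \<in> space ?L" for x using measurable_space[OF T that] .
  have ext: "(\<lambda>i\<in>I. x i) = x" if "x \<in> space ?L" for x using that by (auto simp: space_PiM PiE_def extensional_restrict)
  have "(\<integral>\<^sup>+x. f (T x) \<partial>?L) = (\<integral>\<^sup>+y. (\<integral>\<^sup>+x. f (T x) \<partial>?L) * g y \<partial>?L)"
    by (subst nn_integral_cmult) (auto simp: g1)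
  also have "\<dots> = (\<integral>\<^sup>+y. \<integral>\<^sup>+x. f (\<lambda>i\<in>I. T x i + y i) * g y \<partial>?L \<partial>?L)"
  proof (rule nn_integral_cong)
    fix y assume "y \<in> space ?L"
    then obtain z where z: "z \<in> space ?L" "T z = y" using surj by blast
    have "(\<integral>\<^sup>+x. f (T x) \<partial>?L) = (\<integral>\<^sup>+x. f (T (\<lambda>i\<in>I. x i + z i)) \<partial>?L)"
      by (rule nn_integral_Leb_translation[OF I, symmetric]) measurable
    also have "\<dots> = (\<integral>\<^sup>+x. f (\<lambda>i\<in>I. T x i + y i) \<partial>?L)"
      using z add by (intro nn_integral_cong) auto
    finally show "(\<integral>\<^sup>+x. f (T x) \<partial>?L) * g y = (\<integral>\<^sup>+x. f (\<lambda>i\<in>I. T x i + y i) * g y \<partial>?L)"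
      using \<open>y \<in> space ?L\<close> by (subst nn_integral_multc) auto
  qed
  also have "\<dots> = (\<integral>\<^sup>+x. \<integral>\<^sup>+y. f (\<lambda>i\<in>I. T x i + y i) * g y \<partial>?L \<partial>?L)"
    by (rule Fubini'[where f="\<lambda>x y. f (\<lambda>i\<in>I. T x i + y i) * g y"]) measurable
  also have "\<dots> = (\<integral>\<^sup>+x. \<integral>\<^sup>+y. f y * g (\<lambda>i\<in>I. y i - T x i) \<partial>?L \<partial>?L)"
  proof (rule nn_integral_cong)
    fix x assume x [measurable]: "x \<in> space ?L"
    have [measurable]: "(\<lambda>y. T x) \<in> measurable ?L ?L" using Tsp[OF x] by simp
    have "(\<integral>\<^sup>+y. f (\<lambda>i\<in>I. T x i + y i) * g y \<partial>?L)
      = (\<integral>\<^sup>+y. f (\<lambda>i\<in>I. T x i + (\<lambda>i\<in>I. y i + - T x i) i) * g (\<lambda>i\<in>I. y i + - T x i) \<partial>?L)"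
      by (rule nn_integral_Leb_translation[OF I, symmetric]) measurable
    also have "\<dots> = (\<integral>\<^sup>+y. f y * g (\<lambda>i\<in>I. y i - T x i) \<partial>?L)"
    proof (rule nn_integral_cong)
      fix y assume y: "y \<in> space ?L"
      have "(\<lambda>i\<in>I. T x i + (\<lambda>i\<in>I. y i + - T x i) i) = (\<lambda>i\<in>I. y i)" by auto
      then show "f (\<lambda>i\<in>I. T x i + (\<lambda>i\<in>I. y i + - T x i) i) * g (\<lambda>i\<in>I. y i + - T x i) = f y * g (\<lambda>i\<in>I. y i - T x i)"
        using ext[OF y] by simp
    qed
    finally show "(\<integral>\<^sup>+y. f (\<lambda>i\<in>I. T x i + y i) * g y \<partial>?L) = (\<integral>\<^sup>+y. f y * g (\<lambda>i\<in>I. y i - T x i) \<partial>?L)" .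
  qed
  also have "\<dots> = (\<integral>\<^sup>+y. \<integral>\<^sup>+x. f y * g (\<lambda>i\<in>I. y i - T x i) \<partial>?L \<partial>?L)"
    by (rule Fubini'[where f="\<lambda>x y. f y * g (\<lambda>i\<in>I. y i - T x i)", symmetric]) measurable
  also have "\<dots> = (\<integral>\<^sup>+y. f y \<partial>?L)"
  proof (rule nn_integral_cong)
    fix y assume y: "y \<in> space ?L"
    then obtain z where z: "z \<in> space ?L" "T z = y" using surj by blast
    have [measurable]: "(\<lambda>x. y) \<in> measurable ?L ?L" "(\<lambda>x. z) \<in> measurable ?L ?L" using y z by auto
    have "(\<integral>\<^sup>+x. g (\<lambda>i\<in>I. y i - T x i) \<partial>?L) = (\<integral>\<^sup>+x. g (\<lambda>i\<in>I. y i - T (\<lambda>i\<in>I. x i + z i) i) \<partial>?L)"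
      by (rule nn_integral_Leb_translation[OF I, symmetric]) measurable
    also have "\<dots> = (\<integral>\<^sup>+x. g x \<partial>?L)"
    proof (rule nn_integral_cong)
      fix x assume x: "x \<in> space ?L"
      have "g (\<lambda>i\<in>I. y i - T (\<lambda>i\<in>I. x i + z i) i) = g (T x)"
        using z add[OF x z(1)] by (simp add: g_eq)
      then show "g (\<lambda>i\<in>I. y i - T (\<lambda>i\<in>I. x i + z i) i) = g x" using gT[OF x] by simp
    qed
    finally have "(\<integral>\<^sup>+x. g (\<lambda>i\<in>I. y i - T x i) \<partial>?L) = 1" using g1 by simp
    then show "(\<integral>\<^sup>+x. f y * g (\<lambda>i\<in>I. y i - T x i) \<partial>?L) = f y"
      by (subst nn_integral_cmult) auto
  qed
  finally show ?thesis .
qed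

section \<open>Measurability of matrix-valued functions\<close>

definition mmeas :: "'a measure \<Rightarrow> nat \<Rightarrow> nat \<Rightarrow> ('a \<Rightarrow> real mat) \<Rightarrow> bool" where
  "mmeas M r c A \<longleftrightarrow> (\<forall>x\<in>space M. A x \<in> carrier_mat r c) \<and>
     (\<forall>i<r. \<forall>j<c. (\<lambda>x. A x $$ (i, j)) \<in> borel_measurable M)"

lemma mmeasI:
  "(\<And>x. x \<in> space M \<Longrightarrow> A x \<in> carrier_mat r c) \<Longrightarrow>
   (\<And>i j. i < r \<Longrightarrow> j < c \<Longrightarrow> (\<lambda>x. A x $$ (i, j)) \<in> borel_measurable M) \<Longrightarrow> mmeas M r c A"
  by (simp add: mmeas_def)

lemma mmeasD:
  assumes "mmeas M r c A"
  shows "x \<in> space M \<Longrightarrow> A x \<in> carrier_mat r c"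
    "i < r \<Longrightarrow> j < c \<Longrightarrow> (\<lambda>x. A x $$ (i, j)) \<in> borel_measurable M"
  using assms by (simp_all add: mmeas_def)

lemma mmeas_dims:
  assumes "mmeas M r c A"
  shows "x \<in> space M \<Longrightarrow> dim_row (A x) = r" "x \<in> space M \<Longrightarrow> dim_col (A x) = c"
  using assms by (auto simp: mmeas_def)

lemma mmeas_const: "A \<in> carrier_mat r c \<Longrightarrow> mmeas M r c (\<lambda>_. A)"
  by (simp add: mmeas_def)

lemma mmeas_mult:
  assumes A: "mmeas M r m A" and B: "mmeas M m c B"
  shows "mmeas M r c (\<lambda>x. A x * B x)"
proof (rule mmeasI)
  fix i j assume ij: "i < r" "j < c"
  have "(\<lambda>x. \<Sum>l<m. A x $$ (i,l) * B x $$ (l,j)) \<in> borel_measurable M"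
    using mmeasD(2)[OF A] mmeasD(2)[OF B] ij by (intro borel_measurable_sum borel_measurable_times) auto
  then show "(\<lambda>x. (A x * B x) $$ (i,j)) \<in> borel_measurable M"
    by (rule measurable_cong[THEN iffD1, rotated])
       (use ij in \<open>auto simp: mmeas_dims[OF A] mmeas_dims[OF B] scalar_prod_def atLeast0LessThan intro!: sum.cong\<close>)
qed (auto simp: mmeas_dims[OF A] mmeas_dims[OF B] intro!: carrier_matI)

lemma mmeas_transpose:
  assumes A: "mmeas M r c A" shows "mmeas M c r (\<lambda>x. (A x)\<^sup>T)"
proof (rule mmeasI)
  fix i j assume ij: "i < c" "j < r"
  show "(\<lambda>x. (A x)\<^sup>T $$ (i,j)) \<in> borel_measurable M"
    by (rule measurable_cong[THEN iffD1, rotated, OF mmeasD(2)[OF A ij(2,1)]])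
       (use ij in \<open>auto simp: mmeas_dims[OF A]\<close>)
qed (auto simp: mmeas_dims[OF A] intro!: carrier_matI)

lemma mmeas_minus:
  assumes A: "mmeas M r c A" and B: "mmeas M r c B" shows "mmeas M r c (\<lambda>x. A x - B x)"
proof (rule mmeasI)
  fix i j assume ij: "i < r" "j < c"
  have "(\<lambda>x. A x $$ (i,j) - B x $$ (i,j)) \<in> borel_measurable M"
    using mmeasD(2)[OF A ij] mmeasD(2)[OF B ij] by simp
  then show "(\<lambda>x. (A x - B x) $$ (i,j)) \<in> borel_measurable M"
    by (rule measurable_cong[THEN iffD1, rotated]) (use ij in \<open>auto simp: mmeas_dims[OF A] mmeas_dims[OF B]\<close>)
qed (auto simp: mmeas_dims[OF A] mmeas_dims[OF B] intro!: carrier_matI)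

lemma mmeas_add:
  assumes A: "mmeas M r c A" and B: "mmeas M r c B" shows "mmeas M r c (\<lambda>x. A x + B x)"
proof (rule mmeasI)
  fix i j assume ij: "i < r" "j < c"
  have "(\<lambda>x. A x $$ (i,j) + B x $$ (i,j)) \<in> borel_measurable M"
    using mmeasD(2)[OF A ij] mmeasD(2)[OF B ij] by simp
  then show "(\<lambda>x. (A x + B x) $$ (i,j)) \<in> borel_measurable M"
    by (rule measurable_cong[THEN iffD1, rotated]) (use ij in \<open>auto simp: mmeas_dims[OF A] mmeas_dims[OF B]\<close>)
qed (auto simp: mmeas_dims[OF A] mmeas_dims[OF B] intro!: carrier_matI)

lemma mmeas_smult:
  assumes A: "mmeas M r c A" and f: "f \<in> borel_measurable M" shows "mmeas M r c (\<lambda>x. f x \<cdot>\<^sub>m A x)"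
proof (rule mmeasI)
  fix i j assume ij: "i < r" "j < c"
  have "(\<lambda>x. f x * A x $$ (i,j)) \<in> borel_measurable M"
    using mmeasD(2)[OF A ij] f by simp
  then show "(\<lambda>x. (f x \<cdot>\<^sub>m A x) $$ (i,j)) \<in> borel_measurable M"
    by (rule measurable_cong[THEN iffD1, rotated]) (use ij in \<open>auto simp: mmeas_dims[OF A]\<close>)
qed (auto simp: mmeas_dims[OF A] intro!: carrier_matI)

lemma mmeas_det:
  assumes A: "mmeas M r r A" shows "(\<lambda>x. det (A x)) \<in> borel_measurable M"
proof -
  have "(\<lambda>x. \<Sum>q\<in>{q. q permutes {0..<r}}. signof q * (\<Prod>i = 0..<r. A x $$ (i, q i))) \<in> borel_measurable M"
  proof (intro borel_measurable_sum borel_measurable_times borel_measurable_prod)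
    fix q i assume "q \<in> {q. q permutes {0..<r}}" "i \<in> {0..<r}"
    then have "i < r" "q i < r" using permutes_in_image[of q "{0..<r}" i] by auto
    then show "(\<lambda>x. A x $$ (i, q i)) \<in> borel_measurable M" by (rule mmeasD(2)[OF A])
  qed simp
  then show ?thesis
    by (rule measurable_cong[THEN iffD1, rotated]) (auto simp: det_def'[OF mmeasD(1)[OF A]])
qed

lemma mmeas_adj:
  assumes A: "mmeas M r r A" shows "mmeas M r r (\<lambda>x. adj_mat (A x))"
proof (rule mmeasI)
  fix i j assume ij: "i < r" "j < r"
  have "mmeas M (r - 1) (r - 1) (\<lambda>x. mat_delete (A x) j i)"
  proof (rule mmeasI)
    fix i' j' assume ij': "i' < r - 1" "j' < r - 1"
    then have "(\<lambda>x. A x $$ (if i' < j then i' else Suc i', if j' < i then j' else Suc j')) \<in> borel_measurable M"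
      by (intro mmeasD(2)[OF A]) auto
    then show "(\<lambda>x. mat_delete (A x) j i $$ (i', j')) \<in> borel_measurable M"
      by (rule measurable_cong[THEN iffD1, rotated]) (use ij' in \<open>simp add: mat_delete_def mmeas_dims[OF A]\<close>)
  qed (auto simp: mat_delete_def mmeas_dims[OF A])
  from mmeas_det[OF this] have "(\<lambda>x. (-1) ^ (j + i) * det (mat_delete (A x) j i)) \<in> borel_measurable M" by simp
  then show "(\<lambda>x. adj_mat (A x) $$ (i,j)) \<in> borel_measurable M"
    by (rule measurable_cong[THEN iffD1, rotated]) (use ij in \<open>simp add: adj_mat_def cofactor_def mmeas_dims[OF A]\<close>)
qed (auto simp: adj_mat_def mmeas_dims[OF A])

text \<open>Unlike \<open>minv\<close>, a rational function of the entries also at singular matrices, where its value is \<open>0\<close>.\<close>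

definition inv0 :: "real mat \<Rightarrow> real mat" where
  "inv0 A = (1 / det A) \<cdot>\<^sub>m adj_mat A"

lemma inv0_minv: "A \<in> carrier_mat n n \<Longrightarrow> det A \<noteq> 0 \<Longrightarrow> inv0 A = minv A"
  by (simp add: inv0_def minv(4))

lemma mmeas_inv0: "mmeas M r r A \<Longrightarrow> mmeas M r r (\<lambda>x. inv0 (A x))"
  unfolding inv0_def by (intro mmeas_smult mmeas_adj borel_measurable_divide borel_measurable_const mmeas_det)

lemma mmeas_gram:
  assumes A: "mmeas M n p A" and B: "B \<subseteq> {..<n}" shows "mmeas M p p (\<lambda>x. gram (A x) B)"
proof (rule mmeasI)
  fix a b assume ab: "a < p" "b < p"
  have "(\<lambda>x. \<Sum>i\<in>B. A x $$ (i,a) * A x $$ (i,b)) \<in> borel_measurable M"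
    using mmeasD(2)[OF A] ab B by (intro borel_measurable_sum borel_measurable_times) auto
  then show "(\<lambda>x. gram (A x) B $$ (a,b)) \<in> borel_measurable M"
    by (rule measurable_cong[THEN iffD1, rotated]) (use ab in \<open>auto simp: gram_def mmeas_dims[OF A]\<close>)
qed (auto simp: mmeas_dims[OF A] intro!: carrier_matI)

lemma mmeas_mat: "mmeas (entries_measure n p) n p (\<lambda>e. Matrix.mat n p e)"
  by (rule mmeasI) auto

lemma mmeas_mat_compose: "f \<in> measurable M (entries_measure n p) \<Longrightarrow> mmeas M n p (\<lambda>x. Matrix.mat n p (f x))"
proof (rule mmeasI)
  fix i j assume f: "f \<in> measurable M (entries_measure n p)" and ij: "i < n" "j < p"
  have "(\<lambda>x. f x (i,j)) \<in> borel_measurable M"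
    using measurable_compose[OF f measurable_component_singleton[of "(i,j)"]] ij by auto
  then show "(\<lambda>x. Matrix.mat n p (f x) $$ (i,j)) \<in> borel_measurable M" using ij by simp
qed auto

lemma mmeas_entries:
  assumes A: "mmeas M n p A" shows "(\<lambda>x. entries (A x)) \<in> measurable M (entries_measure n p)"
proof -
  have "(\<lambda>x. \<lambda>ij\<in>{..<n} \<times> {..<p}. A x $$ ij) \<in> measurable M (entries_measure n p)"
    by (rule measurable_restrict) (use mmeasD(2)[OF A] in auto)
  then show ?thesis
    by (rule measurable_cong[THEN iffD1, rotated]) (auto simp: entries_def mmeas_dims[OF A])
qed

lemma mat_entries: "A \<in> carrier_mat n p \<Longrightarrow> Matrix.mat n p (entries A) = A"
  by (rule eq_matI) (auto simp: entries_def)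

lemma entries_mat: "e \<in> space (entries_measure n p) \<Longrightarrow> entries (Matrix.mat n p e) = e"
  by (auto simp: entries_def space_PiM PiE_def extensional_def restrict_def intro!: ext)

lemma entries_in_space: "A \<in> carrier_mat n p \<Longrightarrow> entries A \<in> space (entries_measure n p)"
  by (auto simp: entries_def space_PiM)

section \<open>Centered Gaussian matrices\<close>

definition wnorm :: "nat \<Rightarrow> nat \<Rightarrow> real mat \<Rightarrow> real mat \<Rightarrow> real" where
  "wnorm n p K G = (\<Sum>i<n. qf p K (\<lambda>a. G $$ (i, a)))"

lemma mtrace_gram:
  assumes K: "K \<in> carrier_mat p p" and G: "G \<in> carrier_mat n p"
  shows "mtrace (K * (G\<^sup>T * G)) = wnorm n p K G"
proof -
  have "mtrace (K * (G\<^sup>T * G)) = (\<Sum>a<p. \<Sum>b<p. \<Sum>i<n. G $$ (i,a) * K $$ (a,b) * G $$ (i,b))"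
    using K G unfolding mtrace_def
    by (auto simp: mult_index_sum sum_distrib_left mult_ac simp del: index_mult_mat(1) intro!: sum.cong)
  also have "\<dots> = (\<Sum>i<n. \<Sum>a<p. \<Sum>b<p. G $$ (i,a) * K $$ (a,b) * G $$ (i,b))"
    by (subst (2) sum.swap) (intro sum.cong refl sum.swap)
  finally show ?thesis by (simp add: wnorm_def qf_def)
qed

locale gaussian_matrix = prob_space P for P :: "'a measure" +
  fixes n p :: nat and E :: "'a \<Rightarrow> real mat" and S :: "real mat" and c :: real
  assumes E: "mmeas P n p E" and S: "pos_def p S" and c: "c \<ge> 0"
    and law: "\<And>g. g \<in> borel_measurable (entries_measure n p) \<Longrightarrow>
      (\<integral>\<^sup>+x. g (entries (E x)) \<partial>P) = (\<integral>\<^sup>+e. ennreal (c * exp (- wnorm n p (minv S) (Matrix.mat n p e) / 2)) * g e \<partial>entries_measure n p)"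
begin

lemma Sc: "S \<in> carrier_mat p p" using pos_defD(1)[OF S] .

lemma minvS: "minv S \<in> carrier_mat p p" "S * minv S = 1\<^sub>m p" "minv S * S = 1\<^sub>m p" "(minv S)\<^sup>T = minv S"
proof -
  have "det S \<noteq> 0" using pos_def_det[OF S] by simp
  note m = minv[OF Sc this]
  show "minv S \<in> carrier_mat p p" "S * minv S = 1\<^sub>m p" "minv S * S = 1\<^sub>m p" using m by auto
  have "S * (minv S)\<^sup>T = (minv S * S)\<^sup>T"
    using m(1) Sc pos_defD(2)[OF S] by (simp add: mat_transpose_mult_dim)
  also have "\<dots> = 1\<^sub>m p" using m(3) by simp
  finally have "minv S = (minv S)\<^sup>T" by (intro minv_unique(1)[OF Sc]) (use m(1) in auto)
  then show "(minv S)\<^sup>T = minv S" by simp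
qed

lemma measurable_density [measurable]:
  "(\<lambda>e. ennreal (c * exp (- wnorm n p (minv S) (Matrix.mat n p e) / 2))) \<in> borel_measurable (entries_measure n p)"
  unfolding wnorm_def qf_def using mmeasD(2)[OF mmeas_mat]
  by (intro measurable_compose[OF _ measurable_ennreal] borel_measurable_times borel_measurable_const
      measurable_compose[OF _ borel_measurable_exp] borel_measurable_divide borel_measurable_uminus borel_measurable_sum) auto

lemma rotation_invariant:
  assumes R: "R \<in> carrier_mat n n" "R\<^sup>T * R = 1\<^sub>m n" and g [measurable]: "g \<in> borel_measurable (entries_measure n p)"
  shows "(\<integral>\<^sup>+x. g (entries (R * E x)) \<partial>P) = (\<integral>\<^sup>+x. g (entries (E x)) \<partial>P)"
proof -
  let ?L = "entries_measure n p" and ?m = "\<lambda>e. Matrix.mat n p e"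
  define T where "T e = entries (R * ?m e)" for e
  let ?d = "\<lambda>e. ennreal (c * exp (- wnorm n p (minv S) (?m e) / 2))"
  have RmC: "R * ?m e \<in> carrier_mat n p" for e using R(1) by simp
  have T[measurable]: "T \<in> measurable ?L ?L"
    unfolding T_def by (rule mmeas_entries[OF mmeas_mult[OF mmeas_const[OF R(1)] mmeas_mat]])
  have mT: "?m (T e) = R * ?m e" for e unfolding T_def by (rule mat_entries[OF RmC])
  have RR: "(R * G)\<^sup>T * (R * G) = G\<^sup>T * G" if "G \<in> carrier_mat n p" for G
    using R that by (simp add: mat_transpose_mult_dim mat_mult_assoc_dim invertible_cancel[OF R(2)] del: assoc_mult_mat)
  have wn: "wnorm n p K (R * ?m e) = wnorm n p K (?m e)" if "K \<in> carrier_mat p p" for K e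
    unfolding mtrace_gram[OF that RmC, symmetric] mtrace_gram[OF that mat_carrier, symmetric] by (simp add: RR)
  have nrm: "(\<Sum>ij\<in>{..<n} \<times> {..<p}. (e ij)\<^sup>2) = wnorm n p (1\<^sub>m p) (?m e)" for e :: "nat \<times> nat \<Rightarrow> real"
    unfolding wnorm_def qf_one sum.cartesian_product by (auto intro!: sum.cong)
  have "(\<integral>\<^sup>+x. g (entries (R * E x)) \<partial>P) = (\<integral>\<^sup>+x. g (T (entries (E x))) \<partial>P)"
    unfolding T_def by (intro nn_integral_cong) (simp add: mat_entries[OF mmeasD(1)[OF E]])
  also have "\<dots> = (\<integral>\<^sup>+e. ?d e * g (T e) \<partial>?L)" by (rule law) measurable
  also have "\<dots> = (\<integral>\<^sup>+e. ?d (T e) * g (T e) \<partial>?L)" by (simp add: mT wn[OF minvS(1)])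
  also have "\<dots> = (\<integral>\<^sup>+e. ?d e * g e \<partial>?L)"
  proof (rule nn_integral_Leb_isometry)
    fix x y assume "x \<in> space ?L" "y \<in> space ?L"
    have "?m (\<lambda>ij\<in>{..<n} \<times> {..<p}. x ij + y ij) = ?m x + ?m y" by (rule eq_matI) auto
    then have "T (\<lambda>ij\<in>{..<n} \<times> {..<p}. x ij + y ij) = entries (R * ?m x + R * ?m y)"
      unfolding T_def using R(1) by (simp add: mult_add_distrib_mat[of _ n n _ p])
    also have "\<dots> = (\<lambda>i\<in>{..<n} \<times> {..<p}. T x i + T y i)"
      unfolding T_def entries_def using R(1) by (auto intro!: restrict_ext)
    finally show "T (\<lambda>ij\<in>{..<n} \<times> {..<p}. x ij + y ij) = (\<lambda>i\<in>{..<n} \<times> {..<p}. T x i + T y i)" .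
  next
    fix x assume "x \<in> space ?L"
    show "(\<Sum>i\<in>{..<n} \<times> {..<p}. (T x i)\<^sup>2) = (\<Sum>i\<in>{..<n} \<times> {..<p}. (x i)\<^sup>2)"
      unfolding nrm mT by (rule wn) simp
  next
    fix y assume y: "y \<in> space ?L"
    let ?x = "entries (R\<^sup>T * ?m y)"
    have c1: "R\<^sup>T * ?m y \<in> carrier_mat n p" using R(1) by simp
    have RT: "R * R\<^sup>T = 1\<^sub>m n" by (rule orthogonal_mat_swap[OF _ R]) (use R in simp)
    have "R * (R\<^sup>T * ?m y) = ?m y" by (rule invertible_cancel[OF RT]) (use R in auto)
    then have "T ?x = y" unfolding T_def mat_entries[OF c1] by (simp add: entries_mat[OF y])
    then show "\<exists>x\<in>space ?L. T x = y" using entries_in_space[OF c1] by blast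
  next
    show "T \<in> measurable ?L ?L" by (rule T)
    show "(\<lambda>e. ?d e * g e) \<in> borel_measurable ?L" by measurable
  qed simp
  also have "\<dots> = (\<integral>\<^sup>+x. g (entries (E x)) \<partial>P)" by (rule law[symmetric]) measurable
  finally show ?thesis .
qed

end

lemma qf_shift:
  assumes K: "K \<in> carrier_mat p p" "K\<^sup>T = K" and s: "\<And>a. a < p \<Longrightarrow> mv K s a = v a"
  shows "qf p K (\<lambda>a. x a - t * s a) = qf p K x - 2 * t * (\<Sum>a<p. x a * v a) + t\<^sup>2 * (\<Sum>a<p. s a * v a)"
proof -
  have 1: "(\<Sum>b<p. K $$ (a,b) * s b) = v a" if "a < p" for a using s[OF that] K(1) by (simp add: mv_def)
  have 2: "(\<Sum>b<p. K $$ (b,a) * s b) = v a" if "a < p" for a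
    unfolding 1[OF that, symmetric] by (intro sum.cong refl) (use K that in \<open>metis (no_types) carrier_matD index_transpose_mat(1) lessThan_iff\<close>)
  have "qf p K (\<lambda>a. x a - t * s a) = (\<Sum>a<p. \<Sum>b<p. x a * K $$ (a,b) * x b) - t * (\<Sum>a<p. x a * (\<Sum>b<p. K $$ (a,b) * s b))
     - t * (\<Sum>a<p. \<Sum>b<p. s a * K $$ (a,b) * x b) + t\<^sup>2 * (\<Sum>a<p. s a * (\<Sum>b<p. K $$ (a,b) * s b))"
    unfolding qf_def sum_distrib_left sum_subtractf[symmetric] sum.distrib[symmetric]
    by (intro sum.cong refl) (simp add: algebra_simps power2_eq_square)
  also have "(\<Sum>a<p. \<Sum>b<p. s a * K $$ (a,b) * x b) = (\<Sum>b<p. x b * (\<Sum>a<p. K $$ (a,b) * s a))"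
    by (subst sum.swap) (simp add: sum_distrib_left mult_ac)
  finally show ?thesis using 1 2 by (simp add: qf_def)
qed

lemma wnorm_shift:
  assumes K: "K \<in> carrier_mat p p" "K\<^sup>T = K" and s: "\<And>a. a < p \<Longrightarrow> mv K s a = v a"
    and G: "G \<in> carrier_mat n p" and H: "\<And>i a. i < n \<Longrightarrow> a < p \<Longrightarrow> H $$ (i,a) = G $$ (i,a) - u i * s a"
  shows "wnorm n p K H = wnorm n p K G - 2 * (\<Sum>i<n. u i * mv G v i) + (\<Sum>i<n. (u i)\<^sup>2) * (\<Sum>a<p. s a * v a)"
proof -
  have "wnorm n p K H = (\<Sum>i<n. qf p K (\<lambda>a. G $$ (i,a) - u i * s a))"
    unfolding wnorm_def by (intro sum.cong refl qf_cong) (simp add: H)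
  also have "\<dots> = (\<Sum>i<n. qf p K (\<lambda>a. G $$ (i,a)) - 2 * (u i * mv G v i) + (u i)\<^sup>2 * (\<Sum>a<p. s a * v a))"
    unfolding qf_shift[OF K s, of "\<lambda>a. a"] using G by (intro sum.cong refl) (simp add: mv_def qf_shift[OF K s] mult.assoc)
  finally show ?thesis
    by (simp add: wnorm_def sum.distrib sum_subtractf sum_distrib_left[symmetric] sum_distrib_right[symmetric])
qed

lemma square_le_exp: "x\<^sup>2 \<le> 2 * (exp x + exp (- x))" for x :: real
proof -
  have "1 + \<bar>x\<bar> + \<bar>x\<bar>\<^sup>2 / 2 \<le> exp \<bar>x\<bar>" by (rule exp_lower_Taylor_quadratic) simp
  moreover have "exp \<bar>x\<bar> \<le> exp x + exp (- x)" by (cases "x \<ge> 0") auto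
  ultimately show ?thesis by simp
qed

context gaussian_matrix
begin

lemma exponential_moment:
  "(\<integral>\<^sup>+x. ennreal (exp (\<Sum>i<n. u i * mv (E x) v i)) \<partial>P) = ennreal (exp ((\<Sum>i<n. (u i)\<^sup>2) * qf p S v / 2))"
proof -
  let ?L = "entries_measure n p" and ?m = "\<lambda>e. Matrix.mat n p e" and ?K = "minv S"
  let ?w = "\<lambda>e. wnorm n p ?K (?m e)"
  define s where "s = mv S v"
  have Ks: "mv ?K s a = v a" if "a < p" for a
    unfolding s_def mv_mult[OF minvS(1) Sc that, symmetric] minvS(3) by (rule mv_one[OF that])
  define q where "q = (\<Sum>i<n. (u i)\<^sup>2) * qf p S v"
  have sv: "(\<Sum>a<p. s a * v a) = qf p S v"
    unfolding s_def mv_def qf_def using Sc by (auto simp: sum_distrib_left sum_distrib_right mult_ac intro!: sum.cong)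
  have total: "(\<integral>\<^sup>+e. ennreal (c * exp (- ?w e / 2)) \<partial>?L) = 1"
    using law[of "\<lambda>_. 1"] by (simp add: emeasure_space_1)
  have meas: "(\<lambda>e. ennreal (exp (\<Sum>i<n. u i * mv (?m e) v i))) \<in> borel_measurable ?L"
    unfolding mv_def using mmeasD(2)[OF mmeas_mat]
    by (intro measurable_compose[OF _ measurable_ennreal] borel_measurable_times borel_measurable_const
      measurable_compose[OF _ borel_measurable_exp] borel_measurable_sum) auto
  have "1 = (\<integral>\<^sup>+e. ennreal (c * exp (- ?w (\<lambda>ij\<in>{..<n}\<times>{..<p}. e ij + (- u (fst ij) * s (snd ij))) / 2)) \<partial>?L)"
    unfolding total[symmetric] by (rule nn_integral_Leb_translation[symmetric]) (simp, measurable)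
  also have "\<dots> = (\<integral>\<^sup>+e. ennreal (exp (- q / 2)) * (ennreal (c * exp (- ?w e / 2)) * ennreal (exp (\<Sum>i<n. u i * mv (?m e) v i))) \<partial>?L)"
  proof (rule nn_integral_cong)
    fix e :: "nat \<times> nat \<Rightarrow> real"
    have "?w (\<lambda>ij\<in>{..<n}\<times>{..<p}. e ij + (- u (fst ij) * s (snd ij))) = ?w e - 2 * (\<Sum>i<n. u i * mv (?m e) v i) + q"
      unfolding q_def sv[symmetric] by (rule wnorm_shift[OF minvS(1,4) Ks]) auto
    then have "exp (- ?w (\<lambda>ij\<in>{..<n}\<times>{..<p}. e ij + (- u (fst ij) * s (snd ij))) / 2)
      = exp (- q / 2) * (exp (- ?w e / 2) * exp (\<Sum>i<n. u i * mv (?m e) v i))"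
      by (simp add: exp_add[symmetric] field_simps)
    then show "ennreal (c * exp (- ?w (\<lambda>ij\<in>{..<n}\<times>{..<p}. e ij + (- u (fst ij) * s (snd ij))) / 2))
      = ennreal (exp (- q / 2)) * (ennreal (c * exp (- ?w e / 2)) * ennreal (exp (\<Sum>i<n. u i * mv (?m e) v i)))"
      using c by (simp add: ennreal_mult[symmetric] mult_ac)
  qed
  also have "\<dots> = ennreal (exp (- q / 2)) * (\<integral>\<^sup>+e. ennreal (c * exp (- ?w e / 2)) * ennreal (exp (\<Sum>i<n. u i * mv (?m e) v i)) \<partial>?L)"
    by (rule nn_integral_cmult[OF borel_measurable_times_ennreal[OF measurable_density meas]])
  also have "(\<integral>\<^sup>+e. ennreal (c * exp (- ?w e / 2)) * ennreal (exp (\<Sum>i<n. u i * mv (?m e) v i)) \<partial>?L)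
      = (\<integral>\<^sup>+x. ennreal (exp (\<Sum>i<n. u i * mv (?m (entries (E x))) v i)) \<partial>P)"
    by (rule law[symmetric, OF meas])
  also have "\<dots> = (\<integral>\<^sup>+x. ennreal (exp (\<Sum>i<n. u i * mv (E x) v i)) \<partial>P)"
    by (intro nn_integral_cong) (simp add: mat_entries[OF mmeasD(1)[OF E]])
  finally have eq: "1 = ennreal (exp (- q / 2)) * (\<integral>\<^sup>+x. ennreal (exp (\<Sum>i<n. u i * mv (E x) v i)) \<partial>P)" .
  have "ennreal (exp (q / 2)) * 1 = (ennreal (exp (q / 2)) * ennreal (exp (- q / 2))) * (\<integral>\<^sup>+x. ennreal (exp (\<Sum>i<n. u i * mv (E x) v i)) \<partial>P)"
    by (subst eq) (simp only: mult.assoc)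
  then show ?thesis by (simp add: ennreal_mult[symmetric] exp_add[symmetric] q_def)
qed

lemma mv_measurable: "i < n \<Longrightarrow> (\<lambda>x. mv (E x) v i) \<in> borel_measurable P"
proof -
  assume i: "i < n"
  have "(\<lambda>x. \<Sum>j<p. E x $$ (i,j) * v j) \<in> borel_measurable P"
    using mmeasD(2)[OF E] i by (intro borel_measurable_sum borel_measurable_times) auto
  then show ?thesis
    by (rule measurable_cong[THEN iffD1, rotated]) (simp add: mv_def mmeas_dims[OF E])
qed

lemma second_moment:
  assumes u: "(\<Sum>i<n. (u i)\<^sup>2) = 1" and v: "qf p S v = 1"
  shows "(\<integral>\<^sup>+x. ennreal ((\<Sum>i<n. u i * mv (E x) v i)\<^sup>2) \<partial>P) \<le> 8"
proof -
  let ?f = "\<lambda>x. \<Sum>i<n. u i * mv (E x) v i"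
  have [measurable]: "?f \<in> borel_measurable P" using mv_measurable by (intro borel_measurable_sum borel_measurable_times) auto
  have "(\<integral>\<^sup>+x. ennreal ((?f x)\<^sup>2) \<partial>P) \<le> (\<integral>\<^sup>+x. 2 * (ennreal (exp (?f x)) + ennreal (exp (- ?f x))) \<partial>P)"
  proof (rule nn_integral_mono)
    fix x
    have "ennreal ((?f x)\<^sup>2) \<le> ennreal (2 * (exp (?f x) + exp (- ?f x)))" by (intro ennreal_leI square_le_exp)
    then show "ennreal ((?f x)\<^sup>2) \<le> 2 * (ennreal (exp (?f x)) + ennreal (exp (- ?f x)))"
      by (simp add: ennreal_mult)
  qed
  also have "\<dots> = 2 * ((\<integral>\<^sup>+x. ennreal (exp (?f x)) \<partial>P) + (\<integral>\<^sup>+x. ennreal (exp (- ?f x)) \<partial>P))"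
    by (simp add: nn_integral_cmult nn_integral_add)
  also have "(\<integral>\<^sup>+x. ennreal (exp (- ?f x)) \<partial>P) = (\<integral>\<^sup>+x. ennreal (exp (\<Sum>i<n. (- u i) * mv (E x) v i)) \<partial>P)"
    by (simp add: sum_negf)
  also have "2 * ((\<integral>\<^sup>+x. ennreal (exp (?f x)) \<partial>P) + \<dots>) = ennreal (4 * exp (1/2))"
    unfolding exponential_moment using u v by (simp add: ennreal_plus[symmetric] ennreal_mult[symmetric] del: ennreal_plus)
      (simp flip: ennreal_mult ennreal_numeral)
  also have "\<dots> \<le> ennreal 8"
  proof (rule ennreal_leI)
    have "exp (1/2::real) \<le> 1 + 1/2 + (1/2)\<^sup>2" by (rule exp_bound) auto
    also have "\<dots> \<le> 2" by (simp add: power2_eq_square)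
    finally show "4 * exp (1/2::real) \<le> 8" by simp
  qed
  finally show ?thesis by simp
qed

lemma AE_transfer:
  assumes N: "N \<in> sets (entries_measure n p)" "emeasure (entries_measure n p) N = 0"
  shows "AE x in P. entries (E x) \<notin> N"
proof -
  let ?L = "entries_measure n p"
  have m: "(\<lambda>x. entries (E x)) \<in> measurable P ?L" by (rule mmeas_entries[OF E])
  have "AE e in ?L. e \<notin> N" using N by (auto simp: null_sets_def intro: AE_not_in)
  then have "(\<integral>\<^sup>+e. ennreal (c * exp (- wnorm n p (minv S) (Matrix.mat n p e) / 2)) * indicator N e \<partial>?L) = 0"
    by (intro nn_integral_zero' ) (auto elim!: eventually_mono)
  then have "(\<integral>\<^sup>+x. indicator N (entries (E x)) \<partial>P) = 0"
    using law[of "indicator N"] N(1) by simp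
  moreover have "(\<lambda>x. indicator N (entries (E x)) :: ennreal) \<in> borel_measurable P"
    using measurable_compose[OF m borel_measurable_indicator[OF N(1)]] .
  ultimately have "AE x in P. indicator N (entries (E x)) = (0::ennreal)"
    by (subst (asm) nn_integral_0_iff_AE) auto
  then show ?thesis by (auto elim!: eventually_mono simp: indicator_def split: if_splits)
qed

end

lemma matrix_normal_noise:
  assumes P: "prob_space P" and Y: "matrix_normal P n p Y M S" and S: "pos_def p S" and M: "M \<in> carrier_mat n p"
  shows "\<exists>c. gaussian_matrix P n p (\<lambda>x. Y x - M) S c"
proof -
  let ?L = "entries_measure n p" and ?m = "\<lambda>e. Matrix.mat n p e"
  define c where "c = (2 * pi) powr (- (real n * real p) / 2) * det S powr (- real n / 2)"
  have Yc: "Y x \<in> carrier_mat n p" if "x \<in> space P" for x using Y that by (simp add: matrix_normal_def)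
  have D: "distributed P ?L (\<lambda>x. entries (Y x)) (\<lambda>y. ennreal (normal_mat_density M S (?m y)))"
    using Y by (simp add: matrix_normal_def)
  have Sc: "S \<in> carrier_mat p p" and "det S \<noteq> 0" using pos_defD(1)[OF S] pos_def_det[OF S] by auto
  then have K: "minv S \<in> carrier_mat p p" by (rule minv)
  have dens: "normal_mat_density M S (?m y) = c * exp (- wnorm n p (minv S) (?m y - M) / 2)" for y
    using mtrace_gram[OF K, of "?m y - M" n] M by (simp add: normal_mat_density_def c_def minus_carrier_mat Let_def)
  have mE: "mmeas P n p (\<lambda>x. Y x - M)"
  proof (rule mmeas_minus[OF _ mmeas_const[OF M]])
    have "mmeas P n p (\<lambda>x. ?m (entries (Y x)))"
      using D by (intro mmeas_mat_compose) (simp add: distributed_def)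
    then show "mmeas P n p Y"
      unfolding mmeas_def using Yc by (auto simp: mat_entries[OF Yc] cong: measurable_cong)
  qed
  show ?thesis
  proof (intro exI[of _ c])
    interpret prob_space P by fact
    show "gaussian_matrix P n p (\<lambda>x. Y x - M) S c"
    proof (unfold_locales)
      fix g :: "(nat \<times> nat \<Rightarrow> real) \<Rightarrow> ennreal" assume g[measurable]: "g \<in> borel_measurable ?L"
      have [measurable]: "(\<lambda>y. entries (?m y - M)) \<in> measurable ?L ?L"
        by (intro mmeas_entries mmeas_minus mmeas_mat mmeas_const M)
      let ?h = "\<lambda>y. ennreal (normal_mat_density M S (?m y)) * g (entries (?m y - M))"
      have [measurable]: "(\<lambda>y. ennreal (normal_mat_density M S (?m y))) \<in> borel_measurable ?L"
        using D by (simp add: distributed_def)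
      have "(\<integral>\<^sup>+x. g (entries (Y x - M)) \<partial>P) = (\<integral>\<^sup>+x. g (entries (?m (entries (Y x)) - M)) \<partial>P)"
        by (intro nn_integral_cong) (simp add: mat_entries[OF Yc])
      also have "\<dots> = (\<integral>\<^sup>+y. ?h y \<partial>?L)"
        by (rule distributed_nn_integral[OF D, symmetric]) measurable
      also have "\<dots> = (\<integral>\<^sup>+e. ?h (\<lambda>ij\<in>{..<n}\<times>{..<p}. e ij + M $$ ij) \<partial>?L)"
        by (rule nn_integral_Leb_translation[symmetric]) (simp, measurable)
      also have "\<dots> = (\<integral>\<^sup>+e. ennreal (c * exp (- wnorm n p (minv S) (?m e) / 2)) * g e \<partial>?L)"
      proof (rule nn_integral_cong)
        fix e assume e: "e \<in> space ?L"
        have "?m (\<lambda>ij\<in>{..<n}\<times>{..<p}. e ij + M $$ ij) - M = ?m e" using M by (intro eq_matI) auto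
        then show "?h (\<lambda>ij\<in>{..<n}\<times>{..<p}. e ij + M $$ ij) = ennreal (c * exp (- wnorm n p (minv S) (?m e) / 2)) * g e"
          unfolding dens by (simp add: entries_mat[OF e])
      qed
      finally show "(\<integral>\<^sup>+x. g (entries (Y x - M)) \<partial>P) = (\<integral>\<^sup>+e. ennreal (c * exp (- wnorm n p (minv S) (?m e) / 2)) * g e \<partial>?L)" .
    qed (use mE S in \<open>auto simp: c_def\<close>)
  qed
qed

section \<open>Almost sure nonsingularity\<close>

lemma mv_square_le: "(mv G x i)\<^sup>2 \<le> (\<Sum>a<dim_col G. (G $$ (i,a))\<^sup>2) * (\<Sum>a<dim_col G. (x a)\<^sup>2)"
  unfolding mv_def by (rule Cauchy_Schwarz_ineq_sum)

text \<open>Along a direction \<open>F\<close> whose Gram matrix is the identity, the determinant is a polynomial in the step \<open>t\<close>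
  which does not vanish for large \<open>t\<close>.\<close>

lemma finite_singular_on_line:
  assumes B: "B \<subseteq> {..<n}" and \<iota>: "inj_on \<iota> {..<p}" "\<iota> ` {..<p} \<subseteq> B"
    and G: "\<And>t. G t \<in> carrier_mat n p"
    and line: "\<And>t i a. i < n \<Longrightarrow> a < p \<Longrightarrow> G t $$ (i,a) = G0 $$ (i,a) + t * (if i = \<iota> a then 1 else 0)"
    and G0: "G0 \<in> carrier_mat n p"
  shows "finite {t. det (gram (G t) B) = 0}"
proof -
  define f where "f i a = (if i = \<iota> a then 1 else 0 :: real)" for i a
  define Q where "Q = Matrix.mat p p (\<lambda>(a,b). \<Sum>i\<in>B. [:G0 $$ (i,a), f i a:] * [:G0 $$ (i,b), f i b:])"
  have fB: "finite B" using B finite_subset by blast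
  have Qt: "poly (det Q) t = det (gram (G t) B)" for t
  proof -
    have hom: "comm_ring_hom (\<lambda>q. poly q t)" by unfold_locales auto
    have "map_mat (\<lambda>q. poly q t) Q = gram (G t) B"
    proof (rule eq_matI)
      fix a b assume "a < dim_row (gram (G t) B)" "b < dim_col (gram (G t) B)"
      then have ab: "a < p" "b < p" using G[of t] by auto
      have "poly (\<Sum>i\<in>B. [:G0 $$ (i,a), f i a:] * [:G0 $$ (i,b), f i b:]) t
        = (\<Sum>i\<in>B. (G0 $$ (i,a) + t * f i a) * (G0 $$ (i,b) + t * f i b))"
        by (simp only: poly_sum poly_mult) simp
      also have "\<dots> = (\<Sum>i\<in>B. G t $$ (i,a) * G t $$ (i,b))"
        by (intro sum.cong refl) (use B ab in \<open>auto simp: line f_def\<close>)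
      finally show "map_mat (\<lambda>q. poly q t) Q $$ (a,b) = gram (G t) B $$ (a,b)"
        using ab G[of t] by (simp only: Q_def gram_def) auto
    qed (use G[of t] in \<open>auto simp: Q_def\<close>)
    then show ?thesis using comm_ring_hom.hom_det[OF hom, of Q] by simp
  qed
  define C where "C = (\<Sum>i\<in>B. \<Sum>a<p. (G0 $$ (i,a))\<^sup>2)"
  have C0: "C \<ge> 0" unfolding C_def by (intro sum_nonneg) auto
  define t where "t = C + 1"
  have "C < t\<^sup>2"
  proof -
    have "C \<le> C + C\<^sup>2 + C" using C0 by simp
    then show ?thesis by (simp add: t_def power2_eq_square algebra_simps)
  qed
  have "pos_def p (gram (G t) B)"
  proof (rule pos_defI[OF gram_carrier(1)[OF G] gram_sym])
    fix x :: "nat \<Rightarrow> real" assume x: "\<exists>a<p. x a \<noteq> 0"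
    then have x0: "(\<Sum>a<p. (x a)\<^sup>2) > 0" by (auto intro!: sum_pos2)
    have dG: "dim_col (G t) = p" using G by auto
    show "qf p (gram (G t) B) x > 0"
    proof (rule ccontr)
      assume "\<not> ?thesis"
      then have "(\<Sum>i\<in>B. (mv (G t) x i)\<^sup>2) = 0"
        unfolding gram_qf[OF dG] by (simp add: order_antisym sum_nonneg)
      then have z: "mv (G t) x i = 0" if "i \<in> B" for i
        using fB that by (subst (asm) sum_nonneg_eq_0_iff) auto
      have *: "t * x b = - mv G0 x (\<iota> b)" if b: "b < p" for b
      proof -
        have ib: "\<iota> b \<in> B" "\<iota> b < n" using \<iota>(2) B b by auto
        have "mv (G t) x (\<iota> b) = (\<Sum>a<p. G0 $$ (\<iota> b,a) * x a + (if a = b then t * x b else 0))"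
          unfolding mv_def dG using ib \<iota>(1) b by (intro sum.cong refl) (auto simp: line algebra_simps inj_on_eq_iff)
        also have "\<dots> = mv G0 x (\<iota> b) + t * x b"
          using b G0 by (simp add: sum.distrib mv_def)
        finally show ?thesis using z[OF ib(1)] by simp
      qed
      have "t\<^sup>2 * (\<Sum>b<p. (x b)\<^sup>2) = (\<Sum>b<p. (mv G0 x (\<iota> b))\<^sup>2)"
        using * by (simp add: sum_distrib_left power_mult_distrib[symmetric])
      also have "\<dots> = (\<Sum>i\<in>\<iota> ` {..<p}. (mv G0 x i)\<^sup>2)" using \<iota>(1) by (simp add: sum.reindex)
      also have "\<dots> \<le> (\<Sum>i\<in>B. (mv G0 x i)\<^sup>2)" using \<iota>(2) fB by (intro sum_mono2) auto
      also have "\<dots> \<le> C * (\<Sum>b<p. (x b)\<^sup>2)"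
        unfolding C_def using mv_square_le[of G0 x] G0 by (subst sum_distrib_right, intro sum_mono) auto
      finally show False using x0 \<open>C < t\<^sup>2\<close> by simp
    qed
  qed
  then have "poly (det Q) t \<noteq> 0" unfolding Qt using pos_def_det by (metis less_irrefl)
  then have "det Q \<noteq> 0" by auto
  then show ?thesis using poly_roots_finite[of "det Q"] by (simp add: Qt)
qed

lemma null_of_null_on_lines:
  assumes I: "finite I" and N [measurable]: "N \<in> sets (Leb I)"
    and fin: "\<And>x. x \<in> space (Leb I) \<Longrightarrow> finite {t. (\<lambda>i\<in>I. x i + t * d i) \<in> N}"
  shows "emeasure (Leb I) N = 0"
proof -
  let ?L = "Leb I"
  interpret L: sigma_finite_measure ?L by (rule Leb_sigma_finite[OF I])
  define U where "U = restrict_space lborel {0..1::real}"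
  have U1: "emeasure U (space U) = 1" by (simp add: U_def emeasure_restrict_space space_restrict_space)
  interpret U: finite_measure U by (rule finite_measureI) (simp add: U1)
  interpret pair_sigma_finite U ?L by unfold_locales
  have [measurable]: "(\<lambda>t. t) \<in> borel_measurable U" unfolding U_def by (rule measurable_restrict_space1) simp
  have [measurable]: "(\<lambda>(t,x). \<lambda>i\<in>I. x i + t * d i) \<in> measurable (U \<Otimes>\<^sub>M ?L) ?L"
    unfolding split_beta' by (rule measurable_restrict) measurable
  have "emeasure ?L N = (\<integral>\<^sup>+t. emeasure ?L N \<partial>U)" by (simp add: U1)
  also have "\<dots> = (\<integral>\<^sup>+t. \<integral>\<^sup>+x. indicator N (\<lambda>i\<in>I. x i + t * d i) \<partial>?L \<partial>U)"
  proof (rule nn_integral_cong)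
    fix t
    have "(\<integral>\<^sup>+x. indicator N (\<lambda>i\<in>I. x i + t * d i) \<partial>?L) = (\<integral>\<^sup>+x. indicator N x \<partial>?L)"
      by (rule nn_integral_Leb_translation[OF I]) measurable
    then show "emeasure ?L N = (\<integral>\<^sup>+x. indicator N (\<lambda>i\<in>I. x i + t * d i) \<partial>?L)" by simp
  qed
  also have "\<dots> = (\<integral>\<^sup>+x. \<integral>\<^sup>+t. indicator N (\<lambda>i\<in>I. x i + t * d i) \<partial>U \<partial>?L)"
    by (rule Fubini'[symmetric]) measurable
  also have "\<dots> = (\<integral>\<^sup>+x. 0 \<partial>?L)"
  proof (rule nn_integral_cong)
    fix x assume x: "x \<in> space ?L"
    let ?F = "{t. (\<lambda>i\<in>I. x i + t * d i) \<in> N}"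
    have "?F \<in> null_sets lborel" by (intro finite_imp_null_set_lborel fin x)
    then have "AE t in lborel. t \<notin> ?F" by (rule AE_not_in)
    then have "AE t in U. t \<notin> ?F" unfolding U_def by (subst AE_restrict_space_iff) auto
    then show "(\<integral>\<^sup>+t. indicator N (\<lambda>i\<in>I. x i + t * d i) \<partial>U) = 0"
      by (intro nn_integral_zero') (auto elim!: eventually_mono)
  qed
  finally show ?thesis by simp
qed

lemma (in gaussian_matrix) AE_gram_nonsingular:
  assumes B: "B \<subseteq> {..<n}" and card: "p \<le> card B"
  shows "AE x in P. det (gram (E x) B) \<noteq> 0"
proof -
  let ?L = "entries_measure n p" and ?m = "\<lambda>e. Matrix.mat n p e"
  define N where "N = {e\<in>space ?L. det (gram (?m e) B) = 0}"
  have meas: "(\<lambda>e. det (gram (?m e) B)) \<in> borel_measurable ?L"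
    by (intro mmeas_det[of _ p] mmeas_gram[of _ n] mmeas_mat B)
  have N: "N \<in> sets ?L"
    unfolding N_def using measurable_sets[OF meas, of "{0}"] by (simp add: vimage_def Int_def conj_commute)
  obtain B' where B': "B' \<subseteq> B" "card B' = p" "finite B'"
    using obtain_subset_with_card_n[OF card] by blast
  obtain \<iota> where "bij_betw \<iota> {..<p} B'"
    using ex_bij_betw_nat_finite[OF B'(3)] B'(2) by (auto simp: atLeast0LessThan)
  then have \<iota>: "inj_on \<iota> {..<p}" "\<iota> ` {..<p} \<subseteq> B" using B'(1) by (auto simp: bij_betw_def)
  define d where "d ij = (if fst ij = \<iota> (snd ij) then 1 else 0 :: real)" for ij :: "nat \<times> nat"
  have "emeasure ?L N = 0"
  proof (rule null_of_null_on_lines[where d = d])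
    fix x assume x: "x \<in> space ?L"
    have "finite {t. det (gram (?m (\<lambda>i\<in>{..<n} \<times> {..<p}. x i + t * d i)) B) = 0}"
      by (rule finite_singular_on_line[OF B \<iota>, where ?G0.0 = "?m x"]) (auto simp: d_def)
    then show "finite {t. (\<lambda>i\<in>{..<n} \<times> {..<p}. x i + t * d i) \<in> N}"
      by (rule rev_finite_subset) (auto simp: N_def)
  qed (use N in auto)
  from AE_transfer[OF N this] AE_space show ?thesis
    by eventually_elim (auto simp: N_def entries_in_space[OF mmeasD(1)[OF E]] mat_entries[OF mmeasD(1)[OF E]])
qed

section \<open>Leverages\<close>

text \<open>The entries of the projection onto the column space of the rows of \<open>G\<close> in \<open>B\<close>; all of them are \<open>0\<close> when the
  Gram matrix is singular.\<close>

definition lev :: "real mat \<Rightarrow> nat set \<Rightarrow> nat \<Rightarrow> nat \<Rightarrow> real" where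
  "lev G B i j = (\<Sum>a<dim_col G. \<Sum>b<dim_col G. G $$ (i,a) * inv0 (gram G B) $$ (a,b) * G $$ (j,b))"

lemma inv0_gram:
  assumes G: "G \<in> carrier_mat n p" and d: "det (gram G B) \<noteq> 0"
  shows "inv0 (gram G B) \<in> carrier_mat p p" "gram G B * inv0 (gram G B) = 1\<^sub>m p"
    "inv0 (gram G B) * gram G B = 1\<^sub>m p" "(inv0 (gram G B))\<^sup>T = inv0 (gram G B)"
proof -
  let ?S = "gram G B"
  have S: "?S \<in> carrier_mat p p" using G by simp
  note m = minv[OF S d, folded inv0_minv[OF S d]]
  show "inv0 ?S \<in> carrier_mat p p" "?S * inv0 ?S = 1\<^sub>m p" "inv0 ?S * ?S = 1\<^sub>m p" by (fact m)+
  have "?S * (inv0 ?S)\<^sup>T = (inv0 ?S * ?S)\<^sup>T"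
    using m(1) S by (subst mat_transpose_mult_dim) (auto simp: gram_sym)
  also have "\<dots> = 1\<^sub>m p" using m(3) by simp
  finally have "minv ?S = (inv0 ?S)\<^sup>T" by (intro minv_unique(1)[OF S]) (use m(1) in auto)
  then show "(inv0 ?S)\<^sup>T = inv0 ?S" using inv0_minv[OF S d] by simp
qed

lemma lev_singular: "det (gram G B) = 0 \<Longrightarrow> lev G B i j = 0"
  unfolding lev_def inv0_def by (auto simp: adj_mat_def intro!: sum.neutral)

lemma lev_sym:
  assumes G: "G \<in> carrier_mat n p" shows "lev G B i j = lev G B j i"
proof (cases "det (gram G B) = 0")
  case False
  note K = inv0_gram[OF G False]
  have k: "inv0 (gram G B) $$ (a,b) = inv0 (gram G B) $$ (b,a)" if "a < p" "b < p" for a b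
    using K(1,4) that by (metis carrier_matD index_transpose_mat(1))
  have "lev G B i j = (\<Sum>b<dim_col G. \<Sum>a<dim_col G. G $$ (i,a) * inv0 (gram G B) $$ (a,b) * G $$ (j,b))"
    unfolding lev_def by (rule sum.swap)
  also have "\<dots> = lev G B j i"
    unfolding lev_def using G k by (intro sum.cong refl) (auto simp: mult_ac)
  finally show ?thesis .
qed (simp add: lev_singular)

lemma sum_lev_lev:
  assumes G: "G \<in> carrier_mat n p" shows "(\<Sum>l\<in>B. lev G B i l * lev G B l j) = lev G B i j"
proof (cases "det (gram G B) = 0")
  case False
  note K = inv0_gram[OF G False]
  let ?K = "inv0 (gram G B)" and ?S = "gram G B"
  have S: "?S \<in> carrier_mat p p" using G by simp
  define w where "w i = mv ?K (\<lambda>b. G $$ (i,b))" for i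
  have 1: "lev G B i j = (\<Sum>a<p. G $$ (i,a) * w j a)" for i j
    using G K(1) by (simp add: lev_def w_def mv_def sum_distrib_left mult.assoc)
  have 2: "(\<Sum>b<p. ?S $$ (a,b) * w j b) = G $$ (j,a)" if "a < p" for a
    using mv_mult[OF S K(1) that, of "\<lambda>b. G $$ (j,b)"] mv_one[OF that, of "\<lambda>b. G $$ (j,b)"] S G
    by (simp add: K(2) w_def mv_def[of ?S])
  have "(\<Sum>l\<in>B. lev G B i l * lev G B l j) = (\<Sum>l\<in>B. (\<Sum>a<p. G $$ (l,a) * w i a) * (\<Sum>b<p. G $$ (l,b) * w j b))"
    unfolding lev_sym[OF G, of B i] by (simp add: 1)
  also have "\<dots> = (\<Sum>l\<in>B. \<Sum>a<p. \<Sum>b<p. w i a * (G $$ (l,a) * G $$ (l,b) * w j b))"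
    by (simp add: sum_product mult_ac)
  also have "\<dots> = (\<Sum>a<p. \<Sum>b<p. \<Sum>l\<in>B. w i a * (G $$ (l,a) * G $$ (l,b) * w j b))"
    by (simp only: sum.swap[of _ _ B])
  also have "\<dots> = (\<Sum>a<p. w i a * (\<Sum>b<p. ?S $$ (a,b) * w j b))"
    using G by (auto simp: gram_def sum_distrib_left sum_distrib_right intro!: sum.cong)
  also have "\<dots> = (\<Sum>a<p. w i a * G $$ (j,a))" using 2 by (intro sum.cong refl) simp
  also have "\<dots> = lev G B j i" by (simp add: 1 mult.commute)
  finally show ?thesis using lev_sym[OF G] by simp
qed (simp add: lev_singular)

lemma sum_lev:
  assumes G: "G \<in> carrier_mat n p" and d: "det (gram G B) \<noteq> 0" shows "(\<Sum>l\<in>B. lev G B l l) = p"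
proof -
  note K = inv0_gram[OF G d]
  let ?K = "inv0 (gram G B)" and ?S = "gram G B"
  have "(\<Sum>l\<in>B. lev G B l l) = (\<Sum>a<p. \<Sum>b<p. \<Sum>l\<in>B. ?K $$ (a,b) * (G $$ (l,b) * G $$ (l,a)))"
    using G unfolding lev_def by (simp only: sum.swap[of _ _ B]) (simp add: mult_ac)
  also have "\<dots> = (\<Sum>a<p. \<Sum>b<p. ?K $$ (a,b) * ?S $$ (b,a))"
    using G by (intro sum.cong refl) (simp add: gram_def sum_distrib_left)
  also have "\<dots> = (\<Sum>a<p. (?K * ?S) $$ (a,a))"
    using G K(1) by (intro sum.cong refl) (subst mult_index_sum, auto)
  also have "\<dots> = p" unfolding K(3) by simp
  finally show ?thesis .
qed

lemma det_gram_remove: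
  assumes G: "G \<in> carrier_mat n p" and d: "det (gram G B) \<noteq> 0" and B: "finite B" "i \<in> B"
  shows "det (gram G (B - {i})) = det (gram G B) * (1 - lev G B i i)"
proof -
  have S: "gram G B \<in> carrier_mat p p" using G by simp
  have "gram G (B - {i}) = Matrix.mat p p (\<lambda>(a,b). gram G B $$ (a,b) - G $$ (i,a) * G $$ (i,b))"
    using G B by (intro eq_matI) (auto simp: gram_def sum_diff1)
  then show ?thesis
    using det_rank_one_downdate[OF S d, of "\<lambda>a. G $$ (i,a)"] G
    by (simp add: inv0_minv[OF S d, symmetric] qf_def lev_def)
qed

lemma lev_square_le: "G \<in> carrier_mat n p \<Longrightarrow> finite B \<Longrightarrow> i \<in> B \<Longrightarrow> j \<in> B \<Longrightarrow> (lev G B i j)\<^sup>2 \<le> lev G B i i"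
proof -
  assume a: "G \<in> carrier_mat n p" "finite B" "i \<in> B" "j \<in> B"
  have "(lev G B i j)\<^sup>2 \<le> (\<Sum>l\<in>B. (lev G B i l)\<^sup>2)" using a by (intro member_le_sum) auto
  also have "\<dots> = (\<Sum>l\<in>B. lev G B i l * lev G B l i)" using lev_sym[OF a(1)] by (simp add: power2_eq_square)
  also have "\<dots> = lev G B i i" by (rule sum_lev_lev[OF a(1)])
  finally show ?thesis .
qed

lemma lev_bounds:
  assumes "G \<in> carrier_mat n p" "finite B" "i \<in> B"
  shows "0 \<le> lev G B i i" "lev G B i i \<le> 1" "j \<in> B \<Longrightarrow> \<bar>lev G B i j\<bar> \<le> 1"
proof -
  have 1: "(lev G B i j)\<^sup>2 \<le> lev G B i i" if "j \<in> B" for j using lev_square_le[OF assms that] .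
  show 0: "0 \<le> lev G B i i" using 1[OF assms(3)] by (meson order_trans zero_le_power2)
  show 2: "lev G B i i \<le> 1"
    using 1[OF assms(3)] 0 by (cases "lev G B i i = 0") (auto simp: power2_eq_square mult_le_cancel_left2 mult_le_cancel_right2)
  show "\<bar>lev G B i j\<bar> \<le> 1" if "j \<in> B"
    using 1[OF that] 2 by (metis abs_square_le_1 order_trans)
qed

definition plane_rotation :: "nat \<Rightarrow> nat \<Rightarrow> nat \<Rightarrow> real \<Rightarrow> real \<Rightarrow> real mat" where
  "plane_rotation n i j c s = Matrix.mat n n (\<lambda>(k,l).
     if k = i then (if l = i then c else if l = j then s else 0)
     else if k = j then (if l = i then - s else if l = j then c else 0)
     else if k = l then 1 else 0)"

lemma plane_rotation_mult:
  assumes G: "G \<in> carrier_mat n p" and ij: "i < n" "j < n" "i \<noteq> j" and k: "k < n" "a < p"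
  shows "(plane_rotation n i j c s * G) $$ (k,a) = (if k = i then c * G $$ (i,a) + s * G $$ (j,a)
    else if k = j then - s * G $$ (i,a) + c * G $$ (j,a) else G $$ (k,a))"
proof -
  have "(plane_rotation n i j c s * G) $$ (k,a) = (\<Sum>l<n. (if l = i then (if k = i then c else if k = j then - s else 0) * G $$ (i,a) else 0)
    + (if l = j then (if k = i then s else if k = j then c else 0) * G $$ (j,a) else 0)
    + (if l = k then (if k = i \<or> k = j then 0 else 1) * G $$ (k,a) else 0))"
  proof -
    have "(plane_rotation n i j c s * G) $$ (k,a) = (\<Sum>l<n. plane_rotation n i j c s $$ (k,l) * G $$ (l,a))"
      using G k by (subst mult_index_sum) (auto simp: plane_rotation_def)
    then show ?thesis by (rule trans) (rule sum.cong, use ij k in \<open>auto simp: plane_rotation_def\<close>)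
  qed
  then show ?thesis using ij k by (simp add: sum.distrib)
qed

lemma plane_rotation_orthogonal:
  assumes ij: "i < n" "j < n" "i \<noteq> j" and cs: "c\<^sup>2 + s\<^sup>2 = 1"
  shows "plane_rotation n i j c s \<in> carrier_mat n n"
    "(plane_rotation n i j c s)\<^sup>T * plane_rotation n i j c s = 1\<^sub>m n"
proof -
  let ?R = "plane_rotation n i j c s" and ?R' = "plane_rotation n i j c (- s)"
  show R: "?R \<in> carrier_mat n n" by (simp add: plane_rotation_def)
  have T: "?R\<^sup>T = ?R'" by (rule eq_matI) (auto simp: plane_rotation_def ij)
  show "?R\<^sup>T * ?R = 1\<^sub>m n"
  proof (rule eq_matI)
    fix k l assume "k < dim_row (1\<^sub>m n :: real mat)" "l < dim_col (1\<^sub>m n :: real mat)"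
    then have kl: "k < n" "l < n" by auto
    have "(?R\<^sup>T * ?R) $$ (k,l) = (if k = i then c * ?R $$ (i,l) - s * ?R $$ (j,l)
    else if k = j then s * ?R $$ (i,l) + c * ?R $$ (j,l) else ?R $$ (k,l))"
      unfolding T plane_rotation_mult[OF R ij kl] by simp
    also have "\<dots> = 1\<^sub>m n $$ (k,l)"
      using kl ij cs by (auto simp: plane_rotation_def power2_eq_square)
    finally show "(?R\<^sup>T * ?R) $$ (k,l) = 1\<^sub>m n $$ (k,l)" .
  qed (use R in auto)
qed

lemma gram_plane_rotation:
  assumes G: "G \<in> carrier_mat n p" and B: "B \<subseteq> {..<n}" "i \<in> B" "j \<in> B" "i \<noteq> j" and cs: "c\<^sup>2 + s\<^sup>2 = 1"
  shows "gram (plane_rotation n i j c s * G) B = gram G B"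
proof (rule eq_matI)
  let ?R = "plane_rotation n i j c s"
  have R: "?R \<in> carrier_mat n n" by (simp add: plane_rotation_def)
  have ij: "i < n" "j < n" using B by auto
  have fB: "finite B" using B finite_subset by blast
  fix a b assume "a < dim_row (gram G B)" "b < dim_col (gram G B)"
  then have ab: "a < p" "b < p" using G by auto
  have split: "(\<Sum>k\<in>B. f k) = f i + f j + (\<Sum>k\<in>B - {i,j}. f k)" for f :: "nat \<Rightarrow> real"
    using fB B by (subst sum.subset_diff[of "{i,j}"]) auto
  let ?f = "\<lambda>k. (?R * G) $$ (k,a) * (?R * G) $$ (k,b)"
  have "?f i + ?f j = (c\<^sup>2 + s\<^sup>2) * (G $$ (i,a) * G $$ (i,b) + G $$ (j,a) * G $$ (j,b))"
    using B(4) unfolding plane_rotation_mult[OF G ij B(4) ij(1) ab(1)] plane_rotation_mult[OF G ij B(4) ij(1) ab(2)]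
      plane_rotation_mult[OF G ij B(4) ij(2) ab(1)] plane_rotation_mult[OF G ij B(4) ij(2) ab(2)]
    by (simp add: algebra_simps power2_eq_square)
  moreover have "(\<Sum>k\<in>B - {i,j}. ?f k) = (\<Sum>k\<in>B - {i,j}. G $$ (k,a) * G $$ (k,b))"
    using B(1) ab by (intro sum.cong refl) (auto simp: plane_rotation_mult[OF G ij B(4)] simp del: index_mult_mat(1))
  ultimately have "(\<Sum>k\<in>B. ?f k) = (\<Sum>k\<in>B. G $$ (k,a) * G $$ (k,b))" unfolding split using cs by simp
  then show "gram (?R * G) B $$ (a,b) = gram G B $$ (a,b)"
    using ab G by (simp add: gram_def del: index_mult_mat(1))
qed (use G in auto)

lemma lev_bilinear:
  assumes "dim_col H = dim_col G" "gram H B = gram G B"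
    "\<And>a. a < dim_col G \<Longrightarrow> H $$ (k,a) = x * G $$ (i,a) + y * G $$ (j,a)"
    "\<And>a. a < dim_col G \<Longrightarrow> H $$ (l,a) = x' * G $$ (i,a) + y' * G $$ (j,a)"
  shows "lev H B k l = x * x' * lev G B i i + x * y' * lev G B i j + y * x' * lev G B j i + y * y' * lev G B j j"
  unfolding lev_def assms(1,2) sum_distrib_left sum.distrib[symmetric]
  by (intro sum.cong refl) (auto simp: assms(3,4) algebra_simps)

lemma lev_plane_rotation:
  assumes G: "G \<in> carrier_mat n p" and B: "B \<subseteq> {..<n}" "i \<in> B" "j \<in> B" "i \<noteq> j" and cs: "c\<^sup>2 + s\<^sup>2 = 1"
  defines "H \<equiv> plane_rotation n i j c s * G"
  shows "lev H B i i = c\<^sup>2 * lev G B i i + 2 * c * s * lev G B i j + s\<^sup>2 * lev G B j j"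
    "lev H B j j = s\<^sup>2 * lev G B i i - 2 * c * s * lev G B i j + c\<^sup>2 * lev G B j j"
proof -
  have ij: "i < n" "j < n" using B by auto
  have Hi: "H $$ (i,a) = c * G $$ (i,a) + s * G $$ (j,a)" and Hj: "H $$ (j,a) = (- s) * G $$ (i,a) + c * G $$ (j,a)"
    if "a < dim_col G" for a
    using plane_rotation_mult[OF G ij B(4) ij(1), of a c s] plane_rotation_mult[OF G ij B(4) ij(2), of a c s] that G B(4)
    by (auto simp: H_def)
  have H: "dim_col H = dim_col G" "gram H B = gram G B"
    unfolding H_def using gram_plane_rotation[OF G B cs] by auto
  show "lev H B i i = c\<^sup>2 * lev G B i i + 2 * c * s * lev G B i j + s\<^sup>2 * lev G B j j"
    using lev_bilinear[OF H, of i c i s j i c s] Hi lev_sym[OF G, of B j i] by (simp add: power2_eq_square)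
  show "lev H B j j = s\<^sup>2 * lev G B i i - 2 * c * s * lev G B i j + c\<^sup>2 * lev G B j j"
    using lev_bilinear[OF H, of j "-s" i c j j "-s" c] Hj lev_sym[OF G, of B j i] by (simp add: power2_eq_square)
qed

context gaussian_matrix
begin

lemma expectation_rotation:
  fixes h :: "real mat \<Rightarrow> real"
  assumes R: "R \<in> carrier_mat n n" "R\<^sup>T * R = 1\<^sub>m n"
    and h: "(\<lambda>e. h (Matrix.mat n p e)) \<in> borel_measurable (entries_measure n p)"
  shows "expectation (\<lambda>x. h (R * E x)) = expectation (\<lambda>x. h (E x))"
proof -
  let ?L = "entries_measure n p"
  have RE: "mmeas P n p (\<lambda>x. R * E x)" by (rule mmeas_mult[OF mmeas_const[OF R(1)] E])
  note m = mmeas_entries[OF RE] mmeas_entries[OF E]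
  have eq: "distr P ?L (\<lambda>x. entries (R * E x)) = distr P ?L (\<lambda>x. entries (E x))"
  proof (rule measure_eqI)
    fix A assume "A \<in> sets (distr P ?L (\<lambda>x. entries (R * E x)))"
    then have A: "A \<in> sets ?L" by simp
    have "emeasure (distr P ?L (\<lambda>x. entries (R * E x))) A = (\<integral>\<^sup>+x. indicator A (entries (R * E x)) \<partial>P)"
      using A nn_integral_distr[OF m(1), of "indicator A"] by simp
    also have "\<dots> = (\<integral>\<^sup>+x. indicator A (entries (E x)) \<partial>P)"
      using A by (intro rotation_invariant R) auto
    also have "\<dots> = emeasure (distr P ?L (\<lambda>x. entries (E x))) A"
      using A nn_integral_distr[OF m(2), of "indicator A"] by simp
    finally show "emeasure (distr P ?L (\<lambda>x. entries (R * E x))) A = emeasure (distr P ?L (\<lambda>x. entries (E x))) A" .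
  qed simp
  have "expectation (\<lambda>x. h (R * E x)) = expectation (\<lambda>x. h (Matrix.mat n p (entries (R * E x))))"
    by (intro Bochner_Integration.integral_cong refl) (simp add: mat_entries[OF mmeasD(1)[OF RE]])
  also have "\<dots> = (\<integral>e. h (Matrix.mat n p e) \<partial>distr P ?L (\<lambda>x. entries (R * E x)))"
    by (rule integral_distr[symmetric, OF m(1) h])
  also have "\<dots> = expectation (\<lambda>x. h (Matrix.mat n p (entries (E x))))"
    unfolding eq by (rule integral_distr[OF m(2) h])
  also have "\<dots> = expectation (\<lambda>x. h (E x))"
    by (intro Bochner_Integration.integral_cong refl) (simp add: mat_entries[OF mmeasD(1)[OF E]])
  finally show ?thesis .
qed

end

lemma lev_measurable:
  assumes A: "mmeas M n p A" and B: "B \<subseteq> {..<n}" and ij: "i < n" "j < n"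
  shows "(\<lambda>x. lev (A x) B i j) \<in> borel_measurable M"
proof -
  have K: "mmeas M p p (\<lambda>x. inv0 (gram (A x) B))" by (intro mmeas_inv0 mmeas_gram[OF A B])
  have "(\<lambda>x. \<Sum>a<p. \<Sum>b<p. A x $$ (i,a) * inv0 (gram (A x) B) $$ (a,b) * A x $$ (j,b)) \<in> borel_measurable M"
    using mmeasD(2)[OF A] mmeasD(2)[OF K] ij by (intro borel_measurable_sum borel_measurable_times) auto
  then show ?thesis
    by (rule measurable_cong[THEN iffD1, rotated]) (simp add: lev_def mmeas_dims[OF A])
qed

locale gaussian_leverage = gaussian_matrix +
  fixes B :: "nat set"
  assumes B: "B \<subseteq> {..<n}" and card: "p \<le> card B" and p: "1 \<le> p"
begin

lemma finB: "finite B" using B finite_subset by blast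

abbreviation "lv i j x \<equiv> lev (E x) B i j"

lemma lv_measurable [measurable]: "i \<in> B \<Longrightarrow> j \<in> B \<Longrightarrow> (\<lambda>x. lv i j x) \<in> borel_measurable P"
  using B by (intro lev_measurable[OF E]) auto

lemma lv_abs: "x \<in> space P \<Longrightarrow> i \<in> B \<Longrightarrow> j \<in> B \<Longrightarrow> \<bar>lv i j x\<bar> \<le> 1"
  using lev_bounds(3)[OF mmeasD(1)[OF E] finB] by blast

lemma lv_int: "i \<in> B \<Longrightarrow> j \<in> B \<Longrightarrow> integrable P (\<lambda>x. lv i j x)"
  using lv_abs by (intro integrable_const_bound[of _ 1]) auto

lemma lv_int2: "i \<in> B \<Longrightarrow> j \<in> B \<Longrightarrow> i' \<in> B \<Longrightarrow> j' \<in> B \<Longrightarrow> integrable P (\<lambda>x. lv i j x * lv i' j' x)"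
proof (rule integrable_const_bound[of _ 1])
  assume a: "i \<in> B" "j \<in> B" "i' \<in> B" "j' \<in> B"
  show "AE x in P. norm (lv i j x * lv i' j' x) \<le> 1"
    using lv_abs a by (intro AE_I2) (auto simp: abs_mult intro!: mult_le_one)
qed auto

lemma rotate_expectation:
  fixes f :: "real \<Rightarrow> real \<Rightarrow> real"
  assumes ij: "i \<in> B" "j \<in> B" "i \<noteq> j" and cs: "r\<^sup>2 + s\<^sup>2 = 1" and f: "case_prod f \<in> borel_measurable (borel \<Otimes>\<^sub>M borel)"
  shows "expectation (\<lambda>x. f (lv i i x) (lv j j x)) = expectation (\<lambda>x. f (r\<^sup>2 * lv i i x + 2 * r * s * lv i j x + s\<^sup>2 * lv j j x)
    (s\<^sup>2 * lv i i x - 2 * r * s * lv i j x + r\<^sup>2 * lv j j x))"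
proof -
  have ij': "i < n" "j < n" using ij B by auto
  note R = plane_rotation_orthogonal[OF ij' ij(3) cs]
  have m: "(\<lambda>e. f (lev (Matrix.mat n p e) B i i) (lev (Matrix.mat n p e) B j j)) \<in> borel_measurable (entries_measure n p)"
    using measurable_compose[OF measurable_Pair[OF lev_measurable[OF mmeas_mat B ij'(1,1)] lev_measurable[OF mmeas_mat B ij'(2,2)]] f]
    by simp
  have "expectation (\<lambda>x. f (lv i i x) (lv j j x)) = expectation (\<lambda>x. f (lev (plane_rotation n i j r s * E x) B i i) (lev (plane_rotation n i j r s * E x) B j j))"
    by (rule expectation_rotation[OF R m, symmetric])
  also have "\<dots> = expectation (\<lambda>x. f (r\<^sup>2 * lv i i x + 2 * r * s * lv i j x + s\<^sup>2 * lv j j x)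
    (s\<^sup>2 * lv i i x - 2 * r * s * lv i j x + r\<^sup>2 * lv j j x))"
    by (intro Bochner_Integration.integral_cong refl) (simp add: lev_plane_rotation[OF mmeasD(1)[OF E] B ij cs])
  finally show ?thesis .
qed

lemma expectation_lv_eq:
  assumes "i \<in> B" "j \<in> B"
  shows "expectation (lv i i) = expectation (lv j j)"
    "expectation (\<lambda>x. (lv i i x)\<^sup>2) = expectation (\<lambda>x. (lv j j x)\<^sup>2)"
  using rotate_expectation[OF assms, of 0 1 "\<lambda>x y. x"] rotate_expectation[OF assms, of 0 1 "\<lambda>x y. x\<^sup>2"]
  by (cases "i = j"; simp)+

lemma AE_sum_lv: "AE x in P. (\<Sum>i\<in>B. lv i i x) = p"
  using AE_gram_nonsingular[OF B card] AE_space
  by eventually_elim (rule sum_lev[OF mmeasD(1)[OF E]])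

lemma expectation_lv: "i \<in> B \<Longrightarrow> expectation (lv i i) = p / card B"
proof -
  assume i: "i \<in> B"
  have "real p = expectation (\<lambda>x. \<Sum>i\<in>B. lv i i x)"
    using integral_cong_AE[OF _ _ AE_sum_lv] by (simp add: prob_space)
  also have "\<dots> = (\<Sum>j\<in>B. expectation (lv j j))" by (intro Bochner_Integration.integral_sum lv_int)
  also have "\<dots> = (\<Sum>j\<in>B. expectation (lv i i))" using expectation_lv_eq(1)[OF _ i] by (intro sum.cong) auto
  finally show ?thesis using i finB by (simp add: field_simps card_gt_0_iff) blast
qed

text \<open>Rotations in coordinate planes leave the moments of the leverages invariant. With the trace and the idempotence of
  the projection, this determines the second moments without any Wishart distribution.\<close>

lemma expectation_lv_square: "i \<in> B \<Longrightarrow> expectation (\<lambda>x. (lv i i x)\<^sup>2) = real p * (real p + 2) / (real (card B) * (real (card B) + 2))"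
proof -
  assume i: "i \<in> B"
  let ?N = "real (card B)"
  define m where "m = expectation (\<lambda>x. (lv i i x)\<^sup>2)"
  have mj: "expectation (\<lambda>x. (lv j j x)\<^sup>2) = m" if "j \<in> B" for j
    unfolding m_def by (rule expectation_lv_eq(2)[OF that i])
  have int2: "integrable P (\<lambda>x. (lv j k x)\<^sup>2)" if "j \<in> B" "k \<in> B" for j k
    using lv_int2[OF that that] by (simp add: power2_eq_square)
  have pair: "m = expectation (\<lambda>x. lv j j x * lv k k x) + 2 * expectation (\<lambda>x. (lv j k x)\<^sup>2)" if jk: "j \<in> B" "k \<in> B" "j \<noteq> k" for j k
  proof -
    let ?r = "1 / sqrt (2::real)"
    have "?r\<^sup>2 + ?r\<^sup>2 = 1" by (simp add: power_divide)
    from rotate_expectation[OF jk this, of "\<lambda>x y. x\<^sup>2 + y\<^sup>2"]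
    have "expectation (\<lambda>x. (lv j j x)\<^sup>2 + (lv k k x)\<^sup>2) = expectation (\<lambda>x. (lv j j x / 2 + lv j k x + lv k k x / 2)\<^sup>2 + (lv j j x / 2 - lv j k x + lv k k x / 2)\<^sup>2)"
      by (simp add: power_divide)
    also have "\<dots> = expectation (\<lambda>x. ((lv j j x)\<^sup>2 + (lv k k x)\<^sup>2) / 2 + (lv j j x * lv k k x + 2 * (lv j k x)\<^sup>2))"
      by (intro Bochner_Integration.integral_cong refl) (simp add: power2_eq_square field_simps)
    also have "\<dots> = (m + m) / 2 + (expectation (\<lambda>x. lv j j x * lv k k x) + 2 * expectation (\<lambda>x. (lv j k x)\<^sup>2))"
      using jk int2 lv_int2 by (simp add: mj)
    also have "expectation (\<lambda>x. (lv j j x)\<^sup>2 + (lv k k x)\<^sup>2) = m + m" using jk int2 by (simp add: mj)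
    finally show ?thesis by simp
  qed
  have "real p * real p = expectation (\<lambda>x. \<Sum>j\<in>B. \<Sum>k\<in>B. lv j j x * lv k k x)"
  proof -
    have "AE x in P. (\<Sum>j\<in>B. \<Sum>k\<in>B. lv j j x * lv k k x) = real p * real p"
      using AE_sum_lv by eventually_elim (simp add: sum_product[symmetric])
    from integral_cong_AE[OF _ _ this] show ?thesis by (simp add: prob_space)
  qed
  also have "\<dots> = (\<Sum>j\<in>B. \<Sum>k\<in>B. expectation (\<lambda>x. lv j j x * lv k k x))"
    using lv_int2 by simp
  finally have s1: "(\<Sum>j\<in>B. \<Sum>k\<in>B. expectation (\<lambda>x. lv j j x * lv k k x)) = real p * real p" ..
  have "real p = expectation (\<lambda>x. \<Sum>j\<in>B. \<Sum>k\<in>B. (lv j k x)\<^sup>2)"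
  proof -
    have "AE x in P. (\<Sum>j\<in>B. \<Sum>k\<in>B. (lv j k x)\<^sup>2) = real p"
      using AE_sum_lv AE_space
    proof eventually_elim
      case (elim x)
      have G: "E x \<in> carrier_mat n p" by (rule mmeasD(1)[OF E elim(2)])
      have "(lv j k x)\<^sup>2 = lv j k x * lv k j x" for j k
        unfolding lev_sym[OF G, of B k j] by (rule power2_eq_square)
      then have "(\<Sum>k\<in>B. (lv j k x)\<^sup>2) = lv j j x" for j
        using sum_lev_lev[OF G, of B j j] by simp
      then show ?case using elim by simp
    qed
    from integral_cong_AE[OF _ _ this] show ?thesis by (simp add: prob_space)
  qed
  also have "\<dots> = (\<Sum>j\<in>B. \<Sum>k\<in>B. expectation (\<lambda>x. (lv j k x)\<^sup>2))"
    using int2 by simp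
  finally have s2: "(\<Sum>j\<in>B. \<Sum>k\<in>B. expectation (\<lambda>x. (lv j k x)\<^sup>2)) = real p" ..
  have "(\<Sum>j\<in>B. \<Sum>k\<in>B. m + (if j = k then 2 * m else 0)) = (\<Sum>j\<in>B. \<Sum>k\<in>B. expectation (\<lambda>x. lv j j x * lv k k x) + 2 * expectation (\<lambda>x. (lv j k x)\<^sup>2))"
  proof (intro sum.cong refl)
    fix j k assume jk: "j \<in> B" "k \<in> B"
    show "m + (if j = k then 2 * m else 0) = expectation (\<lambda>x. lv j j x * lv k k x) + 2 * expectation (\<lambda>x. (lv j k x)\<^sup>2)"
      using pair[OF jk] mj[OF jk(1)] by (cases "j = k") (auto simp: power2_eq_square)
  qed
  then have "?N * (?N * m + 2 * m) = real p * real p + 2 * real p"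
    using s1 s2 finB by (simp add: sum.distrib sum_distrib_left[symmetric])
  then have 1: "m * (?N * (?N + 2)) = real p * (real p + 2)" by (simp add: algebra_simps)
  have "?N > 0" using i finB by (auto simp: card_gt_0_iff)
  then have "?N * (?N + 2) \<noteq> 0" by simp
  from nonzero_eq_divide_eq[OF this] 1 show ?thesis unfolding m_def[symmetric] by blast
qed

lemma variance_lv: "i \<in> B \<Longrightarrow> variance (lv i i) \<le> 2 * real p / (real (card B))\<^sup>2"
proof -
  assume i: "i \<in> B"
  let ?N = "real (card B)"
  have N: "?N > 0" using i finB by (auto simp: card_gt_0_iff)
  have sq: "integrable P (\<lambda>x. (lv i i x)\<^sup>2)" using lv_int2[OF i i i i] by (simp add: power2_eq_square)
  have "variance (lv i i) = real p * (real p + 2) / (?N * (?N + 2)) - (real p / ?N)\<^sup>2"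
    unfolding variance_eq[OF lv_int[OF i i] sq] expectation_lv_square[OF i] unfolding expectation_lv[OF i] by (rule refl)
  also have "\<dots> \<le> real p * (real p + 2) / (?N * ?N) - (real p / ?N)\<^sup>2"
    using N by (intro diff_mono divide_left_mono mult_left_mono mult_pos_pos) auto
  also have "\<dots> = 2 * real p / ?N\<^sup>2" using N by (simp add: field_simps power2_eq_square)
  finally show ?thesis by simp
qed

lemma prob_lv_concentrated:
  fixes \<delta> :: real
  assumes i: "i \<in> B" and d: "\<delta> > 0"
  shows "prob {x\<in>space P. lv i i x \<ge> (1 + \<delta>) * real p / real (card B)} \<le> 2 / (\<delta>\<^sup>2 * real p)"
proof -
  let ?N = "real (card B)"
  have N: "?N > 0" using i finB by (auto simp: card_gt_0_iff)
  have p0: "real p > 0" using p by simp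
  have "integrable P (\<lambda>x. (lv i i x)\<^sup>2)" using lv_int2[OF i i i i] by (simp add: power2_eq_square)
  then have "prob {x\<in>space P. \<bar>lv i i x - expectation (lv i i)\<bar> \<ge> \<delta> * real p / ?N} \<le> variance (lv i i) / (\<delta> * real p / ?N)\<^sup>2"
    using N p0 d i by (intro Chebyshev_inequality) auto
  also have "\<dots> \<le> (2 * real p / ?N\<^sup>2) / (\<delta> * real p / ?N)\<^sup>2"
    using variance_lv[OF i] by (intro divide_right_mono) auto
  also have "\<dots> = 2 / (\<delta>\<^sup>2 * real p)" using N p0 d by (simp add: field_simps power2_eq_square)
  finally have 1: "prob {x\<in>space P. \<bar>lv i i x - expectation (lv i i)\<bar> \<ge> \<delta> * real p / ?N} \<le> 2 / (\<delta>\<^sup>2 * real p)" .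
  have "prob {x\<in>space P. lv i i x \<ge> (1 + \<delta>) * real p / ?N} \<le> prob {x\<in>space P. \<bar>lv i i x - expectation (lv i i)\<bar> \<ge> \<delta> * real p / ?N}"
  proof (rule finite_measure_mono)
    show "{x\<in>space P. lv i i x \<ge> (1 + \<delta>) * real p / ?N} \<subseteq> {x\<in>space P. \<bar>lv i i x - expectation (lv i i)\<bar> \<ge> \<delta> * real p / ?N}"
      unfolding expectation_lv[OF i] by (auto simp: distrib_right add_divide_distrib)
    show "{x\<in>space P. \<bar>lv i i x - expectation (lv i i)\<bar> \<ge> \<delta> * real p / ?N} \<in> events"
      using lv_measurable[OF i i] by measurable
  qed
  with 1 show ?thesis by linarith
qed

lemma prob_lv_Markov:
  assumes i: "i \<in> B" and t: "t > 0"
  shows "prob {x\<in>space P. lv i i x \<ge> t} \<le> real p / (real (card B) * t)"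
proof -
  have "prob {x\<in>space P. lv i i x \<ge> t} \<le> expectation (lv i i) / t"
  proof (rule integral_Markov_inequality_measure[where A = "{}"])
    show "AE x in P. 0 \<le> lv i i x" by (intro AE_I2 lev_bounds(1)[OF mmeasD(1)[OF E] finB i])
  qed (use lv_int[OF i i] t in auto)
  then show ?thesis by (simp add: expectation_lv[OF i])
qed

end

section \<open>Projections onto the model spaces\<close>

lemma mtrace_mult_commute:
  assumes "A \<in> carrier_mat m n" "B \<in> carrier_mat n m" shows "mtrace (A * B) = mtrace (B * A)"
proof -
  have "mtrace (A * B) = (\<Sum>i<m. \<Sum>j<n. A $$ (i,j) * B $$ (j,i))"
    using assms by (simp add: mtrace_def mult_index_sum del: index_mult_mat(1))
  also have "\<dots> = (\<Sum>j<n. \<Sum>i<m. B $$ (j,i) * A $$ (i,j))" by (subst sum.swap) (simp add: mult.commute)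
  also have "\<dots> = mtrace (B * A)"
    using assms by (simp add: mtrace_def mult_index_sum del: index_mult_mat(1))
  finally show ?thesis .
qed

lemma one_minus_mult:
  fixes P Z :: "real mat"
  shows "P \<in> carrier_mat n n \<Longrightarrow> Z \<in> carrier_mat n m \<Longrightarrow> (1\<^sub>m n - P) * Z = Z - P * Z"
    "P \<in> carrier_mat n n \<Longrightarrow> Z \<in> carrier_mat m n \<Longrightarrow> Z * (1\<^sub>m n - P) = Z - Z * P"
  by (subst minus_mult_distrib_mat[of _ n n] mult_minus_distrib_mat[of _ m n]; auto)+

lemma mtrace_minus: "A \<in> carrier_mat n n \<Longrightarrow> B \<in> carrier_mat n n \<Longrightarrow> mtrace (A - B) = mtrace A - mtrace B"
  by (simp add: mtrace_def sum_subtractf)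

lemma mtrace_one: "mtrace (1\<^sub>m n) = n"
  by (simp add: mtrace_def)

lemma (in orth) mtrace: "mtrace (spectral n U d) = (\<Sum>i<n. d i)"
proof -
  have "mtrace (spectral n U d) = mtrace (U\<^sup>T * (U * mat_diag n d))"
    unfolding spectral_def using U by (intro mtrace_mult_commute[of _ n n]) auto
  also have "U\<^sup>T * (U * mat_diag n d) = mat_diag n d"
    by (rule invertible_cancel[OF UU]) (use U in auto)
  finally show ?thesis by (simp add: mtrace_def mat_diag_def)
qed

lemma (in orth) spectral_inj: "spectral n U d = spectral n U e \<Longrightarrow> i < n \<Longrightarrow> d i = e i"
proof -
  assume eq: "spectral n U d = spectral n U e" and i: "i < n"
  have d: "mat_diag n d = U\<^sup>T * (spectral n U d * U)" for d
    unfolding spectral_def using U mat_diag_dim[of n d]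
    by (simp add: mat_mult_assoc_dim UU invertible_cancel[OF UU, of n] del: assoc_mult_mat)
  have "mat_diag n d = mat_diag n e" unfolding d[of d] d[of e] eq ..
  then have "mat_diag n d $$ (i,i) = mat_diag n e $$ (i,i)" by simp
  then show ?thesis using i by (simp add: mat_diag_def)
qed

locale orth_projection =
  fixes n :: nat and Q :: "real mat"
  assumes Q: "Q \<in> carrier_mat n n" "Q\<^sup>T = Q" "Q * Q = Q"

lemma nested_projections_diagonal:
  assumes "orth_projection n Q" "orth_projection n Q'" and QQ: "Q * Q' = Q'"
  obtains U B B' where "orth n U" "B \<subseteq> {..<n}" "B' \<subseteq> B"
    "Q = spectral n U (indicator B)" "Q' = spectral n U (indicator B')"
    "card B = mtrace Q" "card B' = mtrace Q'"
proof -
  interpret Q: orth_projection n Q by fact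
  interpret Q': orth_projection n Q' by fact
  have Q'Q: "Q' * Q = Q'" using arg_cong[OF QQ, of transpose_mat] Q.Q Q'.Q by (simp add: mat_transpose_mult_dim)
  have M: "Q + Q' \<in> carrier_mat n n" "(Q + Q')\<^sup>T = Q + Q'"
    using Q.Q(1,2) Q'.Q(1,2) by (auto simp: transpose_add[of _ n n])
  from symmetric_spectral[OF M] obtain U d where UO: "orth n U" and d: "Q + Q' = spectral n U d" .
  interpret orth n U by fact
  have "(Q + Q') * (Q + Q') = Q * Q + Q' * Q + (Q * Q' + Q' * Q')"
    using Q.Q(1) Q'.Q(1) by (simp add: add_mult_distrib_mat[of _ n n] mult_add_distrib_mat[of _ n n])
  then have MM: "spectral n U (\<lambda>i. d i * d i) = Q + Q' + (Q' + Q')"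
    unfolding mult[symmetric] d[symmetric] by (simp add: QQ Q'Q Q.Q(3) Q'.Q(3))
  define e f where "e i = (d i * d i - d i) / 2" and "f i = (3 * d i - d i * d i) / 2" for i
  have Q's: "Q' = spectral n U e"
  proof -
    have "spectral n U e = (1/2) \<cdot>\<^sub>m (spectral n U (\<lambda>i. d i * d i) - spectral n U d)"
      unfolding minus smult e_def by simp
    also have "\<dots> = Q'" unfolding MM d[symmetric] using Q.Q(1) Q'.Q(1) by (intro eq_matI) auto
    finally show ?thesis ..
  qed
  have Qs: "Q = spectral n U f"
  proof -
    have "spectral n U f = spectral n U d - spectral n U e"
      unfolding minus e_def f_def by (rule arg_cong[of _ _ "spectral n U"]) (auto simp: field_simps)
    also have "\<dots> = Q" unfolding d[symmetric] Q's[symmetric] using Q.Q(1) Q'.Q(1) by (intro eq_matI) auto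
    finally show ?thesis ..
  qed
  have e: "e i * e i = e i" if "i < n" for i
    using Q'.Q(3) that unfolding Q's mult by (rule spectral_inj)
  have f: "f i * f i = f i" if "i < n" for i
    using Q.Q(3) that unfolding Qs mult by (rule spectral_inj)
  have fe: "f i * e i = e i" if "i < n" for i
    using QQ that unfolding Qs Q's mult by (rule spectral_inj)
  define B B' where "B = {i. i < n \<and> f i = 1}" and "B' = {i. i < n \<and> e i = 1}"
  have eB: "e i = indicator B' i" and fB: "f i = indicator B i" if "i < n" for i
    using e[OF that] f[OF that] that by (auto simp: B_def B'_def indicator_def)
  have c: "(\<Sum>i<n. indicator A i) = real (card A)" if "A \<subseteq> {..<n}" for A
    using that by (simp add: indicator_def sum.If_cases Int_absorb1 Int_def[symmetric])
  show thesis
  proof (rule that[OF UO, of B B'])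
    show "B \<subseteq> {..<n}" by (auto simp: B_def)
    show "B' \<subseteq> B" using fe by (force simp: B_def B'_def)
    show 1: "Q = spectral n U (indicator B)" unfolding Qs by (rule spectral_cong) (rule fB)
    show 2: "Q' = spectral n U (indicator B')" unfolding Q's by (rule spectral_cong) (rule eB)
    show "card B = mtrace Q" unfolding 1 mtrace by (rule c[symmetric]) (auto simp: B_def)
    show "card B' = mtrace Q'" unfolding 2 mtrace by (rule c[symmetric]) (auto simp: B'_def)
  qed
qed

lemma (in orth) gram_spectral:
  assumes G: "G \<in> carrier_mat n p" and B: "B \<subseteq> {..<n}"
  shows "G\<^sup>T * spectral n U (indicator B) * G = gram (U\<^sup>T * G) B"
proof -
  let ?H = "U\<^sup>T * G"
  have H: "?H \<in> carrier_mat n p" using U G by simp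
  have "G\<^sup>T * spectral n U (indicator B) * G = ?H\<^sup>T * (mat_diag n (indicator B) * ?H)"
    unfolding spectral_def using U G by (simp add: mat_transpose_mult_dim mat_mult_assoc_dim del: assoc_mult_mat)
  also have "\<dots> = gram ?H B"
  proof (rule eq_matI)
    fix a b assume "a < dim_row (gram ?H B)" "b < dim_col (gram ?H B)"
    then have ab: "a < p" "b < p" using H by auto
    have "(?H\<^sup>T * (mat_diag n (indicator B) * ?H)) $$ (a,b) = (\<Sum>i<n. ?H $$ (i,a) * (indicator B i * ?H $$ (i,b)))"
      using ab H G U by (subst mult_index_sum) (auto simp: mat_diag_mult_left[OF H] simp del: index_mult_mat(1) intro!: sum.cong)
    also have "\<dots> = (\<Sum>i\<in>B. ?H $$ (i,a) * ?H $$ (i,b))"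
      using B by (intro sum.mono_neutral_cong_right) (auto simp: indicator_def)
    finally show "(?H\<^sup>T * (mat_diag n (indicator B) * ?H)) $$ (a,b) = gram ?H B $$ (a,b)"
      using ab G by (simp add: gram_def del: index_mult_mat(1))
  qed (use H in auto)
  finally show ?thesis .
qed

locale full_rank =
  fixes n q :: nat and X :: "real mat"
  assumes X: "X \<in> carrier_mat n q" and inj: "\<And>v. (\<And>i. i < n \<Longrightarrow> mv X v i = 0) \<Longrightarrow> j < q \<Longrightarrow> v j = 0"
begin

lemma XX: "pos_def q (X\<^sup>T * X)"
proof (rule pos_defI)
  show "(X\<^sup>T * X)\<^sup>T = X\<^sup>T * X" using X by (simp add: mat_transpose_mult_dim)
  fix v :: "nat \<Rightarrow> real" assume v: "\<exists>i<q. v i \<noteq> 0"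
  then obtain i where "i < n" "mv X v i \<noteq> 0" using inj by blast
  then show "qf q (X\<^sup>T * X) v > 0" unfolding qf_gram[OF X] by (intro sum_pos2[of _ i]) auto
qed (use X in auto)

lemma XX_inv: "minv (X\<^sup>T * X) \<in> carrier_mat q q" "X\<^sup>T * X * minv (X\<^sup>T * X) = 1\<^sub>m q" "minv (X\<^sup>T * X) * (X\<^sup>T * X) = 1\<^sub>m q"
  "(minv (X\<^sup>T * X))\<^sup>T = minv (X\<^sup>T * X)"
proof -
  let ?A = "X\<^sup>T * X"
  have A: "?A \<in> carrier_mat q q" using X by simp
  have "det ?A \<noteq> 0" using pos_def_det[OF XX] by simp
  note m = minv[OF A this]
  show "minv ?A \<in> carrier_mat q q" "?A * minv ?A = 1\<^sub>m q" "minv ?A * ?A = 1\<^sub>m q" using m by auto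
  have "?A * (minv ?A)\<^sup>T = (minv ?A * ?A)\<^sup>T"
    using m(1) A pos_defD(2)[OF XX] by (subst mat_transpose_mult_dim) auto
  also have "\<dots> = 1\<^sub>m q" unfolding m(3) by simp
  finally have "minv ?A = (minv ?A)\<^sup>T" by (intro minv_unique(1)[OF A]) (use m(1) in auto)
  then show "(minv ?A)\<^sup>T = minv ?A" by simp
qed

lemma proj: "proj_mat X \<in> carrier_mat n n" "(proj_mat X)\<^sup>T = proj_mat X" "proj_mat X * X = X"
  "proj_mat X * proj_mat X = proj_mat X" "mtrace (proj_mat X) = q"
proof -
  let ?K = "minv (X\<^sup>T * X)"
  note K = XX_inv
  show c: "proj_mat X \<in> carrier_mat n n" using X K(1) by (simp add: proj_mat_def)
  show "(proj_mat X)\<^sup>T = proj_mat X"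
    using X K(1,4) by (simp add: proj_mat_def mat_transpose_mult_dim mat_mult_assoc_dim del: assoc_mult_mat)
  have "proj_mat X * X = X * (?K * (X\<^sup>T * X))"
    using X K(1) by (simp add: proj_mat_def mat_mult_assoc_dim del: assoc_mult_mat)
  then show 1: "proj_mat X * X = X" unfolding K(3) using X by simp
  have "proj_mat X * proj_mat X = (proj_mat X * X) * ?K * X\<^sup>T"
    using X K(1) c by (simp add: proj_mat_def mat_mult_assoc_dim del: assoc_mult_mat)
  then show "proj_mat X * proj_mat X = proj_mat X" unfolding 1 by (simp add: proj_mat_def)
  have "mtrace (proj_mat X) = mtrace (X\<^sup>T * (X * ?K))"
    unfolding proj_mat_def using X K(1) by (intro mtrace_mult_commute[of _ n q]) auto
  also have "X\<^sup>T * (X * ?K) = 1\<^sub>m q" using X K(1,2) by (simp add: mat_mult_assoc_dim del: assoc_mult_mat)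
  finally show "mtrace (proj_mat X) = q" by (simp add: mtrace_one)
qed

lemma resid: "orth_projection n (1\<^sub>m n - proj_mat X)" "mtrace (1\<^sub>m n - proj_mat X) = real n - real q"
  "(1\<^sub>m n - proj_mat X) * X = 0\<^sub>m n q"
proof -
  note P = proj
  show "orth_projection n (1\<^sub>m n - proj_mat X)"
  proof
    show "(1\<^sub>m n - proj_mat X)\<^sup>T = 1\<^sub>m n - proj_mat X"
      using P(1,2) by (subst transpose_minus[of _ n n]) auto
    have "(1\<^sub>m n - proj_mat X) * (1\<^sub>m n - proj_mat X) = (1\<^sub>m n - proj_mat X) - proj_mat X * (1\<^sub>m n - proj_mat X)"
      by (rule one_minus_mult(1)[OF P(1)]) (use P(1) in \<open>auto intro: minus_carrier_mat\<close>)
    also have "proj_mat X * (1\<^sub>m n - proj_mat X) = proj_mat X - proj_mat X * proj_mat X"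
      by (rule one_minus_mult(2)[OF P(1) P(1)])
    finally show "(1\<^sub>m n - proj_mat X) * (1\<^sub>m n - proj_mat X) = 1\<^sub>m n - proj_mat X"
      unfolding P(4) using P(1) by (auto intro!: eq_matI)
  qed (use P(1) in \<open>auto intro: minus_carrier_mat\<close>)
  show "mtrace (1\<^sub>m n - proj_mat X) = real n - real q"
    using P(5) by (subst mtrace_minus[OF one_carrier_mat P(1)]) (simp add: mtrace_one)
  have "(1\<^sub>m n - proj_mat X) * X = X - X"
    using one_minus_mult(1)[OF P(1) X] P(3) by simp
  then show "(1\<^sub>m n - proj_mat X) * X = 0\<^sub>m n q" using X by (auto intro!: eq_matI)
qed

end

lemma mrank_full_inj:
  assumes X: "X \<in> carrier_mat n k" and r: "mrank X = k"
  shows "full_rank n k X"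
proof (unfold_locales, fact X, rule ccontr)
  fix j v assume v: "\<And>i. i < n \<Longrightarrow> mv X v i = 0" "j < k" "v j \<noteq> 0"
  have r': "vec_space.rank n X = k" using r X by (simp add: mrank_def)
  have Xv: "X *\<^sub>v Matrix.vec k v = 0\<^sub>v n"
    unfolding vec_mv[OF X, symmetric] using v(1) by (intro eq_vecI) auto
  have nz: "Matrix.vec k v \<noteq> 0\<^sub>v k" using v(2,3) by (auto simp: vec_eq_iff)
  show False
  proof (cases "distinct (cols X)")
    case True
    show False
      using vec_space.lin_depI[OF X _ nz Xv True] vec_space.full_rank_lin_indpt[OF X r' True] by auto
  next
    case False
    have "card (set (cols X)) < k"
      using False X by (metis card_distinct card_length carrier_matD(2) cols_length le_neq_implies_less)
    moreover obtain A where A: "maximal A (\<lambda>T. T \<subseteq> set (cols X) \<and> module.lin_indpt class_ring (module_vec TYPE(real) n) T)"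
      using maximal_exists_superset[of "set (cols X)" "\<lambda>T. T \<subseteq> set (cols X) \<and> module.lin_indpt class_ring (module_vec TYPE(real) n) T" "{}"]
      by (auto simp: module.lin_dep_def[OF vec_module])
    moreover have "vec_space.rank n X = card A" by (rule vec_space.rank_card_indpt[OF X A])
    moreover have "card A \<le> card (set (cols X))" using A by (intro card_mono) (auto simp: maximal_def)
    ultimately show False using r' by simp
  qed
qed

lemma cols_sub_carrier: "X \<in> carrier_mat n k \<Longrightarrow> j \<subseteq> {..<k} \<Longrightarrow> cols_sub X j \<in> carrier_mat n (card j)"
proof -
  assume X: "X \<in> carrier_mat n k" and j: "j \<subseteq> {..<k}"
  have "{i. i < k \<and> i \<in> j} = j" using j by auto
  then show ?thesis using X by (intro carrier_matI) (simp_all add: cols_sub_def dim_submatrix)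
qed

lemma cols_sub_index: "X \<in> carrier_mat n k \<Longrightarrow> j \<subseteq> {..<k} \<Longrightarrow> i < n \<Longrightarrow> c < card j \<Longrightarrow> cols_sub X j $$ (i,c) = X $$ (i, pick j c)"
proof -
  assume X: "X \<in> carrier_mat n k" and j: "j \<subseteq> {..<k}" and ic: "i < n" "c < card j"
  have "{i. i < k \<and> i \<in> j} = j" using j by auto
  then show ?thesis using X ic by (simp add: cols_sub_def submatrix_def pick_UNIV)
qed

lemma pick_bij: "finite j \<Longrightarrow> bij_betw (pick j) {..<card j} j"
proof -
  assume f: "finite j"
  have i: "inj_on (pick j) {..<card j}"
    by (rule inj_onI) (metis card_pick lessThan_iff)
  have "pick j ` {..<card j} \<subseteq> j" using pick_in_set_le by auto
  then show ?thesis using i f by (simp add: bij_betw_def card_image card_subset_eq)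
qed

lemma cols_sub_mv:
  assumes X: "X \<in> carrier_mat n k" and j: "j \<subseteq> {..<k}" and i: "i < n"
  shows "mv (cols_sub X j) v i = mv X (\<lambda>c. if c \<in> j then v (inv_into {..<card j} (pick j) c) else 0) i"
proof -
  have fj: "finite j" using j finite_subset by blast
  note b = pick_bij[OF fj]
  have "mv (cols_sub X j) v i = (\<Sum>c<card j. X $$ (i, pick j c) * v (inv_into {..<card j} (pick j) (pick j c)))"
    using cols_sub_carrier[OF X j] b i by (auto simp: mv_def cols_sub_index[OF X j] bij_betw_def intro!: sum.cong)
  also have "\<dots> = (\<Sum>c\<in>j. X $$ (i, c) * v (inv_into {..<card j} (pick j) c))"
    by (rule sum.reindex_bij_betw[OF b])
  also have "\<dots> = mv X (\<lambda>c. if c \<in> j then v (inv_into {..<card j} (pick j) c) else 0) i"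
    unfolding mv_def using X j by (intro sum.mono_neutral_cong_left) auto
  finally show ?thesis .
qed

lemma (in full_rank) cols_sub: "j \<subseteq> {..<q} \<Longrightarrow> full_rank n (card j) (cols_sub X j)"
proof (unfold_locales)
  assume j: "j \<subseteq> {..<q}"
  show "cols_sub X j \<in> carrier_mat n (card j)" by (rule cols_sub_carrier[OF X j])
  have fj: "finite j" using j finite_subset by blast
  note b = pick_bij[OF fj]
  fix l v assume v: "\<And>i. i < n \<Longrightarrow> mv (cols_sub X j) v i = 0" and l: "l < card j"
  let ?v = "\<lambda>c. if c \<in> j then v (inv_into {..<card j} (pick j) c) else 0"
  have pl: "pick j l \<in> j" using b l by (auto simp: bij_betw_def)
  then have "?v (pick j l) = 0" using inj[of ?v "pick j l"] v cols_sub_mv[OF X j] j by auto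
  then show "v l = 0" using pl b l by (simp add: bij_betw_def)
qed

lemma (in full_rank) proj_cols_sub_nested:
  assumes l: "l \<subseteq> {..<q}" and jl: "j \<subseteq> l"
  shows "(1\<^sub>m n - proj_mat (cols_sub X l)) * cols_sub X j = 0\<^sub>m n (card j)"
proof (rule eq_matI)
  let ?Q = "1\<^sub>m n - proj_mat (cols_sub X l)"
  interpret L: full_rank n "card l" "cols_sub X l" by (rule cols_sub[OF l])
  have j: "j \<subseteq> {..<q}" using l jl by auto
  interpret J: full_rank n "card j" "cols_sub X j" by (rule cols_sub[OF j])
  have fj: "finite j" "finite l" using j l finite_subset by blast+
  have Q: "?Q \<in> carrier_mat n n" using L.proj(1) by (rule minus_carrier_mat)
  fix i c assume "i < dim_row (0\<^sub>m n (card j))" "c < dim_col (0\<^sub>m n (card j))"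
  then have ic: "i < n" "c < card j" by auto
  have "pick j c \<in> l" using pick_bij[OF fj(1)] ic jl by (auto simp: bij_betw_def)
  then obtain c' where c': "c' < card l" "pick l c' = pick j c" using pick_bij[OF fj(2)] unfolding bij_betw_def by (metis imageE lessThan_iff)
  have "(?Q * cols_sub X j) $$ (i,c) = (\<Sum>s<n. ?Q $$ (i,s) * cols_sub X j $$ (s,c))"
    using ic J.X Q by (subst mult_index_sum) auto
  also have "\<dots> = (\<Sum>s<n. ?Q $$ (i,s) * cols_sub X l $$ (s,c'))"
    using ic c' by (intro sum.cong refl) (simp add: cols_sub_index[OF X j] cols_sub_index[OF X l])
  also have "\<dots> = (?Q * cols_sub X l) $$ (i,c')"
    using ic c' L.X Q by (subst mult_index_sum) auto
  finally have "(?Q * cols_sub X j) $$ (i,c) = (?Q * cols_sub X l) $$ (i,c')" .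
  then show "(?Q * cols_sub X j) $$ (i,c) = 0\<^sub>m n (card j) $$ (i,c)"
    unfolding L.resid(3) using ic c' by simp
qed (use cols_sub_carrier[OF X, of j] full_rank.proj(1)[OF cols_sub[OF l]] l jl in auto)

lemma (in full_rank) resid_nested:
  assumes l: "l \<subseteq> {..<q}" and jl: "j \<subseteq> l"
  shows "(1\<^sub>m n - proj_mat (cols_sub X j)) * (1\<^sub>m n - proj_mat (cols_sub X l)) = 1\<^sub>m n - proj_mat (cols_sub X l)"
proof -
  let ?P = "proj_mat (cols_sub X j)" and ?L = "1\<^sub>m n - proj_mat (cols_sub X l)"
  interpret L: full_rank n "card l" "cols_sub X l" by (rule cols_sub[OF l])
  have j: "j \<subseteq> {..<q}" using l jl by auto
  interpret J: full_rank n "card j" "cols_sub X j" by (rule cols_sub[OF j])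
  interpret R: orth_projection n ?L by (rule L.resid(1))
  have "?L * ?P = ?L * cols_sub X j * (minv ((cols_sub X j)\<^sup>T * cols_sub X j) * (cols_sub X j)\<^sup>T)"
    using J.X J.XX_inv(1) L.proj(1) unfolding proj_mat_def[of "cols_sub X j"] by (simp add: mat_mult_assoc_dim del: assoc_mult_mat)
  also have "\<dots> = 0\<^sub>m n n" unfolding proj_cols_sub_nested[OF l jl]
    by (rule left_mult_zero_mat) (use J.X J.XX_inv(1) in auto)
  finally have "?L * ?P = 0\<^sub>m n n" .
  from arg_cong[OF this, of transpose_mat] have "?P * ?L = 0\<^sub>m n n"
    using J.proj(1) R.Q(1) by (subst (asm) mat_transpose_mult_dim) (auto simp: J.proj(2) R.Q(2))
  moreover have "(1\<^sub>m n - ?P) * ?L = ?L - ?P * ?L"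
    by (rule one_minus_mult(1)[OF J.proj(1) R.Q(1)])
  ultimately show ?thesis using L.proj(1) by (auto intro!: eq_matI)
qed

section \<open>Determinant ratios of nested Gram matrices\<close>

lemma gram_pos_def:
  assumes G: "G \<in> carrier_mat n p" and B: "finite B" and d: "det (gram G B) \<noteq> 0"
  shows "pos_def p (gram G B)" "det (gram G B) > 0"
proof -
  let ?S = "gram G B"
  have S: "?S \<in> carrier_mat p p" using G by simp
  have dG: "dim_col G = p" using G by simp
  show 1: "pos_def p ?S"
  proof (rule pos_defI[OF S gram_sym])
    fix x :: "nat \<Rightarrow> real" assume x: "\<exists>i<p. x i \<noteq> 0"
    show "qf p ?S x > 0"
    proof (rule ccontr)
      assume "\<not> ?thesis"
      then have "(\<Sum>i\<in>B. (mv G x i)\<^sup>2) = 0" unfolding gram_qf[OF dG] by (simp add: order_antisym sum_nonneg)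
      then have z: "mv G x i = 0" if "i \<in> B" for i using B that by (subst (asm) sum_nonneg_eq_0_iff) auto
      have "mv ?S x a = 0" if "a < p" for a
      proof -
        have "mv ?S x a = (\<Sum>b<p. \<Sum>i\<in>B. G $$ (i,a) * (G $$ (i,b) * x b))"
          using that dG by (simp add: mv_def gram_def sum_distrib_right mult.assoc)
        also have "\<dots> = (\<Sum>i\<in>B. G $$ (i,a) * mv G x i)"
          by (subst sum.swap) (simp add: mv_def dG sum_distrib_left)
        finally show ?thesis using z by simp
      qed
      then have "?S *\<^sub>v Matrix.vec p x = 0\<^sub>v p"
        unfolding vec_mv[OF S, symmetric] by (intro eq_vecI) auto
      moreover have "Matrix.vec p x \<noteq> 0\<^sub>v p" using x by (auto simp: vec_eq_iff)
      ultimately have "det ?S = 0" using det_0_iff_vec_prod_zero[OF S] by (metis vec_carrier)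
      then show False using d by simp
    qed
  qed
  show "det ?S > 0" by (rule pos_def_det[OF 1])
qed

text \<open>Removing row \<open>i\<close> multiplies the determinant by \<open>1\<close> minus the leverage of \<open>i\<close>.\<close>

lemma ln_det_gram_ge:
  assumes G: "G \<in> carrier_mat n p" and B: "finite B" and h: "h < 1"
    and d: "\<And>C. B' \<subseteq> C \<Longrightarrow> C \<subseteq> B \<Longrightarrow> det (gram G C) \<noteq> 0"
    and l: "\<And>C i. B' \<subseteq> C \<Longrightarrow> C \<subseteq> B \<Longrightarrow> i \<in> C - B' \<Longrightarrow> lev G C i i < h"
  shows "B' \<subseteq> C \<Longrightarrow> C \<subseteq> B \<Longrightarrow> ln (det (gram G B')) \<ge> ln (det (gram G C)) + card (C - B') * ln (1 - h)"
proof (induction "card (C - B')" arbitrary: C)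
  case 0
  have "finite C" using 0 B finite_subset by blast
  then have "C = B'" using 0 by auto
  then show ?case by simp
next
  case (Suc m)
  have fC: "finite C" using Suc B finite_subset by blast
  have "C - B' \<noteq> {}" using Suc(2) by (metis card.empty nat.distinct(1))
  then obtain i where i: "i \<in> C - B'" by blast
  have "C - {i} - B' = (C - B') - {i}" by blast
  then have m: "card (C - {i} - B') = m" using card_Diff_singleton[OF i] Suc(2) by simp
  have sub: "B' \<subseteq> C - {i}" "C - {i} \<subseteq> B" using Suc i by auto
  have IH: "ln (det (gram G B')) \<ge> ln (det (gram G (C - {i}))) + m * ln (1 - h)"
    using Suc(1)[of "C - {i}"] m sub by simp
  have dC: "det (gram G C) \<noteq> 0" using d Suc by blast
  have "det (gram G C) > 0" "det (gram G (C - {i})) > 0"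
    using gram_pos_def(2)[OF G] d[OF sub] dC fC by auto
  moreover have eq: "det (gram G (C - {i})) = det (gram G C) * (1 - lev G C i i)"
    using i by (intro det_gram_remove[OF G dC fC]) auto
  moreover have "1 - h < 1 - lev G C i i" using l[of C i] Suc i by simp
  ultimately have "ln (det (gram G (C - {i}))) \<ge> ln (det (gram G C)) + ln (1 - h)"
    using h by (simp add: ln_mult)
  moreover have "real (card (C - B')) = 1 + real m" unfolding Suc(2)[symmetric] by simp
  ultimately show ?case using IH by (simp add: algebra_simps)
qed

context gaussian_matrix
begin

lemma rotate:
  assumes R: "R \<in> carrier_mat n n" "R\<^sup>T * R = 1\<^sub>m n"
  shows "gaussian_matrix P n p (\<lambda>x. R * E x) S c"
proof unfold_locales
  show "mmeas P n p (\<lambda>x. R * E x)" by (rule mmeas_mult[OF mmeas_const[OF R(1)] E])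
  fix g :: "(nat \<times> nat \<Rightarrow> real) \<Rightarrow> ennreal" assume g: "g \<in> borel_measurable (entries_measure n p)"
  show "(\<integral>\<^sup>+x. g (entries (R * E x)) \<partial>P) = (\<integral>\<^sup>+e. ennreal (c * exp (- wnorm n p (minv S) (Matrix.mat n p e) / 2)) * g e \<partial>entries_measure n p)"
    unfolding rotation_invariant[OF R g] by (rule law[OF g])
qed (fact S c)+

lemma overfit_prob:
  fixes \<eta> h :: real
  assumes B: "B \<subseteq> {..<n}" "B' \<subseteq> B" and card: "p \<le> card B'" and h: "h < 1"
    and \<eta>: "\<And>C i. B' \<subseteq> C \<Longrightarrow> C \<subseteq> B \<Longrightarrow> i \<in> C \<Longrightarrow> prob {x\<in>space P. lev (E x) C i i \<ge> h} \<le> \<eta>"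
  shows "prob {x\<in>space P. ln (det (gram (E x) B')) < ln (det (gram (E x) B)) + card (B - B') * ln (1 - h)}
    \<le> 2 ^ card (B - B') * card (B - B') * \<eta>"
proof (cases "B = B'")
  case True
  then show ?thesis by simp
next
  case False
  have fB: "finite B" using B finite_subset by blast
  define F where "F = {(C,i). B' \<subseteq> C \<and> C \<subseteq> B \<and> i \<in> C - B'}"
  define A where "A = (\<lambda>(C,i). {x\<in>space P. lev (E x) C i i \<ge> h})"
  have F: "F \<subseteq> (\<lambda>(D,i). (B' \<union> D, i)) ` (Pow (B - B') \<times> (B - B'))"
  proof
    fix z assume "z \<in> F"
    then obtain C i where "z = (C,i)" "B' \<subseteq> C" "C \<subseteq> B" "i \<in> C - B'" by (auto simp: F_def)
    then show "z \<in> (\<lambda>(D,i). (B' \<union> D, i)) ` (Pow (B - B') \<times> (B - B'))"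
      by (intro image_eqI[of _ _ "(C - B', i)"]) auto
  qed
  have fP: "finite (Pow (B - B') \<times> (B - B'))" using fB by simp
  have fF: "finite F" by (rule finite_subset[OF F finite_imageI[OF fP]])
  have cF: "card F \<le> 2 ^ card (B - B') * card (B - B')"
  proof -
    have "card F \<le> card (Pow (B - B') \<times> (B - B'))"
      by (rule order_trans[OF card_mono[OF finite_imageI[OF fP] F] card_image_le[OF fP]])
    then show ?thesis using fB by (simp add: card_cartesian_product card_Pow)
  qed
  have A: "A z \<in> events" "prob (A z) \<le> \<eta>" if zF: "z \<in> F" for z
  proof -
    obtain C i where z: "z = (C,i)" "B' \<subseteq> C" "C \<subseteq> B" "i \<in> C" using zF by (auto simp: F_def)
    have "(\<lambda>x. lev (E x) C i i) \<in> borel_measurable P" using z B by (intro lev_measurable[OF E]) auto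
    then show "A z \<in> events" by (simp add: A_def z)
    show "prob (A z) \<le> \<eta>" using \<eta>[OF z(2-4)] by (simp add: A_def z)
  qed
  have AE: "AE x in P. \<forall>C\<in>{C. B' \<subseteq> C \<and> C \<subseteq> B}. det (gram (E x) C) \<noteq> 0"
  proof (rule AE_finite_allI)
    show "finite {C. B' \<subseteq> C \<and> C \<subseteq> B}" using fB by (auto intro: finite_subset[of _ "Pow B"])
    fix C assume "C \<in> {C. B' \<subseteq> C \<and> C \<subseteq> B}"
    then have C: "B' \<subseteq> C" "C \<subseteq> B" by auto
    then have "finite C" using fB finite_subset by blast
    then have "p \<le> card C" using card card_mono[of C B'] C by linarith
    then show "AE x in P. det (gram (E x) C) \<noteq> 0" using C B by (intro AE_gram_nonsingular) auto
  qed
  have "prob {x\<in>space P. ln (det (gram (E x) B')) < ln (det (gram (E x) B)) + card (B - B') * ln (1 - h)}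
    \<le> prob (\<Union>z\<in>F. A z)"
  proof (rule finite_measure_mono_AE)
    show "AE x in P. x \<in> {x\<in>space P. ln (det (gram (E x) B')) < ln (det (gram (E x) B)) + card (B - B') * ln (1 - h)} \<longrightarrow> x \<in> (\<Union>z\<in>F. A z)"
      using AE AE_space
    proof eventually_elim
      case (elim x)
      show ?case
      proof (intro impI, rule ccontr)
        assume bad: "x \<in> {x\<in>space P. ln (det (gram (E x) B')) < ln (det (gram (E x) B)) + card (B - B') * ln (1 - h)}"
          and "x \<notin> (\<Union>z\<in>F. A z)"
        have "lev (E x) C i i < h" if "B' \<subseteq> C" "C \<subseteq> B" "i \<in> C - B'" for C i
        proof -
          have "(C,i) \<in> F" unfolding F_def using that by blast
          then have "x \<notin> A (C,i)" using \<open>x \<notin> (\<Union>z\<in>F. A z)\<close> by blast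
          then show ?thesis using elim(2) by (simp add: A_def not_le)
        qed
        then have "ln (det (gram (E x) B')) \<ge> ln (det (gram (E x) B)) + card (B - B') * ln (1 - h)"
          using elim B by (intro ln_det_gram_ge[OF mmeasD(1)[OF E] fB h, where B' = B']) auto
        then show False using bad by simp
      qed
    qed
    show "(\<Union>z\<in>F. A z) \<in> events" using fF A by auto
  qed
  also have "\<dots> \<le> (\<Sum>z\<in>F. prob (A z))" using fF A by (intro finite_measure_subadditive_finite) auto
  also have "\<dots> \<le> card F * \<eta>" using sum_mono[of F "\<lambda>z. prob (A z)" "\<lambda>_. \<eta>"] A by simp
  also have "\<dots> \<le> (2 ^ card (B - B') * card (B - B')) * \<eta>"
  proof (intro mult_right_mono)
    show "real (card F) \<le> real (2 ^ card (B - B') * card (B - B'))"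
      using cF by (simp only: of_nat_le_iff)
    obtain i where "i \<in> B" using False B by blast
    show "0 \<le> \<eta>" by (rule order_trans[OF measure_nonneg \<eta>[OF B(2) subset_refl \<open>i \<in> B\<close>]])
  qed
  finally show ?thesis .
qed

text \<open>Only expectations of squared linear forms of the noise enter: on the complement of two Markov events, the Gram
  matrix of all rows in \<open>B\<close> dominates \<open>(1 + t)\<close> times the one of the rows in \<open>B'\<close> on the range of \<open>V\<close>.\<close>

lemma underfit_prob:
  fixes M V :: "real mat" and \<mu> t C C' :: real
  assumes B: "B \<subseteq> {..<n}" "B' \<subseteq> B" and card: "p \<le> card B'"
    and M: "M \<in> carrier_mat n p" and V: "V \<in> carrier_mat p g"
    and M0: "\<And>i z. i \<in> B' \<Longrightarrow> mv M z i = 0"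
    and unit: "\<And>a. a < g \<Longrightarrow> qf p S (\<lambda>l. V $$ (l,a)) = 1"
    and sig: "\<And>y. (\<Sum>i\<in>B. (mv M (mv V y) i)\<^sup>2) \<ge> \<mu> * (\<Sum>a<g. (y a)\<^sup>2)"
    and t: "t \<ge> 0" and C: "C > 0" "C' > 0" and \<mu>: "\<mu> / 2 - C' \<ge> t * C"
  shows "prob {x\<in>space P. det (gram (M + E x) B) < (1 + t) ^ g * det (gram (E x) B')}
    \<le> 8 * g * card B' / C + 8 * g * card (B - B') / C'"
proof -
  have fB: "finite B" by (rule finite_subset[OF B(1)]) simp
  have fB': "finite B'" by (rule finite_subset[OF B(2) fB])
  define q where "q D x = (\<Sum>i\<in>D. \<Sum>a<g. (mv (E x) (\<lambda>l. V $$ (l,a)) i)\<^sup>2)" for D x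
  have qm: "q D \<in> borel_measurable P" if "D \<subseteq> {..<n}" for D
    unfolding q_def using that by (intro borel_measurable_sum borel_measurable_power mv_measurable) auto
  have q0: "q D x \<ge> 0" for D x unfolding q_def by (intro sum_nonneg) auto
  have Eq: "(\<integral>\<^sup>+x. ennreal (q D x) \<partial>P) \<le> ennreal (8 * g * card D)" if D: "D \<subseteq> {..<n}" for D
  proof -
    have m: "(\<lambda>x. ennreal ((mv (E x) (\<lambda>l. V $$ (l,a)) i)\<^sup>2)) \<in> borel_measurable P" if "i \<in> D" for i a
      using mv_measurable[of i "\<lambda>l. V $$ (l,a)"] that D by auto
    have "(\<integral>\<^sup>+x. ennreal (q D x) \<partial>P) = (\<integral>\<^sup>+x. (\<Sum>i\<in>D. \<Sum>a<g. ennreal ((mv (E x) (\<lambda>l. V $$ (l,a)) i)\<^sup>2)) \<partial>P)"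
      unfolding q_def by (intro nn_integral_cong) (simp add: sum_nonneg)
    also have "\<dots> = (\<Sum>i\<in>D. \<Sum>a<g. \<integral>\<^sup>+x. ennreal ((mv (E x) (\<lambda>l. V $$ (l,a)) i)\<^sup>2) \<partial>P)"
      using m by (subst nn_integral_sum; (intro sum.cong refl nn_integral_sum borel_measurable_sum)?) auto
    also have "\<dots> \<le> (\<Sum>i\<in>D. \<Sum>a<g. 8)"
    proof (intro sum_mono)
      fix i a assume "i \<in> D" "a \<in> {..<g}"
      then have i: "i < n" "a < g" using D by auto
      have "(\<Sum>l<n. (if l = i then 1 else 0) * mv (E x) (\<lambda>l. V $$ (l,a)) l) = mv (E x) (\<lambda>l. V $$ (l,a)) i" for x
        using i by (simp add: if_distrib[of "\<lambda>u. u * _"] cong: if_cong)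
      moreover have "(\<Sum>l<n. (if l = i then 1 else 0 :: real)\<^sup>2) = 1"
        using i by (simp add: if_distrib[of "\<lambda>u. u\<^sup>2"] cong: if_cong)
      ultimately show "(\<integral>\<^sup>+x. ennreal ((mv (E x) (\<lambda>l. V $$ (l,a)) i)\<^sup>2) \<partial>P) \<le> 8"
        using second_moment[of "\<lambda>l. if l = i then 1 else 0", OF _ unit[OF i(2)]] by simp
    qed
    also have "\<dots> = ennreal (8 * g * card D)"
      by (simp add: ennreal_mult[symmetric] ennreal_of_nat_eq_real_of_nat mult_ac flip: ennreal_numeral)
    finally show ?thesis .
  qed
  have Mk: "prob {x\<in>space P. q D x \<ge> K} \<le> 8 * g * card D / K" if D: "D \<subseteq> {..<n}" and K: "K > 0" for D K
  proof -
    have int: "integrable P (q D)"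
      using qm[OF D] q0 Eq[OF D] by (intro integrableI_bounded) (auto simp: ennreal_mult_less_top intro: le_less_trans)
    have "ennreal (expectation (q D)) \<le> ennreal (8 * g * card D)"
      using Eq[OF D] nn_integral_eq_integral[OF int] q0 by simp
    then have e: "expectation (q D) \<le> 8 * g * card D" by (subst (asm) ennreal_le_iff) auto
    have "prob {x\<in>space P. q D x \<ge> K} \<le> expectation (q D) / K"
      by (rule integral_Markov_inequality_measure[where A = "{}"]) (use int q0 K in auto)
    also have "\<dots> \<le> 8 * g * card D / K" using e K by (intro divide_right_mono) auto
    finally show ?thesis .
  qed
  have BD: "B' \<subseteq> {..<n}" "B - B' \<subseteq> {..<n}" using B by auto
  let ?U = "{x\<in>space P. q B' x \<ge> C} \<union> {x\<in>space P. q (B - B') x \<ge> C'}"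
  have "prob {x\<in>space P. det (gram (M + E x) B) < (1 + t) ^ g * det (gram (E x) B')} \<le> prob ?U"
  proof (rule finite_measure_mono_AE)
    show "?U \<in> events" using qm[OF BD(1)] qm[OF BD(2)] by auto
    show "AE x in P. x \<in> {x\<in>space P. det (gram (M + E x) B) < (1 + t) ^ g * det (gram (E x) B')} \<longrightarrow> x \<in> ?U"
      using AE_gram_nonsingular[OF BD(1) card] AE_space
    proof eventually_elim
      case (elim x)
      have G: "E x \<in> carrier_mat n p" by (rule mmeasD(1)[OF E elim(2)])
      have MG: "M + E x \<in> carrier_mat n p" using M G by simp
      have dims: "dim_col (E x) = p" "dim_col (M + E x) = p" using G MG by auto
      show ?case
      proof (intro impI, rule ccontr)
        assume bad: "x \<in> {x\<in>space P. det (gram (M + E x) B) < (1 + t) ^ g * det (gram (E x) B')}" and "x \<notin> ?U"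
        then have q1: "q B' x < C" and q2: "q (B - B') x < C'" using elim by auto
        have madd: "mv (M + E x) z i = mv M z i + mv (E x) z i" if "i < n" for z i
          using M G that by (simp add: mv_def sum.distrib algebra_simps)
        have qW: "qf p (gram (E x) B') z = (\<Sum>i\<in>B'. (mv (E x) z i)\<^sup>2)" for z by (rule gram_qf[OF dims(1)])
        have qA: "qf p (gram (M + E x) B) z = (\<Sum>i\<in>B'. (mv (E x) z i)\<^sup>2) + (\<Sum>i\<in>B - B'. (mv M z i + mv (E x) z i)\<^sup>2)" for z
        proof -
          have "qf p (gram (M + E x) B) z = (\<Sum>i\<in>B. (mv M z i + mv (E x) z i)\<^sup>2)"
            unfolding gram_qf[OF dims(2)] using B by (intro sum.cong refl) (auto simp: madd)
          also have "\<dots> = (\<Sum>i\<in>B - B'. (mv M z i + mv (E x) z i)\<^sup>2) + (\<Sum>i\<in>B'. (mv M z i + mv (E x) z i)\<^sup>2)"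
            by (rule sum.subset_diff[OF B(2) fB])
          finally show ?thesis using M0 by simp
        qed
        have EV: "(\<Sum>i\<in>D. (mv (E x) (mv V y) i)\<^sup>2) \<le> q D x * (\<Sum>a<g. (y a)\<^sup>2)" if D: "D \<subseteq> {..<n}" for D y
        proof -
          have "mv (E x) (mv V y) i = (\<Sum>a<g. mv (E x) (\<lambda>l. V $$ (l,a)) i * y a)" for i
            using V G by (simp add: mv_def sum_distrib_left sum_distrib_right mult.assoc) (rule sum.swap)
          then have "(\<Sum>i\<in>D. (mv (E x) (mv V y) i)\<^sup>2) \<le> (\<Sum>i\<in>D. (\<Sum>a<g. (mv (E x) (\<lambda>l. V $$ (l,a)) i)\<^sup>2) * (\<Sum>a<g. (y a)\<^sup>2))"
            by (intro sum_mono) (simp add: Cauchy_Schwarz_ineq_sum)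
          then show ?thesis by (simp add: q_def sum_distrib_right)
        qed
        have "(1 + t) ^ g * det (gram (E x) B') \<le> det (gram (M + E x) B)"
        proof (rule det_ge_of_qf_ge_on_subspace[OF gram_pos_def(1)[OF G fB' elim(1)] gram_carrier(1)[OF MG] gram_sym V _ t])
          show "qf p (gram (E x) B') z \<le> qf p (gram (M + E x) B) z" for z
            unfolding qW qA by (simp add: sum_nonneg)
          fix y
          let ?s = "\<Sum>a<g. (y a)\<^sup>2" and ?z = "mv V y"
          have s0: "?s \<ge> 0" by (intro sum_nonneg) auto
          have "t * (\<Sum>i\<in>B'. (mv (E x) ?z i)\<^sup>2) \<le> t * (C * ?s)"
            using EV[OF BD(1), of y] q1 s0 t by (intro mult_left_mono order_trans[OF EV[OF BD(1)]] mult_right_mono) auto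
          also have "\<dots> \<le> (\<mu> / 2 - C') * ?s" using \<mu> s0 by (simp add: mult.assoc[symmetric] mult_right_mono)
          also have "\<dots> \<le> (\<Sum>i\<in>B - B'. (mv M ?z i)\<^sup>2) / 2 - (\<Sum>i\<in>B - B'. (mv (E x) ?z i)\<^sup>2)"
          proof -
            have "(\<Sum>i\<in>B. (mv M ?z i)\<^sup>2) = (\<Sum>i\<in>B - B'. (mv M ?z i)\<^sup>2)"
              using M0 fB B(2) by (intro sum.mono_neutral_right) auto
            then have "\<mu> * ?s \<le> (\<Sum>i\<in>B - B'. (mv M ?z i)\<^sup>2)" using sig[of y] by simp
            moreover have "(\<Sum>i\<in>B - B'. (mv (E x) ?z i)\<^sup>2) \<le> C' * ?s"
              using EV[OF BD(2), of y] q2 s0 by (meson less_imp_le mult_right_mono order_trans)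
            ultimately show ?thesis by (simp add: algebra_simps)
          qed
          also have "\<dots> \<le> (\<Sum>i\<in>B - B'. (mv M ?z i + mv (E x) ?z i)\<^sup>2)"
          proof -
            have "(a::real)\<^sup>2 / 2 - b\<^sup>2 \<le> (a + b)\<^sup>2" for a b
              using zero_le_power2[of "a + 2 * b"] by (simp add: power2_eq_square algebra_simps)
            then show ?thesis
              unfolding sum_divide_distrib sum_subtractf[symmetric] by (intro sum_mono)
          qed
          finally show "(1 + t) * qf p (gram (E x) B') ?z \<le> qf p (gram (M + E x) B) ?z"
            unfolding qW qA by (simp add: algebra_simps)
          assume "\<exists>a<g. y a \<noteq> 0"
          then have s1: "?s > 0" by (auto intro!: sum_pos2)
          show "\<exists>i<p. ?z i \<noteq> 0"
          proof (rule ccontr)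
            assume "\<not> ?thesis"
            then have "mv M ?z i = 0" for i using M by (simp add: mv_def)
            then have "\<mu> * ?s \<le> 0" using sig[of y] by simp
            then have "\<mu> \<le> 0" using s1 by (simp add: mult_le_0_iff)
            then have "t * C < 0" using \<mu> C by linarith
            then show False using t C by (simp add: mult_less_0_iff)
          qed
        qed
        then show False using bad by simp
      qed
    qed
  qed
  also have "\<dots> \<le> prob {x\<in>space P. q B' x \<ge> C} + prob {x\<in>space P. q (B - B') x \<ge> C'}"
    using qm[OF BD(1)] qm[OF BD(2)] by (intro measure_Un_le) auto
  also have "\<dots> \<le> 8 * g * card B' / C + 8 * g * card (B - B') / C'"
    using Mk[OF BD(1) C(1)] Mk[OF BD(2) C(2)] by linarith
  finally show ?thesis .
qed

end

section \<open>Residual determinants of the regression model\<close>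

lemma min_eigenvalue_le:
  assumes U: "orth g U" and a: "a < g"
  shows "min_eigenvalue (spectral g U f) \<le> f a"
proof -
  interpret orth g U by fact
  let ?G = "spectral g U f"
  have c: "?G \<in> carrier_mat g g" by simp
  have fin: "finite {e. eigenvalue ?G e}"
  proof -
    have "char_poly ?G \<noteq> 0" using degree_monic_char_poly[OF c] by (metis coeff_0 zero_neq_one)
    then show ?thesis unfolding eigenvalue_root_char_poly[OF c] by (rule poly_roots_finite)
  qed
  let ?v = "Matrix.vec g (\<lambda>l. U $$ (l, a))"
  have "?v \<noteq> 0\<^sub>v g"
  proof
    assume "?v = 0\<^sub>v g"
    then have z: "U $$ (l,a) = 0" if "l < g" for l using that by (metis index_vec index_zero_vec(1))
    have "(U\<^sup>T * U) $$ (a,a) = (\<Sum>l<g. U $$ (l,a) * U $$ (l,a))"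
      using U a unfolding orth_def by (subst mult_index_sum) auto
    also have "\<dots> = 0" using z by simp
    finally show False using a by (simp add: UU)
  qed
  moreover have "?G *\<^sub>v ?v = f a \<cdot>\<^sub>v ?v"
    unfolding vec_mv[OF c, symmetric] using col_eigen[OF a] by (intro eq_vecI) auto
  ultimately have "eigenvalue ?G (f a)"
    unfolding eigenvalue_def eigenvector_def by (intro exI[of _ ?v]) (auto simp: carrier_matD[OF c])
  then show ?thesis unfolding min_eigenvalue_def using fin by (intro Min_le) auto
qed

lemma qf_col: "S \<in> carrier_mat p p \<Longrightarrow> V \<in> carrier_mat p g \<Longrightarrow> a < g \<Longrightarrow> qf p S (\<lambda>l. V $$ (l,a)) = (V\<^sup>T * (S * V)) $$ (a,a)"
proof -
  assume S: "S \<in> carrier_mat p p" and V: "V \<in> carrier_mat p g" and a: "a < g"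
  have "(V\<^sup>T * (S * V)) $$ (a,a) = (\<Sum>i<p. V $$ (i,a) * (S * V) $$ (i,a))"
    using S V a by (subst mult_index_sum) (auto simp del: index_mult_mat(1))
  also have "\<dots> = (\<Sum>i<p. V $$ (i,a) * (\<Sum>j<p. S $$ (i,j) * V $$ (j,a)))"
    using S V a by (intro sum.cong refl) (subst mult_index_sum, auto)
  finally show ?thesis by (simp add: qf_def sum_distrib_left mult.assoc)
qed

lemma signal_basis:
  assumes S: "pos_def p S" and A: "A \<in> carrier_mat p p" and \<Gamma>: "\<Gamma> \<in> carrier_mat p g"
    and eq: "\<Gamma> * \<Gamma>\<^sup>T = inv_sqrt S * A * inv_sqrt S"
    and \<mu>: "\<mu> \<le> min_eigenvalue (\<Gamma>\<^sup>T * \<Gamma>)" "\<mu> > 0"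
  obtains V where "V \<in> carrier_mat p g" "\<And>a. a < g \<Longrightarrow> qf p S (\<lambda>l. V $$ (l,a)) = 1"
    "\<And>y. qf p A (mv V y) \<ge> \<mu> * (\<Sum>a<g. (y a)\<^sup>2)"
proof -
  define R where "R = inv_sqrt S"
  note R = inv_sqrt_pos_def(1-3)[OF S, folded R_def]
  note Sc = pos_defD(1)[OF S]
  have G: "\<Gamma>\<^sup>T * \<Gamma> \<in> carrier_mat g g" "(\<Gamma>\<^sup>T * \<Gamma>)\<^sup>T = \<Gamma>\<^sup>T * \<Gamma>" using \<Gamma> by (auto simp: mat_transpose_mult_dim)
  from symmetric_spectral[OF G] obtain U f where UO: "orth g U" and Gs: "\<Gamma>\<^sup>T * \<Gamma> = spectral g U f" .
  interpret orth g U by fact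
  have f\<mu>: "f a \<ge> \<mu>" if "a < g" for a using min_eigenvalue_le[OF UO that, of f] \<mu>(1) by (simp add: Gs)
  have f0: "f a > 0" if "a < g" for a using f\<mu>[OF that] \<mu>(2) by linarith
  define H where "H = spectral g U (\<lambda>a. 1 / sqrt (f a))"
  have H: "H \<in> carrier_mat g g" "H\<^sup>T = H" by (auto simp: H_def sym)
  define V where "V = R * (\<Gamma> * H)"
  have V: "V \<in> carrier_mat p g" using R(1) \<Gamma> H by (simp add: V_def)
  have HGH: "H * ((\<Gamma>\<^sup>T * \<Gamma>) * H) = 1\<^sub>m g"
    unfolding Gs H_def mult one[symmetric]
  proof (rule spectral_cong)
    fix a assume "a < g"
    then have "f a > 0" by (rule f0)
    then show "1 / sqrt (f a) * (f a * (1 / sqrt (f a))) = 1" by (simp add: field_simps)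
  qed
  have "V\<^sup>T * (S * V) = H * (\<Gamma>\<^sup>T * ((R * S * R) * (\<Gamma> * H)))"
    using R(1,2) \<Gamma> H Sc by (simp add: V_def mat_transpose_mult_dim mat_mult_assoc_dim del: assoc_mult_mat)
  also have "\<dots> = H * ((\<Gamma>\<^sup>T * \<Gamma>) * H)"
    unfolding R(3) using \<Gamma> H by (simp add: mat_mult_assoc_dim del: assoc_mult_mat)
  finally have 1: "V\<^sup>T * (S * V) = 1\<^sub>m g" unfolding HGH .
  have HGGH: "H * ((\<Gamma>\<^sup>T * \<Gamma>) * ((\<Gamma>\<^sup>T * \<Gamma>) * H)) = spectral g U f"
    unfolding Gs H_def mult
  proof (rule spectral_cong)
    fix a assume "a < g"
    then have "f a > 0" by (rule f0)
    then show "1 / sqrt (f a) * (f a * (f a * (1 / sqrt (f a)))) = f a" by (simp add: field_simps)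
  qed
  have "V\<^sup>T * (A * V) = H * (\<Gamma>\<^sup>T * ((R * A * R) * (\<Gamma> * H)))"
    using R(1,2) \<Gamma> H A by (simp add: V_def mat_transpose_mult_dim mat_mult_assoc_dim del: assoc_mult_mat)
  also have "\<dots> = H * ((\<Gamma>\<^sup>T * \<Gamma>) * ((\<Gamma>\<^sup>T * \<Gamma>) * H))"
    unfolding R_def eq[symmetric] using \<Gamma> H by (simp add: mat_mult_assoc_dim del: assoc_mult_mat)
  finally have 2: "V\<^sup>T * (A * V) = spectral g U f" unfolding HGGH .
  show thesis
  proof (rule that[OF V])
    show "qf p S (\<lambda>l. V $$ (l,a)) = 1" if "a < g" for a
      unfolding qf_col[OF Sc V that] 1 using that by simp
    fix y
    have "\<mu> * (\<Sum>a<g. (y a)\<^sup>2) = \<mu> * (\<Sum>a<g. 1 * (mv (U\<^sup>T) y a)\<^sup>2)"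
      unfolding qf[of "\<lambda>_. 1", symmetric] one qf_one ..
    also have "\<dots> \<le> (\<Sum>a<g. f a * (mv (U\<^sup>T) y a)\<^sup>2)"
      unfolding sum_distrib_left using f\<mu> by (intro sum_mono) (auto intro: mult_right_mono)
    also have "\<dots> = qf g (V\<^sup>T * (A * V)) y" unfolding 2 qf ..
    also have "\<dots> = qf p A (mv V y)" by (rule qf_congruence[OF A V])
    finally show "\<mu> * (\<Sum>a<g. (y a)\<^sup>2) \<le> qf p A (mv V y)" .
  qed
qed

locale regression = full_rank n k X + prob_space P
  for n k :: nat and X :: "real mat" and P :: "'a measure" +
  fixes p :: nat and jst :: "nat set" and \<Theta> S :: "real mat" and Y :: "'a \<Rightarrow> real mat"
  assumes jst: "jst \<subseteq> {..<k}" and \<Theta>: "\<Theta> \<in> carrier_mat (card jst) p" and S: "pos_def p S"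
    and Y: "matrix_normal P n p Y (cols_sub X jst * \<Theta>) S" and p: "1 \<le> p" and kn: "k < n"
begin

definition "M = cols_sub X jst * \<Theta>"

definition "resid_mat j = 1\<^sub>m n - proj_mat (cols_sub X j)"

definition "rdet j x = det ((Y x)\<^sup>T * resid_mat j * Y x)"

lemma M: "M \<in> carrier_mat n p"
  unfolding M_def using cols_sub_carrier[OF X jst] \<Theta> by simp

lemma Y_carrier: "x \<in> space P \<Longrightarrow> Y x \<in> carrier_mat n p"
  using Y by (simp add: matrix_normal_def)

lemma noise: "\<exists>c. gaussian_matrix P n p (\<lambda>x. Y x - M) S c"
  using matrix_normal_noise[OF prob_space_axioms Y[folded M_def] S M] .

lemma resid_mat: "j \<subseteq> {..<k} \<Longrightarrow> orth_projection n (resid_mat j)"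
  "j \<subseteq> {..<k} \<Longrightarrow> mtrace (resid_mat j) = real n - real (card j)"
  unfolding resid_mat_def using full_rank.resid[OF cols_sub] by blast+

lemma resid_mat_M: "jst \<subseteq> j \<Longrightarrow> j \<subseteq> {..<k} \<Longrightarrow> resid_mat j * M = 0\<^sub>m n p"
proof -
  assume j: "jst \<subseteq> j" "j \<subseteq> {..<k}"
  have c: "resid_mat j \<in> carrier_mat n n" using orth_projection.Q(1)[OF resid_mat(1)[OF j(2)]] .
  have "resid_mat j * M = (resid_mat j * cols_sub X jst) * \<Theta>"
    unfolding M_def using c cols_sub_carrier[OF X jst] \<Theta> by (simp add: mat_mult_assoc_dim del: assoc_mult_mat)
  then show ?thesis unfolding resid_mat_def proj_cols_sub_nested[OF j(2,1)] using left_mult_zero_mat[OF \<Theta>] by simp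
qed

lemma card_le: "j \<subseteq> {..<k} \<Longrightarrow> card j \<le> k"
  using card_mono[of "{..<k}" j] by simp

lemma nested_gram:
  assumes j: "j \<subseteq> l" "l \<subseteq> {..<k}" and l: "jst \<subseteq> l"
  obtains U B B' c where "orth n U" "B \<subseteq> {..<n}" "B' \<subseteq> B" "card B = n - card j" "card B' = n - card l"
    "gaussian_matrix P n p (\<lambda>x. U\<^sup>T * (Y x - M)) S c"
    "resid_mat j = spectral n U (indicator B)"
    "\<forall>x\<in>space P. rdet j x = det (gram (U\<^sup>T * M + U\<^sup>T * (Y x - M)) B)"
    "\<forall>x\<in>space P. rdet l x = det (gram (U\<^sup>T * (Y x - M)) B')"
    "\<forall>i\<in>B'. \<forall>z. mv (U\<^sup>T * M) z i = 0"
    "jst \<subseteq> j \<longrightarrow> (\<forall>x\<in>space P. rdet j x = det (gram (U\<^sup>T * (Y x - M)) B))"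
proof -
  have jk: "j \<subseteq> {..<k}" using j by auto
  note rj = resid_mat[OF jk] and rl = resid_mat[OF j(2)]
  have "resid_mat j * resid_mat l = resid_mat l"
    unfolding resid_mat_def by (rule resid_nested[OF j(2,1)])
  from nested_projections_diagonal[OF rj(1) rl(1) this] obtain U B B' where UO: "orth n U"
    and B: "B \<subseteq> {..<n}" "B' \<subseteq> B" and s: "resid_mat j = spectral n U (indicator B)" "resid_mat l = spectral n U (indicator B')"
    and card: "card B = mtrace (resid_mat j)" "card B' = mtrace (resid_mat l)" .
  interpret orth n U by fact
  obtain c where c: "gaussian_matrix P n p (\<lambda>x. Y x - M) S c" using noise by blast
  interpret E: gaussian_matrix P n p "\<lambda>x. Y x - M" S c by fact
  have UT: "U\<^sup>T \<in> carrier_mat n n" "(U\<^sup>T)\<^sup>T * U\<^sup>T = 1\<^sub>m n" using U UU' by auto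
  have B'n: "B' \<subseteq> {..<n}" using B by auto
  have split: "U\<^sup>T * M + U\<^sup>T * (Y x - M) = U\<^sup>T * Y x" if "x \<in> space P" for x
  proof -
    have "Y x = M + (Y x - M)" using M Y_carrier[OF that] by (intro eq_matI) auto
    then have "U\<^sup>T * Y x = U\<^sup>T * (M + (Y x - M))" by simp
    also have "\<dots> = U\<^sup>T * M + U\<^sup>T * (Y x - M)"
      by (rule mult_add_distrib_mat[OF UT(1) M]) (use M Y_carrier[OF that] in \<open>auto intro: minus_carrier_mat\<close>)
    finally show ?thesis ..
  qed
  have null: "mv (U\<^sup>T * M) z i = 0" if r: "resid_mat l' = spectral n U (indicator D)" and l': "jst \<subseteq> l'" "l' \<subseteq> {..<k}" and i: "i \<in> D" "i < n" for l' D z i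
  proof -
    have "mat_diag n (indicator D) * (U\<^sup>T * M) = U\<^sup>T * (U * (mat_diag n (indicator D) * (U\<^sup>T * M)))"
      by (rule invertible_cancel[OF UU, symmetric]) (use U M in auto)
    also have "U * (mat_diag n (indicator D) * (U\<^sup>T * M)) = resid_mat l' * M"
      unfolding r spectral_def using U M by (simp add: mat_mult_assoc_dim del: assoc_mult_mat)
    also have "U\<^sup>T * (resid_mat l' * M) = 0\<^sub>m n p" unfolding resid_mat_M[OF l'] using UT by simp
    finally have z: "mat_diag n (indicator D) * (U\<^sup>T * M) = 0\<^sub>m n p" .
    have UM: "U\<^sup>T * M \<in> carrier_mat n p" using U M by simp
    have "(U\<^sup>T * M) $$ (i,a) = 0" if "a < p" for a
      using arg_cong[OF z, of "\<lambda>A. A $$ (i,a)"] that i by (simp add: mat_diag_mult_left[OF UM] del: index_mult_mat(1))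
    then show ?thesis using M by (simp add: mv_def del: index_mult_mat(1))
  qed
  have rd: "rdet l' x = det (gram (U\<^sup>T * Y x) D)" if "resid_mat l' = spectral n U (indicator D)" "D \<subseteq> {..<n}" "x \<in> space P" for l' D x
    unfolding rdet_def that(1) gram_spectral[OF Y_carrier[OF that(3)] that(2)] ..
  have rd0: "gram (U\<^sup>T * Y x) D = gram (U\<^sup>T * (Y x - M)) D"
    if r: "resid_mat l' = spectral n U (indicator D)" and D: "D \<subseteq> {..<n}" and l': "jst \<subseteq> l'" "l' \<subseteq> {..<k}" and x: "x \<in> space P" for l' D x
  proof (rule eq_matI)
    fix a b assume "a < dim_row (gram (U\<^sup>T * (Y x - M)) D)" "b < dim_col (gram (U\<^sup>T * (Y x - M)) D)"
    then have ab: "a < p" "b < p" using M by auto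
    have UM: "U\<^sup>T * M \<in> carrier_mat n p" using U M by simp
    have E: "U\<^sup>T * (Y x - M) \<in> carrier_mat n p" using U M Y_carrier[OF x] by (auto intro!: mult_carrier_mat minus_carrier_mat)
    have "(U\<^sup>T * Y x) $$ (i,a) = (U\<^sup>T * (Y x - M)) $$ (i,a)" if "i \<in> D" "a < p" for i a
    proof -
      have i: "i < n" using that D by auto
      have "mv (U\<^sup>T * M) (\<lambda>b. if b = a then 1 else 0) i = 0" by (rule null[OF r l' that(1) i])
      then have "(U\<^sup>T * M) $$ (i,a) = 0"
        using M that by (simp add: mv_def if_distrib[of "\<lambda>u. _ * u"] del: index_mult_mat(1) cong: if_cong)
      then show ?thesis unfolding split[OF x, symmetric] using i that U M by (simp del: index_mult_mat(1))
    qed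
    then show "gram (U\<^sup>T * Y x) D $$ (a,b) = gram (U\<^sup>T * (Y x - M)) D $$ (a,b)"
      using ab M Y_carrier[OF x] by (simp add: gram_def del: index_mult_mat(1))
  qed (use M Y_carrier[OF x] in auto)
  show thesis
  proof (rule that[OF UO B, of c])
    show "card B = n - card j" using card(1) card_le[OF jk] kn unfolding rj(2) by linarith
    show "card B' = n - card l" using card(2) card_le[OF j(2)] kn unfolding rl(2) by linarith
    show "gaussian_matrix P n p (\<lambda>x. U\<^sup>T * (Y x - M)) S c" by (rule E.rotate[OF UT])
    show "resid_mat j = spectral n U (indicator B)" by (rule s(1))
    show "\<forall>x\<in>space P. rdet j x = det (gram (U\<^sup>T * M + U\<^sup>T * (Y x - M)) B)"
      using split rd[OF s(1) B(1)] by simp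
    show "\<forall>x\<in>space P. rdet l x = det (gram (U\<^sup>T * (Y x - M)) B')"
      using rd[OF s(2) B'n] rd0[OF s(2) B'n l j(2)] by simp
    show "\<forall>i\<in>B'. \<forall>z. mv (U\<^sup>T * M) z i = 0"
      using null[OF s(2) l j(2)] B'n by blast
    show "jst \<subseteq> j \<longrightarrow> (\<forall>x\<in>space P. rdet j x = det (gram (U\<^sup>T * (Y x - M)) B))"
      using rd[OF s(1) B(1)] rd0[OF s(1) B(1) _ jk] by simp
  qed
qed

lemma rdet_overfit:
  fixes h \<eta> :: real
  assumes j: "jst \<subseteq> j" "j \<subseteq> l" "l \<subseteq> {..<k}" and pn: "p + k \<le> n" and h: "0 < h" "h < 1"
    and \<eta>: "\<And>N. n - k \<le> N \<Longrightarrow> p / (N * h) \<le> \<eta> \<or> (\<exists>\<delta>::real. \<delta> > 0 \<and> (1 + \<delta>) * real p / real N \<le> h \<and> 2 / (\<delta>\<^sup>2 * real p) \<le> \<eta>)"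
  shows "prob {x\<in>space P. ln (rdet l x) < ln (rdet j x) + (real (card l) - real (card j)) * ln (1 - h)} \<le> 2 ^ k * k * \<eta>"
proof -
  have jk: "j \<subseteq> {..<k}" and jl: "jst \<subseteq> l" using j by auto
  from nested_gram[OF j(2,3) jl] obtain U B B' c where UO: "orth n U" and B: "B \<subseteq> {..<n}" "B' \<subseteq> B"
    and card: "card B = n - card j" "card B' = n - card l"
    and g: "gaussian_matrix P n p (\<lambda>x. U\<^sup>T * (Y x - M)) S c"
    and "resid_mat j = spectral n U (indicator B)"
    and "\<forall>x\<in>space P. rdet j x = det (gram (U\<^sup>T * M + U\<^sup>T * (Y x - M)) B)"
    and rl: "\<forall>x\<in>space P. rdet l x = det (gram (U\<^sup>T * (Y x - M)) B')"
    and "\<forall>i\<in>B'. \<forall>z. mv (U\<^sup>T * M) z i = 0"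
    and rj: "jst \<subseteq> j \<longrightarrow> (\<forall>x\<in>space P. rdet j x = det (gram (U\<^sup>T * (Y x - M)) B))"
    .
  interpret G: gaussian_matrix P n p "\<lambda>x. U\<^sup>T * (Y x - M)" S c by fact
  have fB: "finite B" by (rule finite_subset[OF B(1)]) simp
  have cl: "card j \<le> card l" by (rule card_mono[OF finite_subset[OF j(3)] j(2)]) simp
  have cBB: "card (B - B') = card l - card j"
    using card_Diff_subset[OF finite_subset[OF B(2) fB] B(2)] card card_le[OF j(3)] kn cl by linarith
  have pB: "p \<le> card B'" using card(2) card_le[OF j(3)] pn by linarith
  have e0: "\<eta> \<ge> 0"
  proof -
    have "p / (n * h) \<le> \<eta> \<or> (\<exists>\<delta>::real. \<delta> > 0 \<and> (1 + \<delta>) * real p / real n \<le> h \<and> 2 / (\<delta>\<^sup>2 * real p) \<le> \<eta>)" by (rule \<eta>) simp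
    then show ?thesis
    proof
      assume "p / (n * h) \<le> \<eta>"
      moreover have "0 \<le> real p / (real n * h)" using h by simp
      ultimately show ?thesis by linarith
    next
      assume "\<exists>\<delta>::real. \<delta> > 0 \<and> (1 + \<delta>) * real p / real n \<le> h \<and> 2 / (\<delta>\<^sup>2 * real p) \<le> \<eta>"
      then obtain \<delta> :: real where "2 / (\<delta>\<^sup>2 * real p) \<le> \<eta>" by blast
      moreover have "0 \<le> 2 / (\<delta>\<^sup>2 * real p)" by simp
      ultimately show ?thesis by linarith
    qed
  qed
  have "{x\<in>space P. ln (rdet l x) < ln (rdet j x) + (real (card l) - real (card j)) * ln (1 - h)}
    = {x\<in>space P. ln (det (gram (U\<^sup>T * (Y x - M)) B')) < ln (det (gram (U\<^sup>T * (Y x - M)) B)) + card (B - B') * ln (1 - h)}"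
    unfolding cBB using rl rj[rule_format, OF j(1)] cl by (auto simp: of_nat_diff)
  also have "prob \<dots> \<le> 2 ^ card (B - B') * card (B - B') * \<eta>"
  proof (rule G.overfit_prob[OF B pB h(2)])
    fix C i assume C: "B' \<subseteq> C" "C \<subseteq> B" "i \<in> C"
    have "card B' \<le> card C" using C fB finite_subset by (intro card_mono) blast+
    then have N: "n - k \<le> card C" "p \<le> card C" using card(2) card_le[OF j(3)] pB by linarith+
    interpret L: gaussian_leverage P n p "\<lambda>x. U\<^sup>T * (Y x - M)" S c C
      by unfold_locales (use B C N p in auto)
    show "prob {x\<in>space P. h \<le> lev (U\<^sup>T * (Y x - M)) C i i} \<le> \<eta>"
      using \<eta>[OF N(1)]
    proof
      assume "p / (card C * h) \<le> \<eta>"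
      then show ?thesis using L.prob_lv_Markov[OF C(3) h(1)] by simp
    next
      assume "\<exists>\<delta>::real. \<delta> > 0 \<and> (1 + \<delta>) * real p / real (card C) \<le> h \<and> 2 / (\<delta>\<^sup>2 * real p) \<le> \<eta>"
      then obtain \<delta> :: real where d: "\<delta> > 0" "(1 + \<delta>) * real p / real (card C) \<le> h" "2 / (\<delta>\<^sup>2 * real p) \<le> \<eta>" by blast
      have "prob {x\<in>space P. h \<le> lev (U\<^sup>T * (Y x - M)) C i i} \<le> prob {x\<in>space P. (1 + \<delta>) * real p / real (card C) \<le> lev (U\<^sup>T * (Y x - M)) C i i}"
        using L.lv_measurable[OF C(3) C(3)] d(2) by (intro finite_measure_mono) auto
      then show ?thesis using L.prob_lv_concentrated[OF C(3) d(1)] d(3) by linarith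
    qed
  qed
  also have "\<dots> \<le> 2 ^ k * k * \<eta>"
  proof (rule mult_right_mono[OF _ e0])
    have "card (B - B') \<le> k" unfolding cBB using card_le[OF j(3)] by linarith
    then show "real (2 ^ card (B - B') * card (B - B')) \<le> real (2 ^ k * k)"
      by (intro of_nat_mono mult_mono power_increasing) auto
  qed
  finally show ?thesis .
qed

lemma rdet_underfit:
  fixes \<mu> t C C' :: real
  assumes j: "j \<subseteq> {..<k}" and pn: "p + k \<le> n"
    and \<Gamma>: "\<Gamma> \<in> carrier_mat p g" "\<Gamma> * \<Gamma>\<^sup>T = noncentrality X jst \<Theta> S j"
    and \<mu>: "\<mu> \<le> min_eigenvalue (\<Gamma>\<^sup>T * \<Gamma>)" "\<mu> > 0" and t: "t \<ge> 0" and C: "C > 0" "C' > 0"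
    and le: "\<mu> / 2 - C' \<ge> t * C"
  shows "prob {x\<in>space P. rdet j x < (1 + t) ^ g * rdet (j \<union> jst) x} \<le> 8 * g * n / C + 8 * g * k / C'"
proof -
  let ?l = "j \<union> jst"
  have l: "j \<subseteq> ?l" "?l \<subseteq> {..<k}" "jst \<subseteq> ?l" using j jst by auto
  from nested_gram[OF l] obtain U B B' c where UO: "orth n U" and B: "B \<subseteq> {..<n}" "B' \<subseteq> B"
    and card: "card B = n - card j" "card B' = n - card ?l"
    and g: "gaussian_matrix P n p (\<lambda>x. U\<^sup>T * (Y x - M)) S c"
    and sj: "resid_mat j = spectral n U (indicator B)"
    and rj: "\<forall>x\<in>space P. rdet j x = det (gram (U\<^sup>T * M + U\<^sup>T * (Y x - M)) B)"
    and rl: "\<forall>x\<in>space P. rdet ?l x = det (gram (U\<^sup>T * (Y x - M)) B')"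
    and null: "\<forall>i\<in>B'. \<forall>z. mv (U\<^sup>T * M) z i = 0"
    and "jst \<subseteq> j \<longrightarrow> (\<forall>x\<in>space P. rdet j x = det (gram (U\<^sup>T * (Y x - M)) B))"
    .
  interpret G: gaussian_matrix P n p "\<lambda>x. U\<^sup>T * (Y x - M)" S c by fact
  interpret orth n U by fact
  have UM: "U\<^sup>T * M \<in> carrier_mat n p" using U M by simp
  let ?A = "M\<^sup>T * resid_mat j * M"
  have rc: "resid_mat j \<in> carrier_mat n n" by (rule orth_projection.Q(1)[OF resid_mat(1)[OF j]])
  have A: "?A \<in> carrier_mat p p" using M rc by simp
  have "\<Gamma> * \<Gamma>\<^sup>T = inv_sqrt S * ?A * inv_sqrt S"
    unfolding \<Gamma>(2) noncentrality_def Let_def M_def resid_mat_def[symmetric]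
    using inv_sqrt_pos_def(1)[OF S] rc cols_sub_carrier[OF X jst] \<Theta> X
    by (simp add: mat_transpose_mult_dim mat_mult_assoc_dim resid_mat_def[symmetric] del: assoc_mult_mat)
  from signal_basis[OF S A \<Gamma>(1) this \<mu>] obtain V where V: "V \<in> carrier_mat p g"
    and V1: "\<And>a. a < g \<Longrightarrow> qf p S (\<lambda>l. V $$ (l,a)) = 1" and V2: "\<And>y. qf p ?A (mv V y) \<ge> \<mu> * (\<Sum>a<g. (y a)\<^sup>2)" by blast
  have pB: "p \<le> card B'" using card(2) card_le[OF l(2)] pn by linarith
  have "{x\<in>space P. rdet j x < (1 + t) ^ g * rdet ?l x} = {x\<in>space P. det (gram (U\<^sup>T * M + U\<^sup>T * (Y x - M)) B) < (1 + t) ^ g * det (gram (U\<^sup>T * (Y x - M)) B')}"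
    using rj rl by auto
  also have "prob \<dots> \<le> 8 * g * card B' / C + 8 * g * card (B - B') / C'"
  proof (rule G.underfit_prob[OF B pB UM V null[rule_format] V1 _ t C le])
    have dUM: "dim_col (U\<^sup>T * M) = p" using M by simp
    show "\<mu> * (\<Sum>a<g. (y a)\<^sup>2) \<le> (\<Sum>i\<in>B. (mv (U\<^sup>T * M) (mv V y) i)\<^sup>2)" for y
      using V2[of y] unfolding sj gram_spectral[OF M B(1)] gram_qf[OF dUM] .
  qed
  also have "\<dots> \<le> 8 * g * n / C + 8 * g * k / C'"
  proof -
    have fB: "finite B" by (rule finite_subset[OF B(1)]) simp
    have "card (B - B') = card B - card B'" by (rule card_Diff_subset[OF finite_subset[OF B(2) fB] B(2)])
    then have "card (B - B') \<le> k" "card B' \<le> n" using card card_le[OF l(2)] kn by linarith+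
    then show ?thesis using C by (intro add_mono divide_right_mono of_nat_mono mult_le_mono2) auto
  qed
  finally show ?thesis .
qed

end

section \<open>The prior term of the criterion\<close>

lemma nn_integral_exp_square:
  assumes v: "v > 0"
  shows "(\<integral>\<^sup>+x. ennreal (exp (- (x\<^sup>2 / v) / 2)) \<partial>lborel) = ennreal (sqrt (2 * pi * v))"
proof -
  have s: "sqrt v > 0" using v by simp
  have "(\<integral>\<^sup>+x. ennreal (normal_density 0 (sqrt v) x) \<partial>lborel) = 1"
    using prob_space.emeasure_space_1[OF prob_space_normal_density[OF s, of 0]]
    by (simp add: emeasure_density cong: nn_integral_cong)
  moreover have "ennreal (exp (- (x\<^sup>2 / v) / 2)) = ennreal (sqrt (2 * pi * v)) * ennreal (normal_density 0 (sqrt v) x)" for x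
    using v by (simp add: normal_density_def ennreal_mult[symmetric] field_simps)
  ultimately show ?thesis by (simp add: nn_integral_cmult)
qed

lemma sqrt_prod: "sqrt (\<Prod>i\<in>A. f i) = (\<Prod>i\<in>A. sqrt (f i))"
  by (induction A rule: infinite_finite_induct) (auto simp: real_sqrt_mult)

lemma mtrace_diag_sandwich:
  assumes W: "W \<in> carrier_mat q p"
  shows "mtrace (mat_diag p g * (W\<^sup>T * (mat_diag q d * W))) = (\<Sum>a<p. \<Sum>i<q. g a * d i * (W $$ (i,a))\<^sup>2)"
proof -
  have "mat_diag p g * (W\<^sup>T * (mat_diag q d * W)) = Matrix.mat p p (\<lambda>(a,b). g a * (W\<^sup>T * (mat_diag q d * W)) $$ (a,b))"
    by (rule mat_diag_mult_left) (use W in auto)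
  moreover have "(W\<^sup>T * (mat_diag q d * W)) $$ (a,a) = (\<Sum>i<q. d i * (W $$ (i,a))\<^sup>2)" if "a < p" for a
    using W that unfolding mat_diag_mult_left[OF W]
    by (subst mult_index_sum) (auto simp: power2_eq_square mult_ac intro!: sum.cong)
  ultimately show ?thesis using W by (simp add: mtrace_def sum_distrib_left mult.assoc)
qed

lemma nn_integral_matrix_gaussian:
  assumes A: "pos_def q A" and S: "pos_def p S" and T0: "T0 \<in> carrier_mat q p"
  shows "(\<integral>\<^sup>+t. ennreal (exp (- mtrace (minv S * ((Matrix.mat q p t - T0)\<^sup>T * (A * (Matrix.mat q p t - T0)))) / 2)) \<partial>entries_measure q p)
    = ennreal ((2 * pi) powr (real (p * q) / 2) * det S powr (real q / 2) * det A powr (- real p / 2))"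
proof -
  let ?I = "{..<q} \<times> {..<p}" and ?m = "\<lambda>t. Matrix.mat q p t"
  let ?L = "entries_measure q p"
  obtain U d where UO: "orth q U" and As: "A = spectral q U d" and d: "\<And>i. i < q \<Longrightarrow> d i > 0"
    using pos_def_spectral[OF A] by metis
  obtain V f where VO: "orth p V" and Ss: "S = spectral p V f" and f: "\<And>i. i < p \<Longrightarrow> f i > 0"
    using pos_def_spectral[OF S] by metis
  interpret U: orth q U by fact
  interpret V: orth p V by fact
  note UV = U.U V.U
  have "f a \<noteq> 0" if "a < p" for a using f[OF that] by simp
  then have Si: "minv S = spectral p V (\<lambda>a. 1 / f a)" unfolding Ss by (rule V.spectral_minv)
  define \<phi> where "\<phi> t = ennreal (exp (- (\<Sum>a<p. \<Sum>i<q. (1 / f a) * d i * (t (i,a))\<^sup>2) / 2))" for t :: "nat \<times> nat \<Rightarrow> real"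
  have \<phi>[measurable]: "\<phi> \<in> borel_measurable ?L" unfolding \<phi>_def by measurable
  define T where "T t = entries (U\<^sup>T * (?m t * V))" for t
  have Wc: "U\<^sup>T * (?m t * V) \<in> carrier_mat q p" for t by (rule carrier_matI) (use UV in auto)
  have mT: "?m (T t) = U\<^sup>T * (?m t * V)" for t unfolding T_def by (rule mat_entries[OF Wc])
  have quad: "mtrace (minv S * ((?m t)\<^sup>T * (A * ?m t))) = (\<Sum>a<p. \<Sum>i<q. (1 / f a) * d i * (T t (i,a))\<^sup>2)" for t
  proof -
    let ?W = "U\<^sup>T * (?m t * V)" and ?F = "mat_diag p (\<lambda>a. 1 / f a)"
    have W2: "V\<^sup>T * ((?m t)\<^sup>T * U) = ?W\<^sup>T" using UV by (simp add: mat_transpose_mult_dim mat_mult_assoc_dim del: assoc_mult_mat)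
    have "mtrace (minv S * ((?m t)\<^sup>T * (A * ?m t))) = mtrace (V * (?F * (V\<^sup>T * ((?m t)\<^sup>T * (A * ?m t)))))"
      unfolding Si spectral_def using UV As U.carrier[of d] by (simp add: mat_mult_assoc_dim del: assoc_mult_mat U.carrier)
    also have "\<dots> = mtrace ((?F * (V\<^sup>T * ((?m t)\<^sup>T * (A * ?m t)))) * V)"
      using UV As U.carrier[of d] by (intro mtrace_mult_commute[of _ p p]) auto
    also have "(?F * (V\<^sup>T * ((?m t)\<^sup>T * (A * ?m t)))) * V = ?F * ((V\<^sup>T * ((?m t)\<^sup>T * U)) * (mat_diag q d * ?W))"
      unfolding As spectral_def using UV by (simp add: mat_mult_assoc_dim del: assoc_mult_mat)
    also have "mtrace \<dots> = (\<Sum>a<p. \<Sum>i<q. (1 / f a) * d i * (?W $$ (i,a))\<^sup>2)"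
      unfolding W2 by (rule mtrace_diag_sandwich[OF Wc])
    also have "\<dots> = (\<Sum>a<p. \<Sum>i<q. (1 / f a) * d i * (T t (i,a))\<^sup>2)"
      using UV by (intro sum.cong refl) (simp add: T_def entries_def del: index_mult_mat(1))
    finally show ?thesis .
  qed
  have nrm: "(\<Sum>ij\<in>?I. (e ij)\<^sup>2) = mtrace (1\<^sub>m p * ((?m e)\<^sup>T * ?m e))" for e :: "nat \<times> nat \<Rightarrow> real"
    unfolding mtrace_gram[OF one_carrier_mat mat_carrier] wnorm_def qf_one sum.cartesian_product by (auto intro!: sum.cong)
  have T[measurable]: "T \<in> measurable ?L ?L"
    unfolding T_def by (rule mmeas_entries[OF mmeas_mult[OF mmeas_const mmeas_mult[OF mmeas_mat mmeas_const]]]) (use UV in auto)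
  have "(\<integral>\<^sup>+t. ennreal (exp (- mtrace (minv S * ((?m t - T0)\<^sup>T * (A * (?m t - T0)))) / 2)) \<partial>?L)
    = (\<integral>\<^sup>+t. \<phi> (T (\<lambda>ij\<in>?I. t ij + - T0 $$ ij)) \<partial>?L)"
  proof (rule nn_integral_cong)
    fix t :: "nat \<times> nat \<Rightarrow> real"
    have "?m (\<lambda>ij\<in>?I. t ij + - T0 $$ ij) = ?m t - T0" using T0 by (intro eq_matI) auto
    then show "ennreal (exp (- mtrace (minv S * ((?m t - T0)\<^sup>T * (A * (?m t - T0)))) / 2)) = \<phi> (T (\<lambda>ij\<in>?I. t ij + - T0 $$ ij))"
      unfolding \<phi>_def quad[symmetric] by simp
  qed
  also have "\<dots> = (\<integral>\<^sup>+t. \<phi> (T t) \<partial>?L)" by (rule nn_integral_Leb_translation) (simp, measurable)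
  also have "\<dots> = (\<integral>\<^sup>+t. \<phi> t \<partial>?L)"
  proof (rule nn_integral_Leb_isometry)
    fix x y assume "x \<in> space ?L" "y \<in> space ?L"
    have "?m (\<lambda>ij\<in>?I. x ij + y ij) = ?m x + ?m y" by (rule eq_matI) auto
    then have "T (\<lambda>ij\<in>?I. x ij + y ij) = entries (U\<^sup>T * (?m x * V) + U\<^sup>T * (?m y * V))"
    proof -
      have "(?m x + ?m y) * V = ?m x * V + ?m y * V" by (rule add_mult_distrib_mat[of _ q p]) (use UV in auto)
      moreover have "U\<^sup>T * (?m x * V + ?m y * V) = U\<^sup>T * (?m x * V) + U\<^sup>T * (?m y * V)"
        by (rule mult_add_distrib_mat[of _ q q _ p]) (use UV in auto)
      ultimately show ?thesis using \<open>?m (\<lambda>ij\<in>?I. x ij + y ij) = ?m x + ?m y\<close> by (simp add: T_def)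
    qed
    also have "\<dots> = (\<lambda>i\<in>?I. T x i + T y i)"
      unfolding T_def entries_def using UV by (auto intro!: restrict_ext)
    finally show "T (\<lambda>ij\<in>?I. x ij + y ij) = (\<lambda>i\<in>?I. T x i + T y i)" .
  next
    fix x assume "x \<in> space ?L"
    have "mtrace ((?m (T x))\<^sup>T * ?m (T x)) = mtrace (V\<^sup>T * ((?m x)\<^sup>T * (U * (U\<^sup>T * (?m x * V)))))"
      unfolding mT using UV by (simp add: mat_transpose_mult_dim mat_mult_assoc_dim del: assoc_mult_mat)
    also have "U * (U\<^sup>T * (?m x * V)) = ?m x * V" by (rule invertible_cancel[OF U.UU']) (use UV in auto)
    also have "mtrace (V\<^sup>T * ((?m x)\<^sup>T * (?m x * V))) = mtrace (((?m x)\<^sup>T * (?m x * V)) * V\<^sup>T)"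
      using UV by (intro mtrace_mult_commute[of _ p p]) auto
    also have "((?m x)\<^sup>T * (?m x * V)) * V\<^sup>T = (?m x)\<^sup>T * (?m x * (V * V\<^sup>T))"
      using UV by (simp add: mat_mult_assoc_dim del: assoc_mult_mat)
    also have "\<dots> = (?m x)\<^sup>T * ?m x" unfolding V.UU' by simp
    finally show "(\<Sum>i\<in>?I. (T x i)\<^sup>2) = (\<Sum>i\<in>?I. (x i)\<^sup>2)" unfolding nrm by simp
  next
    fix y assume y: "y \<in> space ?L"
    let ?x = "entries (U * (?m y * V\<^sup>T))"
    have c1: "U * (?m y * V\<^sup>T) \<in> carrier_mat q p" by (rule carrier_matI) (use UV in auto)
    have "U\<^sup>T * (U * (?m y * V\<^sup>T) * V) = U\<^sup>T * (U * (?m y * (V\<^sup>T * V)))"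
      using UV by (simp add: mat_mult_assoc_dim del: assoc_mult_mat)
    also have "\<dots> = ?m y * (V\<^sup>T * V)" by (rule invertible_cancel[OF U.UU]) (use UV in auto)
    also have "\<dots> = ?m y" unfolding V.UU by simp
    finally have "T ?x = y" unfolding T_def mat_entries[OF c1] by (simp add: entries_mat[OF y])
    then show "\<exists>x\<in>space ?L. T x = y" using entries_in_space[OF c1] by blast
  next
    show "T \<in> measurable ?L ?L" by (rule T)
    show "\<phi> \<in> borel_measurable ?L" by (rule \<phi>)
  qed simp
  also have "\<dots> = (\<integral>\<^sup>+t. (\<Prod>ia\<in>?I. ennreal (exp (- ((t ia)\<^sup>2 / (f (snd ia) / d (fst ia))) / 2))) \<partial>?L)"
  proof (rule nn_integral_cong)
    fix t :: "nat \<times> nat \<Rightarrow> real"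
    have "(\<Sum>a<p. \<Sum>i<q. (1 / f a) * d i * (t (i,a))\<^sup>2) = (\<Sum>ia\<in>?I. (t ia)\<^sup>2 / (f (snd ia) / d (fst ia)))"
      by (subst sum.swap) (auto simp: sum.cartesian_product intro!: sum.cong)
    then have "- (\<Sum>a<p. \<Sum>i<q. (1 / f a) * d i * (t (i,a))\<^sup>2) / 2 = (\<Sum>ia\<in>?I. - ((t ia)\<^sup>2 / (f (snd ia) / d (fst ia))) / 2)"
      by (simp add: sum_negf sum_divide_distrib)
    then show "\<phi> t = (\<Prod>ia\<in>?I. ennreal (exp (- ((t ia)\<^sup>2 / (f (snd ia) / d (fst ia))) / 2)))"
      unfolding \<phi>_def by (simp add: exp_sum prod_ennreal)
  qed
  also have "\<dots> = (\<Prod>ia\<in>?I. \<integral>\<^sup>+x. ennreal (exp (- (x\<^sup>2 / (f (snd ia) / d (fst ia))) / 2)) \<partial>lborel)"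
  proof -
    interpret product_sigma_finite "\<lambda>_::nat \<times> nat. lborel :: real measure" by unfold_locales
    show ?thesis by (rule product_nn_integral_prod) auto
  qed
  also have "\<dots> = (\<Prod>ia\<in>?I. ennreal (sqrt (2 * pi * (f (snd ia) / d (fst ia)))))"
    using d f by (intro prod.cong refl nn_integral_exp_square) auto
  also have "\<dots> = ennreal (\<Prod>ia\<in>?I. sqrt (2 * pi * (f (snd ia) / d (fst ia))))"
    using d f by (intro prod_ennreal) (auto simp: less_imp_le)
  also have "(\<Prod>ia\<in>?I. sqrt (2 * pi * (f (snd ia) / d (fst ia)))) = (\<Prod>i<q. \<Prod>a<p. sqrt (2 * pi) * (sqrt (f a) * (1 / sqrt (d i))))"
    by (auto simp: prod.cartesian_product real_sqrt_mult real_sqrt_divide intro!: prod.cong)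
  also have "\<dots> = (\<Prod>i<q. sqrt (2 * pi) ^ p * ((\<Prod>a<p. sqrt (f a)) * (1 / sqrt (d i)) ^ p))"
    by (simp only: prod.distrib prod_constant card_lessThan)
  also have "\<dots> = (sqrt (2 * pi) ^ p) ^ q * ((\<Prod>a<p. sqrt (f a)) ^ q * (1 / (\<Prod>i<q. sqrt (d i))) ^ p)"
  proof -
    have "(\<Prod>i<q. (1 / sqrt (d i)) ^ p) = (1 / (\<Prod>i<q. sqrt (d i))) ^ p"
      unfolding prod_power_distrib[symmetric] by (simp add: prod_dividef)
    then show ?thesis by (simp only: prod.distrib prod_constant card_lessThan)
  qed
  also have "(\<Prod>a<p. sqrt (f a)) = sqrt (det S)" unfolding Ss V.det by (simp add: sqrt_prod)
  also have "(\<Prod>i<q. sqrt (d i)) = sqrt (det A)" unfolding As U.det by (simp add: sqrt_prod)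
  also have "(sqrt (2 * pi) ^ p) ^ q * (sqrt (det S) ^ q * (1 / sqrt (det A)) ^ p)
     = (2 * pi) powr (real (p * q) / 2) * det S powr (real q / 2) * det A powr (- real p / 2)"
  proof -
    have sq: "sqrt x ^ m = x powr (real m / 2)" if "x > 0" for x m
      using that by (simp add: powr_half_sqrt[symmetric] powr_powr powr_realpow[symmetric] mult.commute)
    have "(1 / sqrt (det A)) ^ p = det A powr (- real p / 2)"
      using sq[OF pos_def_det[OF A], of p] by (simp add: power_one_over powr_minus_divide)
    moreover have "(sqrt (2 * pi) ^ p) ^ q = (2 * pi) powr (real (p * q) / 2)"
      unfolding power_mult[symmetric] by (rule sq) simp
    ultimately show ?thesis using sq[OF pos_def_det[OF S], of q] by simp
  qed
  finally show ?thesis .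
qed

lemma (in full_rank) normal_density_ratio:
  assumes Y: "Y \<in> carrier_mat n p" and S: "pos_def p S" and T: "T \<in> carrier_mat q p"
  defines "T0 \<equiv> minv (X\<^sup>T * X) * X\<^sup>T * Y"
  shows "normal_mat_density (X * T) S Y = normal_mat_density (X * T0) S Y * exp (- mtrace (minv S * ((T - T0)\<^sup>T * ((X\<^sup>T * X) * (T - T0)))) / 2)"
proof -
  note K = XX_inv
  have T0: "T0 \<in> carrier_mat q p" unfolding T0_def using X Y K(1) by simp
  define Z D where "Z = Y - X * T0" and "D = X * (T - T0)"
  have XT: "X * T \<in> carrier_mat n p" "X * T0 \<in> carrier_mat n p" using X T T0 by auto
  have TT: "T - T0 \<in> carrier_mat q p" using T0 by (rule minus_carrier_mat)
  have D: "D \<in> carrier_mat n p" unfolding D_def using X TT by simp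
  have Z: "Z \<in> carrier_mat n p" unfolding Z_def using XT(2) by (rule minus_carrier_mat)
  have D': "D = X * T - X * T0" unfolding D_def by (rule mult_minus_distrib_mat[OF X T T0])
  have YT: "Y - X * T = Z - D" unfolding D' Z_def using Y X T T0 by (intro eq_matI) auto
  have "X\<^sup>T * Z = X\<^sup>T * Y - X\<^sup>T * (X * T0)"
    unfolding Z_def by (rule mult_minus_distrib_mat[of _ q n _ p]) (use X Y XT in auto)
  also have "X\<^sup>T * (X * T0) = (X\<^sup>T * X * minv (X\<^sup>T * X)) * (X\<^sup>T * Y)"
    unfolding T0_def using X Y K(1) by (simp add: mat_mult_assoc_dim del: assoc_mult_mat)
  also have "\<dots> = X\<^sup>T * Y" unfolding K(2) using X Y by simp
  finally have XZ: "X\<^sup>T * Z = 0\<^sub>m q p" using X Y by auto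
  have DZ: "D\<^sup>T * Z = 0\<^sub>m p p"
  proof -
    have "D\<^sup>T * Z = (T - T0)\<^sup>T * (X\<^sup>T * Z)"
      unfolding D_def using X TT Z T0 by (simp add: mat_transpose_mult_dim mat_mult_assoc_dim del: assoc_mult_mat)
    also have "\<dots> = 0\<^sub>m p p" unfolding XZ by (rule right_mult_zero_mat) (use TT in auto)
    finally show ?thesis .
  qed
  have ZD: "Z\<^sup>T * D = 0\<^sub>m p p"
    using arg_cong[OF DZ, of transpose_mat] D Z by (simp add: mat_transpose_mult_dim)
  have "(Z - D)\<^sup>T * (Z - D) = (Z\<^sup>T * Z - D\<^sup>T * Z) - (Z\<^sup>T * D - D\<^sup>T * D)"
  proof -
    have "(Z - D)\<^sup>T = Z\<^sup>T - D\<^sup>T" by (rule transpose_minus[OF Z D])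
    moreover have "(Z - D)\<^sup>T * (Z - D) = (Z - D)\<^sup>T * Z - (Z - D)\<^sup>T * D"
      by (rule mult_minus_distrib_mat[of _ p n _ p]) (use Z D in auto)
    moreover have "(Z\<^sup>T - D\<^sup>T) * Z = Z\<^sup>T * Z - D\<^sup>T * Z" "(Z\<^sup>T - D\<^sup>T) * D = Z\<^sup>T * D - D\<^sup>T * D"
      by (rule minus_mult_distrib_mat[of _ p n _ _ p]; use Z D in auto)+
    ultimately show ?thesis by simp
  qed
  also have "\<dots> = Z\<^sup>T * Z + D\<^sup>T * D" unfolding DZ ZD using Z D by (intro eq_matI) auto
  finally have sq: "(Z - D)\<^sup>T * (Z - D) = Z\<^sup>T * Z + D\<^sup>T * D" .
  have Sc: "S \<in> carrier_mat p p" and "det S \<noteq> 0" using pos_defD(1)[OF S] pos_def_det[OF S] by auto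
  then have Si: "minv S \<in> carrier_mat p p" by (rule minv)
  have "mtrace (minv S * ((Y - X * T)\<^sup>T * (Y - X * T))) = mtrace (minv S * (Z\<^sup>T * Z)) + mtrace (minv S * (D\<^sup>T * D))"
  proof -
    have "minv S * (Z\<^sup>T * Z + D\<^sup>T * D) = minv S * (Z\<^sup>T * Z) + minv S * (D\<^sup>T * D)"
      by (rule mult_add_distrib_mat[OF Si]) (use Z D in auto)
    then show ?thesis unfolding YT sq using Si Z D by (simp add: mtrace_def sum.distrib del: index_mult_mat(1))
  qed
  moreover have "D\<^sup>T * D = (T - T0)\<^sup>T * ((X\<^sup>T * X) * (T - T0))"
    unfolding D_def using X TT T0 by (simp add: mat_transpose_mult_dim mat_mult_assoc_dim del: assoc_mult_mat)
  ultimately have "mtrace (minv S * ((Y - X * T)\<^sup>T * (Y - X * T)))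
    = mtrace (minv S * (Z\<^sup>T * Z)) + mtrace (minv S * ((T - T0)\<^sup>T * ((X\<^sup>T * X) * (T - T0))))" by simp
  then show ?thesis
    unfolding normal_mat_density_def Let_def by (simp add: Z_def exp_add[symmetric] algebra_simps add_divide_distrib)
qed

lemma normal_mat_density_pos: "pos_def p S \<Longrightarrow> normal_mat_density M S Y > 0"
  using pos_def_det[of p S] by (simp add: normal_mat_density_def Let_def)

text \<open>The factor \<open>|S|\<close> from (P1) cancels the one of the Gaussian integral, hence the bound is uniform in \<open>Y\<close>.\<close>

lemma (in full_rank) marginal_ratio_bound:
  fixes m :: real and S :: "real mat"
  assumes j: "j \<subseteq> {..<q}" and Y: "Y \<in> carrier_mat n p" and prior: "prior_density (card j) p \<pi>"
    and P1: "\<And>T S. T \<in> carrier_mat (card j) p \<Longrightarrow> pos_def p S \<Longrightarrow>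
        \<pi> T S * det S powr (real (card j) / 2) = \<pi> (T * inv_sqrt S) (1\<^sub>m p)"
    and m: "\<And>T. T \<in> carrier_mat (card j) p \<Longrightarrow> \<pi> T (1\<^sub>m p) \<le> m"
  defines "A \<equiv> (cols_sub X j)\<^sup>T * cols_sub X j"
  defines "r \<equiv> marginal_density \<pi> X j Y S / normal_mat_density (cols_sub X j * Theta_hat X Y j) S Y"
  shows "0 \<le> r" "r \<le> m * ((2 * pi) powr (real (p * card j) / 2) * det A powr (- real p / 2))"
proof -
  let ?Xj = "cols_sub X j" and ?q = "card j" and ?m = "\<lambda>t. Matrix.mat (card j) p t" and ?L = "entries_measure (card j) p"
  interpret J: full_rank n ?q ?Xj by (rule cols_sub[OF j])
  have dY: "dim_col Y = p" using Y by simp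
  let ?K = "(2 * pi) powr (real (p * ?q) / 2) * det A powr (- real p / 2)"
  have one: "pos_def p (1\<^sub>m p)"
    by (rule pos_defI) (auto simp: qf_one intro!: sum_pos2)
  have m0: "m \<ge> 0"
  proof -
    have "0 \<le> \<pi> (0\<^sub>m ?q p) (1\<^sub>m p)" using prior one by (simp add: prior_density_def)
    then show ?thesis using m[of "0\<^sub>m ?q p"] by simp
  qed
  have K0: "?K \<ge> 0" by simp
  have "0 \<le> r \<and> r \<le> m * ?K"
  proof (cases "pos_def p S")
    case False
    then show ?thesis unfolding r_def marginal_density_def Let_def dY using m0 K0 by simp
  next
    case S: True
    let ?T0 = "Theta_hat X Y j" and ?d = "normal_mat_density (?Xj * Theta_hat X Y j) S Y"
    have T0: "?T0 \<in> carrier_mat ?q p" unfolding Theta_hat_def Let_def using J.X J.XX_inv(1) Y by simp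
    have d: "?d > 0" by (rule normal_mat_density_pos[OF S])
    have dS: "det S > 0" by (rule pos_def_det[OF S])
    let ?e = "\<lambda>t. exp (- mtrace (minv S * ((?m t - ?T0)\<^sup>T * (A * (?m t - ?T0)))) / 2)"
    have ratio: "normal_mat_density (?Xj * ?m t) S Y = ?d * ?e t" for t
      unfolding A_def Theta_hat_def Let_def by (rule J.normal_density_ratio[OF Y S]) simp
    let ?f = "\<lambda>t. normal_mat_density (?Xj * ?m t) S Y * \<pi> (?m t) S"
    have p0: "\<pi> (?m t) S \<ge> 0" for t using prior S by (simp add: prior_density_def)
    have p1: "\<pi> (?m t) S \<le> m * det S powr (- real ?q / 2)" for t
    proof -
      have "\<pi> (?m t) S * det S powr (real ?q / 2) \<le> m"
        unfolding P1[OF mat_carrier S] by (rule m[OF mult_carrier_mat[OF mat_carrier inv_sqrt_pos_def(1)[OF S]]])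
      then show ?thesis using dS by (simp add: powr_minus_divide field_simps)
    qed
    have f0: "?f t \<ge> 0" for t using p0 normal_mat_density_pos[OF S] by (simp add: less_imp_le)
    have marg: "marginal_density \<pi> X j Y S = (\<integral>t. ?f t \<partial>?L)"
      unfolding marginal_density_def Let_def dY using S by simp
    have "0 \<le> (\<integral>t. ?f t \<partial>?L)" using f0 by simp
    moreover have "(\<integral>t. ?f t \<partial>?L) \<le> ?d * (m * ?K)"
    proof (cases "integrable ?L ?f")
      case False
      then show ?thesis using d m0 K0 by (simp add: not_integrable_integral_eq)
    next
      case True
      let ?c = "?d * (m * det S powr (- real ?q / 2))"
      have c0: "?c \<ge> 0" using d m0 by simp
      have A: "pos_def ?q A" unfolding A_def by (rule J.XX)
      have "ennreal (\<integral>t. ?f t \<partial>?L) = (\<integral>\<^sup>+t. ennreal (?f t) \<partial>?L)"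
        using nn_integral_eq_integral[OF True] f0 by simp
      also have "\<dots> \<le> (\<integral>\<^sup>+t. ennreal ?c * ennreal (?e t) \<partial>?L)"
      proof (rule nn_integral_mono)
        fix t
        have "?f t \<le> (?d * ?e t) * (m * det S powr (- real ?q / 2))"
          unfolding ratio using d p1[of t] by (intro mult_left_mono) auto
        also have "\<dots> = ?c * ?e t" by simp
        finally show "ennreal (?f t) \<le> ennreal ?c * ennreal (?e t)"
          using c0 by (simp add: ennreal_mult[symmetric] ennreal_leI)
      qed
      also have "\<dots> = ennreal ?c * (\<integral>\<^sup>+t. ennreal (?e t) \<partial>?L)"
      proof (rule nn_integral_cmult)
        have Si: "minv S \<in> carrier_mat p p" using minv(1)[OF pos_defD(1)[OF S]] dS by simp
        have "mmeas ?L p p (\<lambda>t. minv S * ((?m t - ?T0)\<^sup>T * (A * (?m t - ?T0))))"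
          by (intro mmeas_mult[of _ _ p] mmeas_mult[of _ _ ?q] mmeas_transpose mmeas_minus mmeas_mat mmeas_const Si T0 pos_defD(1)[OF A])
        note e1 = mmeasD(2)[OF this]
        have "(\<lambda>t. \<Sum>i<p. (minv S * ((?m t - ?T0)\<^sup>T * (A * (?m t - ?T0)))) $$ (i,i)) \<in> borel_measurable ?L"
          using e1 by (intro borel_measurable_sum) auto
        then have "(\<lambda>t. mtrace (minv S * ((?m t - ?T0)\<^sup>T * (A * (?m t - ?T0))))) \<in> borel_measurable ?L"
          unfolding mtrace_def using Si by simp
        then show "(\<lambda>t. ennreal (?e t)) \<in> borel_measurable ?L" by simp
      qed
      also have "\<dots> = ennreal (?c * ((2 * pi) powr (real (p * ?q) / 2) * det S powr (real ?q / 2) * det A powr (- real p / 2)))"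
        unfolding nn_integral_matrix_gaussian[OF A S T0] using c0 by (simp add: ennreal_mult)
      also have "?c * ((2 * pi) powr (real (p * ?q) / 2) * det S powr (real ?q / 2) * det A powr (- real p / 2)) = ?d * (m * ?K)"
        using dS by (simp add: powr_minus_divide)
      finally show ?thesis using d m0 K0 by (subst (asm) ennreal_le_iff) auto
    qed
    ultimately show ?thesis unfolding r_def marg using d by (simp add: pos_divide_le_eq mult.commute)
  qed
  then show "0 \<le> r" "r \<le> m * ?K" by auto
qed

section \<open>Measurability of the criteria\<close>

text \<open>A polynomial iteration for the square root shows that the square root of a measurable positive definite
  matrix is measurable.\<close>

primrec sqrt_iter :: "real \<Rightarrow> nat \<Rightarrow> real" where
  "sqrt_iter a 0 = 0"
| "sqrt_iter a (Suc m) = sqrt_iter a m + (a - sqrt_iter a m * sqrt_iter a m) / 2"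

lemma sqrt_iter_tendsto:
  assumes a: "0 < a" "a \<le> 1" shows "(\<lambda>m. sqrt_iter a m) \<longlonglongrightarrow> sqrt a"
proof -
  define s where "s = sqrt a"
  have s: "0 < s" "s \<le> 1" "s * s = a" using a by (auto simp: s_def)
  have *: "0 \<le> s - sqrt_iter a m \<and> s - sqrt_iter a m \<le> s * (1 - s / 2) ^ m \<and> 0 \<le> sqrt_iter a m" for m
  proof (induction m)
    case 0
    then show ?case using s by simp
  next
    case (Suc m)
    define b where "b = sqrt_iter a m"
    have b: "0 \<le> s - b" "s - b \<le> s * (1 - s / 2) ^ m" "0 \<le> b" using Suc by (auto simp: b_def)
    have "sqrt_iter a (Suc m) = b + (s * s - b * b) / 2" by (simp add: b_def s(3))
    then have e: "s - sqrt_iter a (Suc m) = (s - b) * (1 - (s + b) / 2)"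
      by (simp add: field_simps del: sqrt_iter.simps)
    have f: "0 \<le> 1 - (s + b) / 2" "1 - (s + b) / 2 \<le> 1 - s / 2" using b s by auto
    have "(s - b) * (1 - (s + b) / 2) \<le> (s * (1 - s / 2) ^ m) * (1 - s / 2)"
      using b f s by (intro mult_mono) auto
    moreover have "0 \<le> (s - b) * (1 - (s + b) / 2)" using b f by simp
    moreover have "0 \<le> sqrt_iter a (Suc m)"
    proof -
      have "b * b \<le> s * s" using b by (intro mult_mono) auto
      then show ?thesis using b by (simp add: b_def[symmetric] s(3))
    qed
    ultimately show ?case unfolding e by (simp add: mult_ac)
  qed
  have "(\<lambda>m. (1 - s / 2) ^ m) \<longlonglongrightarrow> 0" using s by (intro LIMSEQ_realpow_zero) auto
  then have "(\<lambda>m. s * (1 - s / 2) ^ m) \<longlonglongrightarrow> 0" using tendsto_mult_right_zero by blast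
  then have "(\<lambda>m. s - sqrt_iter a m) \<longlonglongrightarrow> 0"
    by (rule tendsto_sandwich[rotated 3]) (use * in auto)
  then have "(\<lambda>m. s - (s - sqrt_iter a m)) \<longlonglongrightarrow> s - 0" by (intro tendsto_intros)
  then show ?thesis by (simp add: s_def)
qed

primrec mat_sqrt_iter :: "nat \<Rightarrow> real mat \<Rightarrow> nat \<Rightarrow> real mat" where
  "mat_sqrt_iter p A 0 = 0\<^sub>m p p"
| "mat_sqrt_iter p A (Suc m) = mat_sqrt_iter p A m + (1/2) \<cdot>\<^sub>m (A - mat_sqrt_iter p A m * mat_sqrt_iter p A m)"

definition inv_sqrt0 :: "nat \<Rightarrow> real mat \<Rightarrow> real mat" where
  "inv_sqrt0 p S = inv0 (sqrt (1 + mtrace S) \<cdot>\<^sub>m Matrix.mat p p (\<lambda>ij. lim (\<lambda>m. mat_sqrt_iter p ((1 / (1 + mtrace S)) \<cdot>\<^sub>m S) m $$ ij)))"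

lemma (in orth) mat_sqrt_iter_spectral:
  "mat_sqrt_iter n (spectral n U d) m = spectral n U (\<lambda>i. sqrt_iter (d i) m)"
proof (induction m)
  case 0
  have "0\<^sub>m n n = spectral n U (\<lambda>_. 0)" by (rule eq_matI) (auto simp: carrier_matD[OF carrier] entry simp del: carrier)
  then show ?case by simp
next
  case (Suc m)
  show ?case
    unfolding mat_sqrt_iter.simps Suc mult minus smult plus
    by (rule spectral_cong) (simp add: field_simps)
qed

lemma inv_sqrt0_eq:
  assumes S: "pos_def p S" shows "inv_sqrt0 p S = inv_sqrt S"
proof -
  obtain U d where UO: "orth p U" and Ss: "S = spectral p U d" and d: "\<And>i. i < p \<Longrightarrow> d i > 0"
    using pos_def_spectral[OF S] by metis
  interpret orth p U by fact
  define t where "t = 1 + mtrace S"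
  have tr: "mtrace S = (\<Sum>i<p. d i)" unfolding Ss mtrace ..
  have t: "t > 0" unfolding t_def tr using d by (intro add_pos_nonneg sum_nonneg) (auto simp: less_imp_le)
  have dt: "0 < 1 / t * d i" "1 / t * d i \<le> 1" if "i < p" for i
  proof -
    show "0 < 1 / t * d i" using d[OF that] t by simp
    have "d i \<le> (\<Sum>i<p. d i)" using that d by (intro member_le_sum) (auto simp: less_imp_le)
    then show "1 / t * d i \<le> 1" using t by (simp add: t_def tr field_simps)
  qed
  have "Matrix.mat p p (\<lambda>ij. lim (\<lambda>m. mat_sqrt_iter p ((1 / t) \<cdot>\<^sub>m S) m $$ ij)) = spectral p U (\<lambda>i. sqrt (1 / t * d i))"
  proof (rule eq_matI)
    fix i j assume "i < dim_row (spectral p U (\<lambda>i. sqrt (1 / t * d i)))" "j < dim_col (spectral p U (\<lambda>i. sqrt (1 / t * d i)))"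
    then have ij: "i < p" "j < p" by (simp_all add: carrier_matD[OF carrier])
    have "(\<lambda>m. mat_sqrt_iter p ((1 / t) \<cdot>\<^sub>m S) m $$ (i,j)) \<longlonglongrightarrow> (\<Sum>l<p. sqrt (1 / t * d l) * U $$ (i,l) * U $$ (j,l))"
      unfolding Ss smult mat_sqrt_iter_spectral entry[OF ij]
      using dt by (intro tendsto_intros sqrt_iter_tendsto) auto
    then show "Matrix.mat p p (\<lambda>ij. lim (\<lambda>m. mat_sqrt_iter p ((1 / t) \<cdot>\<^sub>m S) m $$ ij)) $$ (i,j) = spectral p U (\<lambda>i. sqrt (1 / t * d i)) $$ (i,j)"
      using ij by (simp add: limI entry)
  qed (auto simp: carrier_matD[OF carrier])
  then have "inv_sqrt0 p S = inv0 (spectral p U (\<lambda>i. sqrt t * sqrt (1 / t * d i)))"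
    unfolding inv_sqrt0_def t_def[symmetric] by (simp add: smult)
  also have "spectral p U (\<lambda>i. sqrt t * sqrt (1 / t * d i)) = spectral p U (\<lambda>i. sqrt (d i))"
    using t by (intro spectral_cong) (simp add: real_sqrt_mult real_sqrt_divide)
  also have "\<dots> = pd_sqrt S" unfolding Ss by (rule pd_sqrt[symmetric]) (rule d)
  also have "inv0 (pd_sqrt S) = minv (pd_sqrt S)"
  proof (rule inv0_minv[of _ p])
    have e: "pd_sqrt S = spectral p U (\<lambda>i. sqrt (d i))" unfolding Ss by (rule pd_sqrt) (rule d)
    show "pd_sqrt S \<in> carrier_mat p p" unfolding e by simp
    show "det (pd_sqrt S) \<noteq> 0" unfolding e det using d by (auto simp: less_imp_neq[THEN not_sym])
  qed
  finally show ?thesis unfolding inv_sqrt_def .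
qed

lemma mmeas_mtrace: "mmeas M p p A \<Longrightarrow> (\<lambda>x. mtrace (A x)) \<in> borel_measurable M"
proof -
  assume A: "mmeas M p p A"
  have "(\<lambda>x. \<Sum>i<p. A x $$ (i,i)) \<in> borel_measurable M" using mmeasD(2)[OF A] by (intro borel_measurable_sum) auto
  then show ?thesis
    by (rule measurable_cong[THEN iffD1, rotated]) (simp add: mtrace_def mmeas_dims[OF A])
qed

lemma mmeas_inv_sqrt0:
  assumes A: "mmeas M p p A" shows "mmeas M p p (\<lambda>x. inv_sqrt0 p (A x))"
proof -
  have tr: "(\<lambda>x. mtrace (A x)) \<in> borel_measurable M" by (rule mmeas_mtrace[OF A])
  have "mmeas M p p (\<lambda>x. (1 / (1 + mtrace (A x))) \<cdot>\<^sub>m A x)"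
    by (rule mmeas_smult[OF A]) (use tr in measurable)
  then have it: "mmeas M p p (\<lambda>x. mat_sqrt_iter p ((1 / (1 + mtrace (A x))) \<cdot>\<^sub>m A x) m)" for m
    by (induction m) (auto intro!: mmeas_const mmeas_add mmeas_smult mmeas_minus mmeas_mult)
  have "mmeas M p p (\<lambda>x. Matrix.mat p p (\<lambda>ij. lim (\<lambda>m. mat_sqrt_iter p ((1 / (1 + mtrace (A x))) \<cdot>\<^sub>m A x) m $$ ij)))"
  proof (rule mmeasI)
    fix i j assume ij: "i < p" "j < p"
    have "(\<lambda>x. lim (\<lambda>m. mat_sqrt_iter p ((1 / (1 + mtrace (A x))) \<cdot>\<^sub>m A x) m $$ (i,j))) \<in> borel_measurable M"
      by (rule borel_measurable_lim_metric) (rule mmeasD(2)[OF it ij])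
    then show "(\<lambda>x. Matrix.mat p p (\<lambda>ij. lim (\<lambda>m. mat_sqrt_iter p ((1 / (1 + mtrace (A x))) \<cdot>\<^sub>m A x) m $$ ij)) $$ (i,j)) \<in> borel_measurable M"
      using ij by simp
  qed simp
  then show ?thesis unfolding inv_sqrt0_def
    by (intro mmeas_inv0 mmeas_smult) (use tr in measurable)
qed

lemma smooth_mat_fun_measurable:
  assumes g: "smooth_mat_fun q p g" and A: "mmeas M q p A"
  shows "(\<lambda>x. g (A x)) \<in> borel_measurable M"
proof -
  have "Ck 0 ({..<q} \<times> {..<p}) (\<lambda>t. g (Matrix.mat q p t))" using g unfolding smooth_mat_fun_def by blast
  then have c: "continuous_on UNIV (\<lambda>t. g (Matrix.mat q p t))" by simp
  have "(\<lambda>t. g (Matrix.mat q p t)) \<in> borel_measurable borel" by (rule borel_measurable_continuous_onI[OF c])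
  then have m: "(\<lambda>t. g (Matrix.mat q p t)) \<in> borel_measurable (PiM UNIV (\<lambda>_. borel))"
    by (simp add: measurable_def sets_PiM_equal_borel space_PiM PiE_UNIV_domain cong: measurable_cong_sets)
  define f where "f x ij = (if ij \<in> {..<q} \<times> {..<p} then A x $$ ij else 0)" for x ij
  have "f \<in> measurable M (PiM UNIV (\<lambda>_. borel))"
  proof (rule measurable_PiM_single')
    fix ij :: "nat \<times> nat"
    show "(\<lambda>x. f x ij) \<in> borel_measurable M"
      using mmeasD(2)[OF A, of "fst ij" "snd ij"] by (cases "ij \<in> {..<q} \<times> {..<p}") (auto simp: f_def)
  qed (auto simp: space_PiM)
  from measurable_compose[OF this m] have "(\<lambda>x. g (Matrix.mat q p (f x))) \<in> borel_measurable M" .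
  then show ?thesis
  proof (rule measurable_cong[THEN iffD1, rotated])
    fix x assume "x \<in> space M"
    then have "Matrix.mat q p (f x) = A x" using mmeas_dims[OF A] by (intro eq_matI) (auto simp: f_def)
    then show "g (Matrix.mat q p (f x)) = g (A x)" by simp
  qed
qed

lemma mmeas_comp: "mmeas N r c A \<Longrightarrow> f \<in> measurable M N \<Longrightarrow> mmeas M r c (\<lambda>x. A (f x))"
proof (rule mmeasI)
  fix i j assume A: "mmeas N r c A" and f: "f \<in> measurable M N" and ij: "i < r" "j < c"
  show "(\<lambda>x. A (f x) $$ (i,j)) \<in> borel_measurable M" by (rule measurable_compose[OF f mmeasD(2)[OF A ij]])
qed (auto simp: mmeas_def measurable_space)

lemma (in full_rank) Sigma_hat_measurable:
  assumes j: "j \<subseteq> {..<q}" and Y: "mmeas M n p Y"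
  shows "mmeas M p p (\<lambda>x. Sigma_hat X (Y x) j)"
proof -
  interpret J: full_rank n "card j" "cols_sub X j" by (rule cols_sub[OF j])
  have "mmeas M p p (\<lambda>x. (1 / real n) \<cdot>\<^sub>m ((Y x)\<^sup>T * (1\<^sub>m n - proj_mat (cols_sub X j)) * Y x))"
    by (rule mmeas_smult[OF mmeas_mult[OF mmeas_mult[OF mmeas_transpose[OF Y] mmeas_const] Y]])
      (use orth_projection.Q(1)[OF J.resid(1)] in auto)
  then show ?thesis
    unfolding Sigma_hat_def mmeas_def using mmeas_dims[OF Y] by (simp cong: measurable_cong)
qed

lemma (in orth_projection) quadratic:
  "Y \<in> carrier_mat n p \<Longrightarrow> Y\<^sup>T * Q * Y = (Q * Y)\<^sup>T * (Q * Y)"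
proof -
  assume Y: "Y \<in> carrier_mat n p"
  have "(Q * Y)\<^sup>T * (Q * Y) = Y\<^sup>T * (Q * Q) * Y"
    using Y Q(1,2) by (simp add: mat_transpose_mult_dim mat_mult_assoc_dim del: assoc_mult_mat)
  then show ?thesis unfolding Q(3) ..
qed

lemma qf_smult: "A \<in> carrier_mat p p \<Longrightarrow> qf p (c \<cdot>\<^sub>m A) x = c * qf p A x"
  unfolding qf_def sum_distrib_left by (intro sum.cong refl) simp

lemma (in full_rank) Sigma_hat_pos_def:
  assumes j: "j \<subseteq> {..<q}" and Y: "Y \<in> carrier_mat n p" and n: "n > 0"
  shows "pos_def p (Sigma_hat X Y j) \<longleftrightarrow> det (Sigma_hat X Y j) \<noteq> 0"
proof
  assume "pos_def p (Sigma_hat X Y j)"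
  then show "det (Sigma_hat X Y j) \<noteq> 0" using pos_def_det by fastforce
next
  assume d: "det (Sigma_hat X Y j) \<noteq> 0"
  interpret J: full_rank n "card j" "cols_sub X j" by (rule cols_sub[OF j])
  let ?Q = "1\<^sub>m n - proj_mat (cols_sub X j)"
  interpret Q: orth_projection n ?Q by (rule J.resid(1))
  let ?G = "?Q * Y"
  have G: "?G \<in> carrier_mat n p" using Q.Q(1) Y by simp
  have S: "Sigma_hat X Y j = (1 / real n) \<cdot>\<^sub>m (?G\<^sup>T * ?G)"
    unfolding Sigma_hat_def Q.quadratic[OF Y, symmetric] using Y by simp
  have GG: "?G\<^sup>T * ?G = gram ?G {..<n}"
    using G by (intro eq_matI) (auto simp: gram_def mult_index_sum simp del: index_mult_mat(1) intro!: sum.cong)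
  have "det (gram ?G {..<n}) \<noteq> 0" using d unfolding S GG by auto
  from gram_pos_def(1)[OF G _ this] have pd: "pos_def p (?G\<^sup>T * ?G)" unfolding GG by simp
  show "pos_def p (Sigma_hat X Y j)" unfolding S
  proof (rule pos_defI)
    show "(1 / real n) \<cdot>\<^sub>m (?G\<^sup>T * ?G) \<in> carrier_mat p p" using pos_defD(1)[OF pd] by simp
    have "((1 / real n) \<cdot>\<^sub>m (?G\<^sup>T * ?G))\<^sup>T = (1 / real n) \<cdot>\<^sub>m (?G\<^sup>T * ?G)\<^sup>T" by (rule eq_matI) auto
    then show "((1 / real n) \<cdot>\<^sub>m (?G\<^sup>T * ?G))\<^sup>T = (1 / real n) \<cdot>\<^sub>m (?G\<^sup>T * ?G)" unfolding pos_defD(2)[OF pd] .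
    fix x :: "nat \<Rightarrow> real" assume "\<exists>i<p. x i \<noteq> 0"
    then have "qf p (?G\<^sup>T * ?G) x > 0" by (rule pos_defD(3)[OF pd])
    moreover have "qf p ((1 / real n) \<cdot>\<^sub>m (?G\<^sup>T * ?G)) x = (1 / real n) * qf p (?G\<^sup>T * ?G) x"
      by (rule qf_smult[OF pos_defD(1)[OF pd]])
    ultimately show "qf p ((1 / real n) \<cdot>\<^sub>m (?G\<^sup>T * ?G)) x > 0" using n by simp
  qed
qed

lemma MPIC_main_measurable:
  assumes "(\<lambda>x. det (Sigma_hat X (Y x) j)) \<in> borel_measurable M" and Y: "mmeas M n p Y"
  shows "(\<lambda>x. MPIC_main X (Y x) j) \<in> borel_measurable M"
proof -
  have "(\<lambda>x. n * ln (det (Sigma_hat X (Y x) j)) + real n * real p * (ln (2 * pi) + 1) +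
      real n * real p * (2 * real (card j) + real p + 1) / (real n - real p - real (card j) - 1)) \<in> borel_measurable M"
    using assms(1) by measurable
  then show ?thesis
    by (rule measurable_cong[THEN iffD1, rotated]) (simp add: MPIC_main_def Let_def mmeas_dims[OF Y])
qed

lemma (in full_rank) MPIC_measurable:
  assumes j: "j \<subseteq> {..<q}" and Y: "mmeas M n p Y" and n: "n > 0" and prior: "prior_density (card j) p (\<pi> j)"
    and P1: "\<And>T S. T \<in> carrier_mat (card j) p \<Longrightarrow> pos_def p S \<Longrightarrow>
        \<pi> j T S * det S powr (real (card j) / 2) = \<pi> j (T * inv_sqrt S) (1\<^sub>m p)"
  shows "(\<lambda>x. MPIC \<pi> w X (Y x) j) \<in> borel_measurable M"
proof -
  let ?q = "card j" and ?Xj = "cols_sub X j" and ?L = "entries_measure (card j) p" and ?m = "\<lambda>t. Matrix.mat (card j) p t"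
  let ?S = "\<lambda>x. Sigma_hat X (Y x) j"
  interpret J: full_rank n ?q ?Xj by (rule cols_sub[OF j])
  have one: "pos_def p (1\<^sub>m p)"
    by (rule pos_defI) (auto simp: qf_one intro!: sum_pos2)
  have S: "mmeas M p p ?S" by (rule Sigma_hat_measurable[OF j Y])
  have dS: "(\<lambda>x. det (?S x)) \<in> borel_measurable M" by (rule mmeas_det[OF S])
  define D where "D Z x = (2 * pi) powr (- (real n * real p) / 2) * det (?S x) powr (- real n / 2) *
      exp (- (1 / 2) * mtrace (inv0 (?S x) * ((Y x - Z)\<^sup>T * (Y x - Z))))" for Z x
  define h where "h x t = D (?Xj * ?m t) x * (\<pi> j (?m t * inv_sqrt0 p (?S x)) (1\<^sub>m p) / det (?S x) powr (real ?q / 2))" for x t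
  have T0: "mmeas M n p (\<lambda>x. ?Xj * Theta_hat X (Y x) j)"
    unfolding Theta_hat_def Let_def
    by (rule mmeas_mult[OF mmeas_const[OF J.X] mmeas_mult[OF mmeas_const Y]]) (use J.X J.XX_inv(1) in simp)
  have Dm: "(\<lambda>y. D (Z y) (f y)) \<in> borel_measurable N" if Z: "mmeas N n p Z" and f: "f \<in> measurable N M" for N f Z
  proof -
    note Yf = mmeas_comp[OF Y f] and Sf = mmeas_comp[OF S f]
    have "mmeas N p p (\<lambda>y. inv0 (?S (f y)) * ((Y (f y) - Z y)\<^sup>T * (Y (f y) - Z y)))"
      by (rule mmeas_mult[OF mmeas_inv0[OF Sf] mmeas_mult[OF mmeas_transpose[OF mmeas_minus[OF Yf Z]] mmeas_minus[OF Yf Z]]])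
    from mmeas_mtrace[OF this] mmeas_det[OF Sf] show ?thesis unfolding D_def by measurable
  qed
  have hm: "case_prod h \<in> borel_measurable (M \<Otimes>\<^sub>M ?L)"
  proof -
    have 1: "mmeas (M \<Otimes>\<^sub>M ?L) ?q p (\<lambda>y. ?m (snd y))" by (rule mmeas_comp[OF mmeas_mat]) measurable
    note S1 = mmeas_comp[OF S, of fst "M \<Otimes>\<^sub>M ?L"]
    have 2: "(\<lambda>y. D (?Xj * ?m (snd y)) (fst y)) \<in> borel_measurable (M \<Otimes>\<^sub>M ?L)"
      by (rule Dm[OF mmeas_mult[OF mmeas_const[OF J.X] 1]]) measurable
    have 3: "(\<lambda>y. \<pi> j (?m (snd y) * inv_sqrt0 p (?S (fst y))) (1\<^sub>m p)) \<in> borel_measurable (M \<Otimes>\<^sub>M ?L)"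
    proof (rule smooth_mat_fun_measurable[of ?q p])
      show "smooth_mat_fun ?q p (\<lambda>T. \<pi> j T (1\<^sub>m p))" using prior one by (simp add: prior_density_def)
      show "mmeas (M \<Otimes>\<^sub>M ?L) ?q p (\<lambda>y. ?m (snd y) * inv_sqrt0 p (?S (fst y)))"
        by (rule mmeas_mult[OF 1 mmeas_inv_sqrt0[OF S1]]) measurable
    qed
    have 4: "(\<lambda>y. det (?S (fst y))) \<in> borel_measurable (M \<Otimes>\<^sub>M ?L)" using dS by measurable
    show ?thesis unfolding h_def split_beta' using 2 3 4 by measurable
  qed
  interpret L: sigma_finite_measure ?L by (rule Leb_sigma_finite) simp
  have int: "(\<lambda>x. \<integral>t. h x t \<partial>?L) \<in> borel_measurable M"
    by (rule L.borel_measurable_lebesgue_integral[OF hm])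
  have main: "(\<lambda>x. MPIC_main X (Y x) j) \<in> borel_measurable M" by (rule MPIC_main_measurable[OF dS Y])
  have "(\<lambda>x. MPIC_main X (Y x) j - 2 * ln (if det (?S x) = 0 then w j else (1 - w j) * (\<integral>t. h x t \<partial>?L) / D (?Xj * Theta_hat X (Y x) j) x + w j)) \<in> borel_measurable M"
  proof -
    have [measurable]: "(\<lambda>x. D (?Xj * Theta_hat X (Y x) j) x) \<in> borel_measurable M" by (rule Dm[OF T0]) simp
    note [measurable] = main dS int
    show ?thesis by measurable
  qed
  then show ?thesis
  proof (rule measurable_cong[THEN iffD1, rotated])
    fix x assume x: "x \<in> space M"
    have Yx: "Y x \<in> carrier_mat n p" by (rule mmeasD(1)[OF Y x])
    have dY: "dim_row (Y x) = n" "dim_col (Y x) = p" using Yx by auto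
    have Sx: "?S x \<in> carrier_mat p p" by (rule mmeasD(1)[OF S x])
    show "MPIC_main X (Y x) j - 2 * ln (if det (?S x) = 0 then w j else (1 - w j) * (\<integral>t. h x t \<partial>?L) / D (?Xj * Theta_hat X (Y x) j) x + w j) = MPIC \<pi> w X (Y x) j"
    proof (cases "det (?S x) = 0")
      case True
      then have "\<not> pos_def p (?S x)" using Sigma_hat_pos_def[OF j Yx n] by simp
      then show ?thesis using True by (simp add: MPIC_def marginal_density_def dY)
    next
      case False
      then have pd: "pos_def p (?S x)" using Sigma_hat_pos_def[OF j Yx n] by simp
      have dpos: "det (?S x) > 0" by (rule pos_def_det[OF pd])
      have Dn: "D Z x = normal_mat_density Z (?S x) (Y x)" for Z
        unfolding D_def normal_mat_density_def Let_def dY inv0_minv[OF Sx False] ..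
      have pr: "\<pi> j (?m t * inv_sqrt0 p (?S x)) (1\<^sub>m p) / det (?S x) powr (real ?q / 2) = \<pi> j (?m t) (?S x)" for t
        unfolding inv_sqrt0_eq[OF pd] using P1[of "?m t", OF _ pd] dpos by (simp add: field_simps)
      have "marginal_density (\<pi> j) X j (Y x) (?S x) = (\<integral>t. h x t \<partial>?L)"
        unfolding marginal_density_def Let_def dY h_def Dn pr using pd by simp
      then show ?thesis using False by (simp add: MPIC_def Dn)
    qed
  qed
qed

section \<open>Asymptotics\<close>

lemma ln_ratio_tendsto:
  assumes h: "h \<longlonglongrightarrow> x" and x: "0 \<le> x" "x < 1" and pos: "\<forall>\<^sub>F n in sequentially. h n > 0"
  shows "(\<lambda>n. ln (1 - h n) / h n) \<longlonglongrightarrow> log_ratio x"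
proof (cases "x = 0")
  case False
  then show ?thesis unfolding log_ratio_def using h x by (auto intro!: tendsto_eq_intros)
next
  case True
  have "((\<lambda>y::real. ln (1 - y)) has_real_derivative - 1) (at 0)"
    by (auto intro!: derivative_eq_intros)
  then have "((\<lambda>y::real. ln (1 - y) / y) \<longlongrightarrow> - 1) (at 0)"
    by (simp add: has_field_derivative_iff)
  moreover have "filterlim h (at 0) sequentially"
    using h True pos by (auto simp: filterlim_at elim!: eventually_mono)
  ultimately have "(\<lambda>n. ln (1 - h n) / h n) \<longlonglongrightarrow> - 1" by (rule filterlim_compose)
  then show ?thesis using True by (simp add: log_ratio_def)
qed

lemma log_ratio_perturb:
  assumes c: "0 \<le> c" "c < 1" and e: "b < log_ratio c"
  shows "\<exists>\<delta>>0. (1 + \<delta>) * c < 1 \<and> b < (1 + \<delta>) * log_ratio ((1 + \<delta>) * c)"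
proof -
  define d where "d m = 1 / real (Suc m)" for m
  have d0: "d \<longlonglongrightarrow> 0" unfolding d_def using LIMSEQ_inverse_real_of_nat by (simp add: inverse_eq_divide)
  have h: "(\<lambda>m. (1 + d m) * c) \<longlonglongrightarrow> c" using tendsto_mult[OF tendsto_add[OF tendsto_const d0, of 1] tendsto_const, of c] by simp
  have lim: "(\<lambda>m. log_ratio ((1 + d m) * c)) \<longlonglongrightarrow> log_ratio c"
  proof (cases "c = 0")
    case False
    have pos: "0 < (1 + d m) * c" for m using c False by (auto simp: d_def add_pos_pos)
    have "(\<lambda>m. ln (1 - (1 + d m) * c) / ((1 + d m) * c)) \<longlonglongrightarrow> log_ratio c"
      by (rule ln_ratio_tendsto[OF h c]) (use pos in simp)
    moreover have "log_ratio ((1 + d m) * c) = ln (1 - (1 + d m) * c) / ((1 + d m) * c)" for m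
      using pos[of m] by (auto simp: log_ratio_def)
    ultimately show ?thesis by simp
  qed simp
  have "(\<lambda>m. (1 + d m) * log_ratio ((1 + d m) * c)) \<longlonglongrightarrow> log_ratio c"
    using tendsto_mult[OF tendsto_add[OF tendsto_const d0, of 1] lim] by simp
  from order_tendstoD(1)[OF this e] order_tendstoD(2)[OF h c(2)]
  have "\<forall>\<^sub>F m in sequentially. (1 + d m) * c < 1 \<and> b < (1 + d m) * log_ratio ((1 + d m) * c)"
    by eventually_elim simp
  then obtain m where "(1 + d m) * c < 1" "b < (1 + d m) * log_ratio ((1 + d m) * c)"
    by (auto simp: eventually_sequentially)
  then show ?thesis by (intro exI[of _ "d m"]) (simp add: d_def)
qed

definition penalty :: "nat \<Rightarrow> nat \<Rightarrow> nat \<Rightarrow> real" where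
  "penalty n p q = real n * real p * (2 * real q + real p + 1) / (real n - real p - real q - 1)"

locale dims =
  fixes k :: nat and p :: "nat \<Rightarrow> nat" and c0 :: real
  assumes mono_p: "mono p" and p1: "\<And>n. 1 \<le> p n" and ratio: "(\<lambda>n. real (p n) / real n) \<longlonglongrightarrow> c0"
    and c0: "0 \<le> c0" "c0 < 1"
begin

lemma inverse_n: "(\<lambda>n. a / real n) \<longlonglongrightarrow> 0"
  by (rule lim_const_over_n)

lemma eventually_room: "\<forall>\<^sub>F n in sequentially. p n + q \<le> n"
proof -
  have "(\<lambda>n. real (p n) / real n + real q / real n) \<longlonglongrightarrow> c0 + 0"
    by (intro tendsto_add ratio inverse_n)
  then have "\<forall>\<^sub>F n in sequentially. real (p n) / real n + real q / real n < 1"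
    using c0 by (intro order_tendstoD) auto
  then show ?thesis using eventually_gt_at_top[of 0]
  proof eventually_elim
    case (elim n)
    then have "real (p n) + real q < real n" by (simp add: field_simps)
    then show ?case by linarith
  qed
qed

lemma p_at_top: "\<not> bdd_above (range p) \<Longrightarrow> filterlim (\<lambda>n. real (p n)) at_top sequentially"
proof -
  assume "\<not> bdd_above (range p)"
  then have "\<exists>n. N \<le> p n" for N by (metis bdd_above.I2 linear)
  then have "filterlim p at_top sequentially"
    unfolding filterlim_at_top eventually_sequentially using mono_p by (meson monoD order_trans)
  then show ?thesis by (rule filterlim_compose[OF filterlim_real_sequentially])
qed

lemma leverage_bound_tendsto: "(\<lambda>n. a * real (p n) / real (n - q)) \<longlonglongrightarrow> a * c0"
proof -
  have "(\<lambda>n. a * (real (p n) / real n) / (1 - real q / real n)) \<longlonglongrightarrow> a * c0 / (1 - 0)"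
    by (intro tendsto_intros ratio inverse_n) auto
  moreover have "\<forall>\<^sub>F n in sequentially. a * (real (p n) / real n) / (1 - real q / real n) = a * real (p n) / real (n - q)"
    using eventually_gt_at_top[of q] by eventually_elim (simp add: field_simps of_nat_diff)
  ultimately show ?thesis by (auto intro: Lim_transform_eventually)
qed

lemma ln_leverage_tendsto:
  assumes d: "\<delta> > 0" "(1 + \<delta>) * c0 < 1"
  shows "(\<lambda>n. real n * ln (1 - (1 + \<delta>) * real (p n) / real (n - q)) / real (p n)) \<longlonglongrightarrow> (1 + \<delta>) * log_ratio ((1 + \<delta>) * c0)"
proof -
  define h where "h n = (1 + \<delta>) * real (p n) / real (n - q)" for n
  have h: "h \<longlonglongrightarrow> (1 + \<delta>) * c0" unfolding h_def by (rule leverage_bound_tendsto)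
  have hpos: "\<forall>\<^sub>F n in sequentially. h n > 0"
    using eventually_gt_at_top[of q]
  proof eventually_elim
    case (elim n)
    then show ?case using p1[of n] d by (simp add: h_def)
  qed
  have 1: "(\<lambda>n. ln (1 - h n) / h n) \<longlonglongrightarrow> log_ratio ((1 + \<delta>) * c0)"
    by (rule ln_ratio_tendsto[OF h _ d(2) hpos]) (use d c0 in simp)
  have "(\<lambda>n. (1 + \<delta>) / (1 - real q / real n)) \<longlonglongrightarrow> (1 + \<delta>) / (1 - 0)"
    by (intro tendsto_intros inverse_n) auto
  then have 2: "(\<lambda>n. (1 + \<delta>) / (1 - real q / real n)) \<longlonglongrightarrow> 1 + \<delta>" by simp
  have "\<forall>\<^sub>F n in sequentially. (1 + \<delta>) / (1 - real q / real n) * (ln (1 - h n) / h n) = real n * ln (1 - h n) / real (p n)"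
    using eventually_gt_at_top[of q]
  proof eventually_elim
    case (elim n)
    have "real (p n) > 0" "real n - real q > 0" using p1[of n] elim by auto
    moreover have "(1 + \<delta>) / (1 - Q / N) * (L / ((1 + \<delta>) * q' / (N - Q))) = N * L / q'"
      if "q' > 0" "N - Q > 0" "N > 0" for L N Q q' :: real
    proof -
      define e where "e = 1 + \<delta>"
      have "1 - Q / N = (N - Q) / N" using that by (simp add: field_simps)
      moreover have "e > 0" using d by (simp add: e_def)
      ultimately show ?thesis using that unfolding e_def[symmetric] by simp
    qed
    moreover have "h n = (1 + \<delta>) * real (p n) / (real n - real q)" using elim by (simp add: h_def of_nat_diff)
    ultimately show ?case using elim by simp
  qed
  from Lim_transform_eventually[OF tendsto_mult[OF 2 1] this] show ?thesis by (simp add: h_def)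
qed

lemma penalty_diff_tendsto:
  "(\<lambda>n. (penalty n (p n) a - penalty n (p n) b) / real (p n)) \<longlonglongrightarrow> (real a - real b) * ((2 - c0) / (1 - c0)\<^sup>2)"
proof -
  have "(\<lambda>n. (real a - real b) * (2 * (1 - real (p n) / real n - 1 / real n) + real (p n) / real n + 1 / real n)
      / ((1 - real (p n) / real n - (real a + 1) / real n) * (1 - real (p n) / real n - (real b + 1) / real n)))
    \<longlonglongrightarrow> (real a - real b) * (2 * (1 - c0 - 0) + c0 + 0) / ((1 - c0 - 0) * (1 - c0 - 0))"
    using c0 by (intro tendsto_intros ratio inverse_n) auto
  moreover have "(real a - real b) * (2 * (1 - c0 - 0) + c0 + 0) / ((1 - c0 - 0) * (1 - c0 - 0)) = (real a - real b) * ((2 - c0) / (1 - c0)\<^sup>2)"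
    by (simp add: power2_eq_square)
  moreover have "\<forall>\<^sub>F n in sequentially. (real a - real b) * (2 * (1 - real (p n) / real n - 1 / real n) + real (p n) / real n + 1 / real n)
      / ((1 - real (p n) / real n - (real a + 1) / real n) * (1 - real (p n) / real n - (real b + 1) / real n))
    = (penalty n (p n) a - penalty n (p n) b) / real (p n)"
    using eventually_room[of "a + b + 2"]
  proof eventually_elim
    case (elim n)
    define N q where "N = real n" and "q = real (p n)"
    have pos: "q > 0" "N > 0" "N - q - real a - 1 > 0" "N - q - real b - 1 > 0"
      using p1[of n] elim by (auto simp: N_def q_def)
    have 1: "1 - q / N - (x + 1) / N = (N - q - x - 1) / N" for x using pos by (simp add: field_simps)
    have 2: "2 * (1 - q / N - 1 / N) + q / N + 1 / N = (2 * (N - q - 1) + q + 1) / N" using pos by (simp add: field_simps)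
    have "(penalty n (p n) a - penalty n (p n) b) / q = N * ((2 * real a + q + 1) / (N - q - real a - 1) - (2 * real b + q + 1) / (N - q - real b - 1))"
    proof -
      have "(N * q * x / y - N * q * x' / y') / q = N * (x / y - x' / y')" for x y x' y'
        using pos(1) by (simp add: diff_divide_distrib right_diff_distrib)
      then show ?thesis unfolding penalty_def N_def[symmetric] q_def[symmetric] .
    qed
    also have "(2 * real a + q + 1) / (N - q - real a - 1) - (2 * real b + q + 1) / (N - q - real b - 1)
      = (real a - real b) * (2 * (N - q - 1) + q + 1) / ((N - q - real a - 1) * (N - q - real b - 1))"
      using pos(3,4) by (simp add: diff_frac_eq) (simp add: algebra_simps)
    also have "N * \<dots> = (real a - real b) * ((2 * (N - q - 1) + q + 1) / N) / (((N - q - real a - 1) / N) * ((N - q - real b - 1) / N))"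
      using pos(2) by simp
    finally show ?case unfolding N_def[symmetric] q_def[symmetric] 1 2 by simp
  qed
  ultimately show ?thesis by (auto intro: Lim_transform_eventually)
qed

end

lemma mmeas_cong: "(\<And>x. x \<in> space M \<Longrightarrow> A x = B x) \<Longrightarrow> mmeas M r c A \<longleftrightarrow> mmeas M r c B"
  by (simp add: mmeas_def cong: measurable_cong)

context regression
begin

lemma Y_measurable: "mmeas P n p Y"
proof -
  obtain c where "gaussian_matrix P n p (\<lambda>x. Y x - M) S c" using noise by blast
  from mmeas_add[OF mmeas_const[OF M] gaussian_matrix.E[OF this]]
  have "mmeas P n p (\<lambda>x. M + (Y x - M))" .
  moreover have "M + (Y x - M) = Y x" if "x \<in> space P" for x
    using M Y_carrier[OF that] by (intro eq_matI) auto
  ultimately show ?thesis by (simp cong: mmeas_cong)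
qed

lemma rdet_measurable: "j \<subseteq> {..<k} \<Longrightarrow> rdet j \<in> borel_measurable P"
proof -
  assume j: "j \<subseteq> {..<k}"
  have "mmeas P p p (\<lambda>x. (Y x)\<^sup>T * resid_mat j * Y x)"
    by (rule mmeas_mult[OF mmeas_mult[OF mmeas_transpose[OF Y_measurable] mmeas_const] Y_measurable])
      (rule orth_projection.Q(1)[OF resid_mat(1)[OF j]])
  from mmeas_det[OF this] show ?thesis unfolding rdet_def[abs_def] .
qed

lemma AE_rdet_pos: "jst \<subseteq> j \<Longrightarrow> j \<subseteq> {..<k} \<Longrightarrow> p + k \<le> n \<Longrightarrow> AE x in P. rdet j x > 0"
proof -
  assume j: "jst \<subseteq> j" "j \<subseteq> {..<k}" and pn: "p + k \<le> n"
  from nested_gram[OF subset_refl j(2) j(1)] obtain U B B' c where UO: "orth n U" and B: "B \<subseteq> {..<n}" "B' \<subseteq> B"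
    and card: "card B = n - card j" "card B' = n - card j"
    and g: "gaussian_matrix P n p (\<lambda>x. U\<^sup>T * (Y x - M)) S c"
    and "resid_mat j = spectral n U (indicator B)"
    and "\<forall>x\<in>space P. rdet j x = det (gram (U\<^sup>T * M + U\<^sup>T * (Y x - M)) B)"
    and rl: "\<forall>x\<in>space P. rdet j x = det (gram (U\<^sup>T * (Y x - M)) B')"
    and "\<forall>i\<in>B'. \<forall>z. mv (U\<^sup>T * M) z i = 0"
    and "jst \<subseteq> j \<longrightarrow> (\<forall>x\<in>space P. rdet j x = det (gram (U\<^sup>T * (Y x - M)) B))"
    .
  interpret G: gaussian_matrix P n p "\<lambda>x. U\<^sup>T * (Y x - M)" S c by fact
  have B': "B' \<subseteq> {..<n}" using B by auto
  have "p \<le> card B'" using card(2) card_le[OF j(2)] pn by linarith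
  from G.AE_gram_nonsingular[OF B' this] AE_space show ?thesis
  proof eventually_elim
    case (elim x)
    have "finite B'" by (rule finite_subset[OF B']) simp
    from gram_pos_def(2)[OF mmeasD(1)[OF G.E elim(2)] this elim(1)] show ?case using rl elim(2) by simp
  qed
qed

end

locale model_sequence = dims k p c0 for k :: nat and p :: "nat \<Rightarrow> nat" and c0 :: real +
  fixes jst :: "nat set" and X \<Theta> \<Sigma> :: "nat \<Rightarrow> real mat" and P :: "nat \<Rightarrow> 'a measure" and Y :: "nat \<Rightarrow> 'a \<Rightarrow> real mat"
  assumes reg: "\<And>n. n > k \<Longrightarrow> regression n k (X n) (P n) (p n) jst (\<Theta> n) (\<Sigma> n) (Y n)"
begin

definition "rd n j x = regression.rdet n (X n) (Y n) j x"

definition "bad n j l b = {x\<in>space (P n). ln (rd n l x) < ln (rd n j x) + b}"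

lemma rd_measurable: "n > k \<Longrightarrow> j \<subseteq> {..<k} \<Longrightarrow> rd n j \<in> borel_measurable (P n)"
  unfolding rd_def[abs_def] by (rule regression.rdet_measurable[OF reg])

lemma bad_sets: "n > k \<Longrightarrow> j \<subseteq> {..<k} \<Longrightarrow> l \<subseteq> {..<k} \<Longrightarrow> bad n j l b \<in> sets (P n)"
proof -
  assume a: "n > k" "j \<subseteq> {..<k}" "l \<subseteq> {..<k}"
  note [measurable] = rd_measurable[OF a(1,2)] rd_measurable[OF a(1,3)]
  show ?thesis unfolding bad_def by measurable
qed

lemma overfit_unbounded:
  assumes unb: "\<not> bdd_above (range p)" and d: "\<delta> > 0" "(1 + \<delta>) * c0 < 1" and j: "jst \<subseteq> j" "j \<subseteq> l" "l \<subseteq> {..<k}" and e: "\<epsilon> > 0"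
  shows "\<forall>\<^sub>F n in sequentially. measure (P n) (bad n j l ((real (card l) - real (card j)) * ln (1 - (1 + \<delta>) * real (p n) / real (n - k)))) \<le> \<epsilon>"
proof -
  define K where "K = real (2 ^ k * k) + 1"
  have K: "K > 0" "real (2 ^ k * k) \<le> K" by (auto simp: K_def intro: add_nonneg_pos)
  have "(\<lambda>n. 2 / \<delta>\<^sup>2 / real (p n)) \<longlonglongrightarrow> 0"
    by (rule real_tendsto_divide_at_top[OF tendsto_const p_at_top[OF unb]])
  then have "\<forall>\<^sub>F n in sequentially. 2 / \<delta>\<^sup>2 / real (p n) < \<epsilon> / K" using e K by (intro order_tendstoD) auto
  moreover have "\<forall>\<^sub>F n in sequentially. (1 + \<delta>) * real (p n) / real (n - k) < 1"
    by (rule order_tendstoD(2)[OF leverage_bound_tendsto d(2)])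
  ultimately show ?thesis using eventually_room[of k] eventually_gt_at_top[of k]
  proof eventually_elim
    case (elim n)
    interpret regression n k "X n" "P n" "p n" jst "\<Theta> n" "\<Sigma> n" "Y n" by (rule reg) fact
    let ?h = "(1 + \<delta>) * real (p n) / real (n - k)"
    have "measure (P n) (bad n j l ((real (card l) - real (card j)) * ln (1 - ?h))) \<le> real (2 ^ k * k) * (2 / (\<delta>\<^sup>2 * real (p n)))"
      unfolding bad_def rd_def
    proof (rule rdet_overfit[OF j])
      show "0 < ?h" using p1[of n] d elim by simp
      fix N assume N: "n - k \<le> N"
      have "(1 + \<delta>) * real (p n) / real N \<le> ?h" using N d elim by (intro divide_left_mono) auto
      then show "real (p n) / (real N * ?h) \<le> 2 / (\<delta>\<^sup>2 * real (p n)) \<or> (\<exists>\<delta>'::real. \<delta>' > 0 \<and> (1 + \<delta>') * real (p n) / real N \<le> ?h \<and> 2 / (\<delta>'\<^sup>2 * real (p n)) \<le> 2 / (\<delta>\<^sup>2 * real (p n)))"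
        using d by blast
    qed (use elim in auto)
    also have "\<dots> \<le> K * (\<epsilon> / K)"
    proof (rule mult_mono[OF K(2)])
      show "2 / (\<delta>\<^sup>2 * real (p n)) \<le> \<epsilon> / K" using elim by simp
    qed (use K in auto)
    finally show ?case using K by simp
  qed
qed

lemma bounded_obtain:
  assumes "bdd_above (range p)" obtains b where "\<And>n. real (p n) \<le> b" "b > 0"
proof -
  obtain B where "\<And>n. p n \<le> B" using assms by (auto simp: bdd_above_def)
  then have "real (p n) \<le> real B" for n by simp
  moreover have "real B > 0" using p1[of 0] calculation[of 0] by linarith
  ultimately show thesis using that by blast
qed

lemma overfit_bounded:
  assumes bdd: "bdd_above (range p)" and j: "jst \<subseteq> j" "j \<subseteq> l" "l \<subseteq> {..<k}" and e: "\<epsilon> > 0"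
  shows "\<exists>b. \<forall>\<^sub>F n in sequentially. measure (P n) (bad n j l (- b / real n)) \<le> \<epsilon>"
proof -
  obtain m where m: "\<And>n. real (p n) \<le> m" "m > 0" using bounded_obtain[OF bdd] by blast
  define K where "K = real (2 ^ k * k) + 1"
  have K: "K > 0" "real (2 ^ k * k) \<le> K" by (auto simp: K_def intro: add_nonneg_pos)
  define \<eta> where "\<eta> = \<epsilon> / K"
  have \<eta>: "\<eta> > 0" using e K by (simp add: \<eta>_def)
  define d where "d = real (card l) - real (card j)"
  have fl: "finite l" using j finite_subset by blast
  have d: "d \<ge> 0" using card_mono[OF fl j(2)] by (simp add: d_def)
  define h where "h n = real (p n) / \<eta> / real (n - k)" for n
  define b where "b = 4 * d * m / \<eta>"
  have lev: "(\<lambda>n. (1 / \<eta>) * real (p n) / real (n - k)) \<longlonglongrightarrow> (1 / \<eta>) * c0" by (rule leverage_bound_tendsto)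
  have "(\<lambda>n. m / \<eta> / real (n - k)) \<longlonglongrightarrow> 0"
  proof (rule real_tendsto_divide_at_top[OF tendsto_const])
    show "filterlim (\<lambda>n. real (n - k)) at_top sequentially"
      by (rule filterlim_compose[OF filterlim_real_sequentially filterlim_minus_const_nat_at_top])
  qed
  then have "\<forall>\<^sub>F n in sequentially. m / \<eta> / real (n - k) < 1 / 2" by (intro order_tendstoD) auto
  then have "\<forall>\<^sub>F n in sequentially. measure (P n) (bad n j l (- b / real n)) \<le> \<epsilon>"
    using eventually_room[of k] eventually_gt_at_top[of "2 * k"]
  proof eventually_elim
    case (elim n)
    then have nk: "n > k" "real (n - k) > 0" "real n \<le> 2 * real (n - k)" by auto
    interpret regression n k "X n" "P n" "p n" jst "\<Theta> n" "\<Sigma> n" "Y n" by (rule reg) (use nk in simp)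
    have hm: "h n \<le> m / \<eta> / real (n - k)" unfolding h_def using m \<eta> by (intro divide_right_mono) auto
    have h0: "h n > 0" unfolding h_def using p1[of n] \<eta> nk by simp
    have h1: "h n < 1 / 2" by (rule le_less_trans[OF hm elim(1)])
    have "- b / real n \<le> d * ln (1 - h n)"
    proof -
      have "- 2 * h n \<le> ln (1 - h n)"
      proof -
        have "ln (1 - h n) \<ge> - h n - 2 * (h n)\<^sup>2" by (rule ln_one_minus_pos_lower_bound) (use h0 h1 in auto)
        moreover have "2 * (h n)\<^sup>2 \<le> h n" using h0 h1 by (simp add: power2_eq_square)
        ultimately show ?thesis by linarith
      qed
      moreover have "2 * h n \<le> 4 * m / \<eta> / real n"
      proof -
        have "2 * h n \<le> 2 * (m / \<eta> / real (n - k))" using hm by simp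
        also have "\<dots> \<le> 2 * (m / \<eta> / (real n / 2))" using m \<eta> nk by (intro mult_left_mono divide_left_mono) auto
        finally show ?thesis by simp
      qed
      ultimately have "- (4 * m / \<eta> / real n) \<le> ln (1 - h n)" by linarith
      from mult_left_mono[OF this d] show ?thesis by (simp add: b_def mult_ac)
    qed
    then have "measure (P n) (bad n j l (- b / real n)) \<le> measure (P n) (bad n j l (d * ln (1 - h n)))"
    proof (intro finite_measure_mono)
      show "bad n j l (d * ln (1 - h n)) \<in> events" by (rule bad_sets) (use nk j in auto)
    qed (auto simp: bad_def)
    also have "\<dots> \<le> real (2 ^ k * k) * \<eta>"
      unfolding bad_def rd_def d_def
    proof (rule rdet_overfit[OF j])
      fix N assume N: "n - k \<le> N"
      have "real (p n) / (real N * h n) \<le> real (p n) / (real (n - k) * h n)"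
        using N nk h0 by (intro divide_left_mono mult_right_mono) auto
      also have "\<dots> = \<eta>" using nk p1[of n] \<eta> by (simp add: h_def)
      finally show "real (p n) / (real N * h n) \<le> \<eta> \<or> (\<exists>\<delta>'::real. \<delta>' > 0 \<and> (1 + \<delta>') * real (p n) / real N \<le> h n \<and> 2 / (\<delta>'\<^sup>2 * real (p n)) \<le> \<eta>)"
        by blast
    qed (use elim h0 h1 in auto)
    also have "\<dots> \<le> K * \<eta>" using K \<eta> by (intro mult_right_mono) auto
    also have "\<dots> = \<epsilon>" using K by (simp add: \<eta>_def)
    finally show ?case .
  qed
  then show ?thesis by blast
qed

end

context model_sequence
begin

lemma prob_P: "n > k \<Longrightarrow> prob_space (P n)"
  using reg[unfolded regression_def] by blast

text \<open>Here \<open>v n\<close> stands for \<open>log (w\<^sub>* / w\<^sub>j)\<close>, so that \<open>gap v n j\<close> is almost surely the difference of \<open>MPIC_Approx\<close> at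
  \<open>j\<close> and at the true model.\<close>

definition "gap v n j x = real n * (ln (rd n j x) - ln (rd n jst x))
  + (penalty n (p n) (card j) - penalty n (p n) (card jst)) + 2 * v n"

lemma gap_measurable: "n > k \<Longrightarrow> j \<subseteq> {..<k} \<Longrightarrow> jst \<subseteq> {..<k} \<Longrightarrow> gap v n j \<in> borel_measurable (P n)"
proof -
  assume a: "n > k" "j \<subseteq> {..<k}" "jst \<subseteq> {..<k}"
  note [measurable] = rd_measurable[OF a(1,2)] rd_measurable[OF a(1,3)]
  show ?thesis unfolding gap_def[abs_def] by measurable
qed

definition "ahead v n j C x \<longleftrightarrow> 0 < rd n j x \<and> 0 < rd n jst x \<and> C < gap v n j x"

lemma ahead_sets:
  "n > k \<Longrightarrow> j \<subseteq> {..<k} \<Longrightarrow> jst \<subseteq> {..<k} \<Longrightarrow> {x\<in>space (P n). \<not> ahead v n j C x} \<in> sets (P n)"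
proof -
  assume a: "n > k" "j \<subseteq> {..<k}" "jst \<subseteq> {..<k}"
  note [measurable] = rd_measurable[OF a(1,2)] rd_measurable[OF a(1,3)] gap_measurable[OF a]
  show ?thesis unfolding ahead_def by measurable
qed

lemma gap_large:
  fixes \<epsilon>1 \<epsilon>2 :: real
  assumes j: "j \<subseteq> {..<k}" and l: "jst \<subseteq> l" "l \<subseteq> {..<k}" and a: "\<And>n. a n > 0"
    and under: "\<forall>\<^sub>F n in sequentially. measure (P n) {x\<in>space (P n). rd n j x < a n * rd n l x} \<le> \<epsilon>1"
    and over: "\<forall>\<^sub>F n in sequentially. measure (P n) (bad n jst l (b n)) \<le> \<epsilon>2"
    and lim: "filterlim (\<lambda>n. real n * (ln (a n) + b n) + (penalty n (p n) (card j) - penalty n (p n) (card jst)) + 2 * v n)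
      at_top sequentially"
  shows "\<forall>\<^sub>F n in sequentially. measure (P n) {x\<in>space (P n). \<not> ahead v n j C x} \<le> \<epsilon>1 + \<epsilon>2"
  using under over lim[unfolded filterlim_at_top_dense, rule_format, of C] eventually_gt_at_top[of k] eventually_room[of k]
proof eventually_elim
  case (elim n)
  interpret regression n k "X n" "P n" "p n" jst "\<Theta> n" "\<Sigma> n" "Y n" by (rule reg) fact
  let ?F = "{x\<in>space (P n). rd n j x < a n * rd n l x}" and ?G = "bad n jst l (b n)"
  have jst: "jst \<subseteq> {..<k}" using l by blast
  note [measurable] = rd_measurable[OF elim(4) j] rd_measurable[OF elim(4) l(2)]
  have F: "?F \<in> events" by measurable
  have G: "?G \<in> events" by (rule bad_sets) (use elim jst l in auto)
  have "AE x in P n. rd n l x > 0" "AE x in P n. rd n jst x > 0"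
    unfolding rd_def by (rule AE_rdet_pos; use l elim in auto)+
  then have "AE x in P n. rd n l x > 0 \<and> rd n jst x > 0" by eventually_elim simp
  then have "AE x in P n. x \<in> {x\<in>space (P n). \<not> ahead v n j C x} \<longrightarrow> x \<in> ?F \<union> ?G"
  proof (rule AE_mp, intro AE_I2 impI)
    fix x assume x: "x \<in> space (P n)" "rd n l x > 0 \<and> rd n jst x > 0" "x \<in> {x\<in>space (P n). \<not> ahead v n j C x}"
    show "x \<in> ?F \<union> ?G"
    proof (rule ccontr)
      assume "\<not> ?thesis"
      then have *: "rd n j x \<ge> a n * rd n l x" "ln (rd n l x) \<ge> ln (rd n jst x) + b n" using x by (auto simp: bad_def)
      have pos: "0 < rd n j x" using * a[of n] x by (auto intro: less_le_trans[of 0 "a n * rd n l x"])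
      then have "ln (a n * rd n l x) \<le> ln (rd n j x)" using * a[of n] x by (subst ln_le_cancel_iff) auto
      then have "ln (a n) + b n \<le> ln (rd n j x) - ln (rd n jst x)" using * a[of n] x by (simp add: ln_mult)
      then have "real n * (ln (a n) + b n) \<le> real n * (ln (rd n j x) - ln (rd n jst x))" by (intro mult_left_mono) auto
      then show False using elim(3) x(2,3) pos by (simp add: gap_def ahead_def)
    qed
  qed
  then have "measure (P n) {x\<in>space (P n). \<not> ahead v n j C x} \<le> measure (P n) (?F \<union> ?G)"
    by (rule finite_measure_mono_AE) (use F G in auto)
  also have "\<dots> \<le> measure (P n) ?F + measure (P n) ?G" by (rule measure_Un_le[OF F G])
  finally show ?case using elim by linarith
qed

lemma underfit:
  fixes c \<epsilon> :: real
  assumes j: "j \<subseteq> {..<k}" and e: "\<epsilon> > 0"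
    and \<Gamma>: "\<And>n. n > k \<Longrightarrow> G n \<in> carrier_mat (p n) g \<and> G n * (G n)\<^sup>T = noncentrality (X n) jst (\<Theta> n) (\<Sigma> n) j"
    and c: "c > 0" "\<forall>\<^sub>F n in sequentially. c * (real n * real (p n)) \<le> min_eigenvalue ((G n)\<^sup>T * G n)"
  obtains c' where "c' > 0" "\<forall>\<^sub>F n in sequentially. measure (P n) {x\<in>space (P n). rd n j x < (1 + c' * real (p n)) ^ g * rd n (j \<union> jst) x} \<le> \<epsilon>"
proof -
  define a where "a = 16 * (real g + 1) / \<epsilon>"
  define C' where "C' = 16 * (real g * real k + 1) / \<epsilon>"
  define c' where "c' = c / (4 * a)"
  have a: "a > 0" and C': "C' > 0" using e by (auto simp: a_def C'_def intro!: divide_pos_pos add_nonneg_pos)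
  have c': "c' > 0" using a c by (simp add: c'_def)
  have "\<forall>\<^sub>F n in sequentially. measure (P n) {x\<in>space (P n). rd n j x < (1 + c' * real (p n)) ^ g * rd n (j \<union> jst) x} \<le> \<epsilon>"
    using c(2) eventually_gt_at_top[of k] eventually_room[of k] eventually_ge_at_top[of "nat \<lceil>4 * C' / c\<rceil>"]
  proof eventually_elim
    case (elim n)
    interpret regression n k "X n" "P n" "p n" jst "\<Theta> n" "\<Sigma> n" "Y n" by (rule reg) fact
    have n: "real n > 0" using elim by simp
    have np: "c * (real n * real (p n)) \<ge> 4 * C'"
    proof -
      have "real n \<ge> 4 * C' / c" using elim(4) by linarith
      then have "4 * C' \<le> c * real n" using c by (simp add: field_simps)
      also have "\<dots> \<le> c * (real n * real (p n))" using c p1[of n] n by simp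
      finally show ?thesis .
    qed
    have "measure (P n) {x\<in>space (P n). rd n j x < (1 + c' * real (p n)) ^ g * rd n (j \<union> jst) x} \<le> 8 * g * n / (n * a) + 8 * g * k / C'"
      unfolding rd_def
    proof (rule rdet_underfit[OF j])
      show "c * (real n * real (p n)) / 2 - C' \<ge> c' * real (p n) * (real n * a)"
        using np a by (simp add: c'_def)
      show "c * (real n * real (p n)) > 0" using c n p1[of n] by simp
    qed (use elim \<Gamma> c' a n C' in auto)
    also have "8 * g * n / (n * a) \<le> \<epsilon> / 2"
    proof -
      have "8 * g * n / (n * a) = 8 * real g / a" using n by simp
      also have "\<dots> = \<epsilon> / 2 * (real g / (real g + 1))" using e by (simp add: a_def field_simps)
      also have "\<dots> \<le> \<epsilon> / 2 * 1" using e by (intro mult_left_mono) auto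
      finally show ?thesis by simp
    qed
    also have "8 * g * k / C' \<le> \<epsilon> / 2"
    proof -
      have pos: "real g * real k + 1 > 0" by (simp add: add_nonneg_pos)
      have "8 * g * k / C' = \<epsilon> / 2 * (real g * real k / (real g * real k + 1))" using e pos by (simp add: C'_def field_simps)
      also have "\<dots> \<le> \<epsilon> / 2 * 1" using e pos by (intro mult_left_mono) auto
      finally show ?thesis by simp
    qed
    finally show ?case by simp
  qed
  with c' show ?thesis by (rule that)
qed

lemma gap_overfit_unbounded:
  fixes C \<epsilon> :: real
  assumes unb: "\<not> bdd_above (range p)" and j: "jst \<subseteq> j" "j \<noteq> jst" "j \<subseteq> {..<k}" and e: "\<epsilon> > 0"
    and L: "(\<lambda>n. ereal (v n / real (p n))) \<longlonglongrightarrow> L"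
      "L > ereal (- (1 / 2) * (real (card j) - real (card jst)) * (log_ratio c0 + (2 - c0) / (1 - c0)\<^sup>2))"
  shows "\<forall>\<^sub>F n in sequentially. measure (P n) {x\<in>space (P n). \<not> ahead v n j C x} \<le> \<epsilon>"
proof -
  define d where "d = real (card j) - real (card jst)"
  have "card jst < card j" using j by (intro psubset_card_mono finite_subset[OF j(3)]) auto
  then have d: "d > 0" by (simp add: d_def)
  define K where "K = (2 - c0) / (1 - c0)\<^sup>2"
  obtain r where r: "- (1 / 2) * d * (log_ratio c0 + K) < r" "ereal r < L"
    using ereal_dense2[OF L(2)] by (auto simp: d_def K_def)
  have rv: "\<forall>\<^sub>F n in sequentially. r < v n / real (p n)"
    using order_tendstoD(1)[OF L(1) r(2)] by simp
  have "- 2 * r / d - K < log_ratio c0" using r(1) d by (simp add: field_simps)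
  from log_ratio_perturb[OF c0 this] obtain \<delta> where \<delta>: "\<delta> > 0" "(1 + \<delta>) * c0 < 1"
    "- 2 * r / d - K < (1 + \<delta>) * log_ratio ((1 + \<delta>) * c0)" by blast
  define b where "b n = d * ln (1 - (1 + \<delta>) * real (p n) / real (n - k))" for n
  define f where "f n = d * (real n * ln (1 - (1 + \<delta>) * real (p n) / real (n - k)) / real (p n))
    + (penalty n (p n) (card j) - penalty n (p n) (card jst)) / real (p n) + 2 * r" for n
  have f: "f \<longlonglongrightarrow> d * ((1 + \<delta>) * log_ratio ((1 + \<delta>) * c0)) + d * K + 2 * r"
    unfolding f_def using ln_leverage_tendsto[OF \<delta>(1,2)] penalty_diff_tendsto[of "card j" "card jst"]
    by (intro tendsto_intros) (auto simp: d_def K_def)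
  have pos: "d * ((1 + \<delta>) * log_ratio ((1 + \<delta>) * c0)) + d * K + 2 * r > 0"
  proof -
    have "d * (- 2 * r / d - K) < d * ((1 + \<delta>) * log_ratio ((1 + \<delta>) * c0))" using \<delta>(3) d by simp
    then show ?thesis using d by (simp add: algebra_simps)
  qed
  have lim: "filterlim (\<lambda>n. f n * real (p n)) at_top sequentially"
    by (rule filterlim_tendsto_pos_mult_at_top[OF f pos p_at_top[OF unb]])
  have "\<forall>\<^sub>F n in sequentially. measure (P n) {x\<in>space (P n). \<not> ahead v n j C x} \<le> 0 + \<epsilon>"
  proof (rule gap_large[OF j(3,1,3), where a="\<lambda>n. 1" and b=b])
    show "\<forall>\<^sub>F n in sequentially. measure (P n) (bad n jst j (b n)) \<le> \<epsilon>"
      unfolding b_def d_def by (rule overfit_unbounded[OF unb \<delta>(1,2) _ j(1,3) e]) simp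
    show "filterlim (\<lambda>n. real n * (ln 1 + b n) + (penalty n (p n) (card j) - penalty n (p n) (card jst)) + 2 * v n) at_top sequentially"
      using lim
    proof (rule filterlim_at_top_mono)
      show "\<forall>\<^sub>F n in sequentially. f n * real (p n) \<le> real n * (ln 1 + b n) + (penalty n (p n) (card j) - penalty n (p n) (card jst)) + 2 * v n"
        using rv
      proof eventually_elim
        case (elim n)
        have pn: "real (p n) > 0" using p1[of n] by simp
        have "f n * real (p n) = real n * b n + (penalty n (p n) (card j) - penalty n (p n) (card jst)) + 2 * (r * real (p n))"
          using pn by (simp add: f_def b_def distrib_right)
        also have "r * real (p n) \<le> v n" using elim pn by (simp add: field_simps)
        finally show ?case by simp
      qed
    qed
  qed auto
  then show ?thesis by simp
qed

lemma gap_overfit_bounded: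
  fixes C \<epsilon> :: real
  assumes bdd: "bdd_above (range p)" and j: "jst \<subseteq> j" "j \<noteq> jst" "j \<subseteq> {..<k}" and e: "\<epsilon> > 0"
    and L: "filterlim v at_top sequentially"
  shows "\<forall>\<^sub>F n in sequentially. measure (P n) {x\<in>space (P n). \<not> ahead v n j C x} \<le> \<epsilon>"
proof -
  obtain m where m: "\<And>n. real (p n) \<le> m" "m > 0" using bounded_obtain[OF bdd] by blast
  obtain b where b: "\<forall>\<^sub>F n in sequentially. measure (P n) (bad n jst j (- b / real n)) \<le> \<epsilon>"
    using overfit_bounded[OF bdd _ j(1,3) e] by blast
  have cd: "real (card jst) \<le> real (card j)" using card_mono[OF finite_subset[OF j(3)] j(1)] by simp
  have pen: "\<forall>\<^sub>F n in sequentially. - 1 < (penalty n (p n) (card j) - penalty n (p n) (card jst)) / real (p n)"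
  proof (rule order_tendstoD(1)[OF penalty_diff_tendsto])
    have "0 \<le> (real (card j) - real (card jst)) * ((2 - c0) / (1 - c0)\<^sup>2)" using cd c0 by (intro mult_nonneg_nonneg) auto
    then show "- 1 < (real (card j) - real (card jst)) * ((2 - c0) / (1 - c0)\<^sup>2)" by linarith
  qed
  have "\<forall>\<^sub>F n in sequentially. measure (P n) {x\<in>space (P n). \<not> ahead v n j C x} \<le> 0 + \<epsilon>"
  proof (rule gap_large[OF j(3,1,3), where a="\<lambda>n. 1" and b="\<lambda>n. - b / real n"])
    have "filterlim (\<lambda>n. (- b - m) + v n) at_top sequentially"
      by (rule filterlim_tendsto_add_at_top[OF tendsto_const L])
    then show "filterlim (\<lambda>n. real n * (ln 1 + - b / real n) + (penalty n (p n) (card j) - penalty n (p n) (card jst)) + 2 * v n) at_top sequentially"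
    proof (rule filterlim_at_top_mono)
      show "\<forall>\<^sub>F n in sequentially. (- b - m) + v n \<le> real n * (ln 1 + - b / real n) + (penalty n (p n) (card j) - penalty n (p n) (card jst)) + 2 * v n"
        using pen L[unfolded filterlim_at_top_dense, rule_format, of 0] eventually_gt_at_top[of 0]
      proof eventually_elim
        case (elim n)
        have pn: "real (p n) > 0" using p1[of n] by simp
        have "- real (p n) < penalty n (p n) (card j) - penalty n (p n) (card jst)" using elim(1) pn by (simp add: field_simps)
        then show ?case using m(1)[of n] elim by simp
      qed
    qed
  qed (use b in auto)
  then show ?thesis by simp
qed

lemma gap_underfit_unbounded:
  fixes C \<epsilon> c :: real
  assumes unb: "\<not> bdd_above (range p)" and jst: "jst \<subseteq> {..<k}" and j: "j \<subseteq> {..<k}" and e: "\<epsilon> > 0"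
    and \<Gamma>: "\<And>n. n > k \<Longrightarrow> G n \<in> carrier_mat (p n) g \<and> G n * (G n)\<^sup>T = noncentrality (X n) jst (\<Theta> n) (\<Sigma> n) j"
    and c: "c > 0" "\<forall>\<^sub>F n in sequentially. c * (real n * real (p n)) \<le> min_eigenvalue ((G n)\<^sup>T * G n)"
    and L: "(\<lambda>n. ereal (v n / (real n * ln (real (p n))))) \<longlonglongrightarrow> L" "L > ereal (- real g / 2)"
  shows "\<forall>\<^sub>F n in sequentially. measure (P n) {x\<in>space (P n). \<not> ahead v n j C x} \<le> \<epsilon>"
proof -
  define d where "d = real (card (j \<union> jst)) - real (card jst)"
  define D where "D n = penalty n (p n) (card j) - penalty n (p n) (card jst)" for n
  obtain r where r: "- real g / 2 < r" "ereal r < L" using ereal_dense2[OF L(2)] by auto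
  have rv: "\<forall>\<^sub>F n in sequentially. r < v n / (real n * ln (real (p n)))"
    using order_tendstoD(1)[OF L(1) r(2)] by simp
  obtain c' where c': "c' > 0" "\<forall>\<^sub>F n in sequentially. measure (P n) {x\<in>space (P n). rd n j x < (1 + c' * real (p n)) ^ g * rd n (j \<union> jst) x} \<le> \<epsilon> / 2"
    using underfit[OF j _ \<Gamma> c, of "\<epsilon> / 2"] e by auto
  obtain \<delta> where \<delta>: "\<delta> > 0" "(1 + \<delta>) * c0 < 1" using log_ratio_perturb[OF c0, of "log_ratio c0 - 1"] by auto
  define b where "b n = d * ln (1 - (1 + \<delta>) * real (p n) / real (n - k))" for n
  have b: "b \<longlonglongrightarrow> d * ln (1 - (1 + \<delta>) * c0)"
    unfolding b_def by (intro tendsto_intros leverage_bound_tendsto) (use \<delta> in auto)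
  have lp: "filterlim (\<lambda>n. ln (real (p n))) at_top sequentially"
    by (rule filterlim_compose[OF ln_at_top p_at_top[OF unb]])
  have small: "(\<lambda>n. h n / ln (real (p n))) \<longlonglongrightarrow> 0" if "h \<longlonglongrightarrow> y" for h :: "nat \<Rightarrow> real" and y
    by (rule real_tendsto_divide_at_top[OF that lp])
  have ip: "(\<lambda>n. 1 / real (p n)) \<longlonglongrightarrow> 0"
    by (rule real_tendsto_divide_at_top[OF tendsto_const p_at_top[OF unb]])
  define f where "f n = real g * (1 + ln (c' + 1 / real (p n)) / ln (real (p n))) + b n / ln (real (p n))
    + D n / real (p n) * (real (p n) / real n) / ln (real (p n)) + 2 * r" for n
  have f: "f \<longlonglongrightarrow> real g * (1 + 0) + 0 + 0 + 2 * r"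
    unfolding f_def
  proof (intro tendsto_add tendsto_mult[of "\<lambda>_. real g"] tendsto_mult[of "\<lambda>_. 2"] tendsto_const small[OF b] small)
    show "(\<lambda>n. ln (c' + 1 / real (p n))) \<longlonglongrightarrow> ln (c' + 0)" by (intro tendsto_ln tendsto_add tendsto_const ip) (use c' in simp)
    show "(\<lambda>n. D n / real (p n) * (real (p n) / real n)) \<longlonglongrightarrow> (real (card j) - real (card jst)) * ((2 - c0) / (1 - c0)\<^sup>2) * c0"
      unfolding D_def by (intro tendsto_mult[OF penalty_diff_tendsto ratio])
  qed
  have lim: "filterlim (\<lambda>n. f n * (real n * ln (real (p n)))) at_top sequentially"
    by (rule filterlim_tendsto_pos_mult_at_top[OF f _ filterlim_at_top_mult_at_top[OF filterlim_real_sequentially lp]]) (use r in simp)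
  have "\<forall>\<^sub>F n in sequentially. measure (P n) {x\<in>space (P n). \<not> ahead v n j C x} \<le> \<epsilon> / 2 + \<epsilon> / 2"
  proof (rule gap_large[OF j _ _ _ c'(2), where b=b])
    show "\<forall>\<^sub>F n in sequentially. measure (P n) (bad n jst (j \<union> jst) (b n)) \<le> \<epsilon> / 2"
      unfolding b_def d_def by (rule overfit_unbounded[OF unb \<delta>(1,2)]) (use jst j e in auto)
    show "0 < (1 + c' * real (p n)) ^ g" for n using c' by (simp add: add_pos_nonneg)
    show "filterlim (\<lambda>n. real n * (ln ((1 + c' * real (p n)) ^ g) + b n) + (penalty n (p n) (card j) - penalty n (p n) (card jst)) + 2 * v n) at_top sequentially"
      using lim
    proof (rule filterlim_at_top_mono)
      show "\<forall>\<^sub>F n in sequentially. f n * (real n * ln (real (p n))) \<le> real n * (ln ((1 + c' * real (p n)) ^ g) + b n) + (penalty n (p n) (card j) - penalty n (p n) (card jst)) + 2 * v n"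
        using rv lp[unfolded filterlim_at_top_dense, rule_format, of 0] eventually_gt_at_top[of 0]
      proof eventually_elim
        case (elim n)
        define l where "l = ln (real (p n))"
        have l: "l > 0" using elim by (simp add: l_def)
        have pn: "real (p n) > 0" using p1[of n] by simp
        have "1 + c' * real (p n) = real (p n) * (c' + 1 / real (p n))" using pn by (simp add: field_simps)
        moreover have "c' + 1 / real (p n) > 0" using c' pn by (simp add: add_pos_pos)
        ultimately have 1: "ln ((1 + c' * real (p n)) ^ g) = real g * (l + ln (c' + 1 / real (p n)))"
          using pn by (simp add: ln_realpow ln_mult l_def)
        have "f n * (real n * l) = real n * (real g * (l + ln (c' + 1 / real (p n))) + b n) + D n + 2 * (r * (real n * l))"
          using pn l elim unfolding f_def l_def[symmetric] by (simp add: distrib_left distrib_right mult_ac)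
        also have "r * (real n * l) \<le> v n" using elim(1) l elim(3) unfolding l_def[symmetric] by (simp add: pos_less_divide_eq)
        finally show ?case unfolding 1 D_def l_def by simp
      qed
    qed
  qed (use jst j in auto)
  then show ?thesis by simp
qed

lemma gap_underfit_bounded:
  fixes C \<epsilon> c :: real
  assumes bdd: "bdd_above (range p)" and jst: "jst \<subseteq> {..<k}" and j: "j \<subseteq> {..<k}" and e: "\<epsilon> > 0" and g: "g > 0"
    and \<Gamma>: "\<And>n. n > k \<Longrightarrow> G n \<in> carrier_mat (p n) g \<and> G n * (G n)\<^sup>T = noncentrality (X n) jst (\<Theta> n) (\<Sigma> n) j"
    and c: "c > 0" "\<forall>\<^sub>F n in sequentially. c * (real n * real (p n)) \<le> min_eigenvalue ((G n)\<^sup>T * G n)"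
    and L: "(\<lambda>n. ereal (v n / real n)) \<longlonglongrightarrow> L" "L \<ge> 0"
  shows "\<forall>\<^sub>F n in sequentially. measure (P n) {x\<in>space (P n). \<not> ahead v n j C x} \<le> \<epsilon>"
proof -
  define D where "D n = penalty n (p n) (card j) - penalty n (p n) (card jst)" for n
  obtain m where m: "\<And>n. real (p n) \<le> m" "m > 0" using bounded_obtain[OF bdd] by blast
  have "(\<lambda>n. real (p n) / real n) \<longlonglongrightarrow> 0"
  proof (rule tendsto_sandwich[of "\<lambda>_. 0" _ _ "\<lambda>n. m / real n"])
    show "(\<lambda>n. m / real n) \<longlonglongrightarrow> 0" by (rule lim_const_over_n)
  qed (auto intro!: always_eventually divide_right_mono m)
  with ratio have c00: "c0 = 0" by (rule LIMSEQ_unique)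
  obtain c' where c': "c' > 0" "\<forall>\<^sub>F n in sequentially. measure (P n) {x\<in>space (P n). rd n j x < (1 + c' * real (p n)) ^ g * rd n (j \<union> jst) x} \<le> \<epsilon> / 2"
    using underfit[OF j _ \<Gamma> c, of "\<epsilon> / 2"] e by auto
  obtain b where b: "\<forall>\<^sub>F n in sequentially. measure (P n) (bad n jst (j \<union> jst) (- b / real n)) \<le> \<epsilon> / 2"
    using overfit_bounded[OF bdd, of jst "j \<union> jst" "\<epsilon> / 2"] jst j e by auto
  define s where "s = real g * ln (1 + c')"
  have s: "s > 0" using g c' by (simp add: s_def)
  have "ereal (- s / 8) < L" using L(2) s by (intro less_le_trans[OF _ L(2)]) simp
  from order_tendstoD(1)[OF L(1) this] have rv: "\<forall>\<^sub>F n in sequentially. - s / 8 < v n / real n" by simp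
  define f where "f n = s - b / real n + D n / real (p n) * (real (p n) / real n) - s / 4" for n
  have f: "f \<longlonglongrightarrow> s - 0 + (real (card j) - real (card jst)) * ((2 - c0) / (1 - c0)\<^sup>2) * c0 - s / 4"
    unfolding f_def
  proof (intro tendsto_add tendsto_diff tendsto_mult tendsto_const ratio lim_const_over_n)
    show "(\<lambda>n. D n / real (p n)) \<longlonglongrightarrow> (real (card j) - real (card jst)) * ((2 - c0) / (1 - c0)\<^sup>2)"
      unfolding D_def by (rule penalty_diff_tendsto)
  qed
  have lim: "filterlim (\<lambda>n. f n * real n) at_top sequentially"
    by (rule filterlim_tendsto_pos_mult_at_top[OF f _ filterlim_real_sequentially]) (use s c00 in simp)
  have "\<forall>\<^sub>F n in sequentially. measure (P n) {x\<in>space (P n). \<not> ahead v n j C x} \<le> \<epsilon> / 2 + \<epsilon> / 2"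
  proof (rule gap_large[OF j _ _ _ c'(2) b])
    show "0 < (1 + c' * real (p n)) ^ g" for n using c' by (simp add: add_pos_nonneg)
    show "filterlim (\<lambda>n. real n * (ln ((1 + c' * real (p n)) ^ g) + - b / real n) + (penalty n (p n) (card j) - penalty n (p n) (card jst)) + 2 * v n) at_top sequentially"
      using lim
    proof (rule filterlim_at_top_mono)
      show "\<forall>\<^sub>F n in sequentially. f n * real n \<le> real n * (ln ((1 + c' * real (p n)) ^ g) + - b / real n) + (penalty n (p n) (card j) - penalty n (p n) (card jst)) + 2 * v n"
        using rv eventually_gt_at_top[of 0]
      proof eventually_elim
        case (elim n)
        have pn: "real (p n) \<ge> 1" using p1[of n] by simp
        have "c' * 1 \<le> c' * real (p n)" using pn c' by (intro mult_left_mono) auto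
        then have "ln (1 + c') \<le> ln (1 + c' * real (p n))" using c' by (subst ln_le_cancel_iff) (auto intro: add_pos_nonneg)
        then have "s \<le> ln ((1 + c' * real (p n)) ^ g)"
          using c' unfolding s_def by (subst ln_realpow) (auto intro: mult_left_mono add_pos_nonneg)
        then have 1: "real n * s \<le> real n * ln ((1 + c' * real (p n)) ^ g)" by (intro mult_left_mono) auto
        have 2: "- (s / 8) * real n \<le> v n" using elim by (simp add: field_simps)
        have "f n * real n = real n * s - b + D n + 2 * (- (s / 8) * real n)"
          using pn elim by (simp add: f_def algebra_simps)
        moreover have "real n * (ln ((1 + c' * real (p n)) ^ g) + - b / real n) = real n * ln ((1 + c' * real (p n)) ^ g) - b"
          using elim by (simp add: distrib_left right_diff_distrib)
        ultimately show ?case using 1 2 unfolding D_def by linarith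
      qed
    qed
  qed (use jst j in auto)
  then show ?thesis by simp
qed

end

lemma (in regression) MPIC_main_rdet:
  assumes x: "x \<in> space P" and pos: "rdet j x > 0"
  shows "MPIC_main X (Y x) j = n * (ln (rdet j x) - p * ln n) + n * p * (ln (2 * pi) + 1) + penalty n p (card j)"
proof -
  have Yx: "Y x \<in> carrier_mat n p" using Y x by (auto simp: matrix_normal_def)
  let ?A = "(Y x)\<^sup>T * (1\<^sub>m n - proj_mat (cols_sub X j)) * Y x"
  have "Sigma_hat X (Y x) j = (1 / real n) \<cdot>\<^sub>m ?A" using Yx by (simp add: Sigma_hat_def)
  then have "det (Sigma_hat X (Y x) j) = (1 / real n) ^ p * rdet j x"
    using Yx by (simp add: det_smult rdet_def resid_mat_def)
  moreover have "ln ((1 / real n) ^ p * rdet j x) = ln (rdet j x) - p * ln n"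
    using pos kn by (simp add: ln_mult ln_realpow ln_div)
  ultimately show ?thesis using Yx by (simp add: MPIC_main_def Let_def penalty_def)
qed

lemma powr_ratio_bound:
  fixes l a n :: real
  assumes "l > 0" "a > 0" "n > 0" and le: "(2 * pi) ^ q * n ^ q \<le> l ^ q * a"
  shows "(2 * pi) powr (real (p * q) / 2) * a powr (- real p / 2) \<le> l powr (real (p * q) / 2) / n powr (real (p * q) / 2)"
proof -
  have pw: "x powr (real (p * q) / 2) = (x ^ q) powr (real p / 2)" if "x > 0" for x :: real
    using that by (simp add: powr_realpow[symmetric] powr_powr mult.commute)
  have "((2 * pi) ^ q * n ^ q) powr (real p / 2) \<le> (l ^ q * a) powr (real p / 2)"
    by (rule powr_mono2) (use assms in auto)
  then have "((2 * pi) ^ q) powr (real p / 2) * (n ^ q) powr (real p / 2) \<le> (l ^ q) powr (real p / 2) * a powr (real p / 2)"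
    using assms by (simp add: powr_mult)
  moreover have frac: "u * (1 / z) \<le> y / v" if "u * v \<le> y * z" "z > 0" "v > 0" for u v y z :: real
    using that by (simp add: field_simps)
  ultimately have "((2 * pi) ^ q) powr (real p / 2) * (1 / a powr (real p / 2)) \<le> (l ^ q) powr (real p / 2) / (n ^ q) powr (real p / 2)"
    by (intro frac) (use assms in auto)
  then show ?thesis
    using pw[of "2 * pi"] pw[of l] pw[of n] assms powr_minus_divide[of a "real p / 2"] by simp
qed

lemma (in full_rank) MPIC_bounds:
  fixes m B :: real
  assumes j: "j \<subseteq> {..<q}" and Y: "Y \<in> carrier_mat n p" and prior: "prior_density (card j) p (\<pi> j)"
    and P1: "\<And>T S. T \<in> carrier_mat (card j) p \<Longrightarrow> pos_def p S \<Longrightarrow>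
        \<pi> j T S * det S powr (real (card j) / 2) = \<pi> j (T * inv_sqrt S) (1\<^sub>m p)"
    and m: "\<And>T. T \<in> carrier_mat (card j) p \<Longrightarrow> \<pi> j T (1\<^sub>m p) \<le> m"
    and w: "0 < w j" "w j < 1"
    and B: "(1 - w j) / w j * (m * ((2 * pi) powr (real (p * card j) / 2) * det ((cols_sub X j)\<^sup>T * cols_sub X j) powr (- real p / 2))) \<le> B"
  shows "MPIC_Approx w X Y j - 2 * ln (1 + B) \<le> MPIC \<pi> w X Y j" "MPIC \<pi> w X Y j \<le> MPIC_Approx w X Y j"
proof -
  let ?S = "Sigma_hat X Y j"
  define r where "r = marginal_density (\<pi> j) X j Y ?S / normal_mat_density (cols_sub X j * Theta_hat X Y j) ?S Y"
  note r = marginal_ratio_bound[OF j Y prior P1 m, of ?S, folded r_def]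
  have "(1 - w j) * r \<le> w j * B"
  proof -
    have "(1 - w j) / w j * r \<le> B" using r(2) w by (intro order_trans[OF mult_left_mono B]) auto
    then show ?thesis using w by (simp add: field_simps)
  qed
  then have up: "(1 - w j) * r + w j \<le> w j * (1 + B)" by (simp add: distrib_left)
  have lo: "w j \<le> (1 - w j) * r + w j" using r(1) w by simp
  have pos: "(1 - w j) * r + w j > 0" using lo w by linarith
  then have B1: "1 + B > 0" using up w by (metis less_le_trans zero_less_mult_pos)
  have "ln ((1 - w j) * r + w j) \<le> ln (w j * (1 + B))" using pos up by (subst ln_le_cancel_iff) linarith+
  moreover have "ln (w j * (1 + B)) = ln (w j) + ln (1 + B)" using w B1 by (simp add: ln_mult)
  moreover have "ln (w j) \<le> ln ((1 - w j) * r + w j)" using pos lo w by (subst ln_le_cancel_iff) linarith+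
  moreover have "MPIC \<pi> w X Y j = MPIC_main X Y j - 2 * ln ((1 - w j) * r + w j)"
    by (simp add: MPIC_def r_def)
  ultimately show "MPIC_Approx w X Y j - 2 * ln (1 + B) \<le> MPIC \<pi> w X Y j" "MPIC \<pi> w X Y j \<le> MPIC_Approx w X Y j"
    by (auto simp: MPIC_Approx_def)
qed

lemma prior_sup_bound:
  fixes a :: "nat \<Rightarrow> real"
  assumes fin: "(SUP n\<in>N. ereal (a n) * prior_sup q (p n) (\<pi> n)) < \<infinity>" and a: "\<And>n. n \<in> N \<Longrightarrow> a n > 0"
  obtains B where "B \<ge> 0" "\<And>n. n \<in> N \<Longrightarrow> \<exists>m. a n * m \<le> B \<and> (\<forall>T\<in>carrier_mat q (p n). \<pi> n T (1\<^sub>m (p n)) \<le> m)"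
proof -
  obtain B0 :: real where B0: "(SUP n\<in>N. ereal (a n) * prior_sup q (p n) (\<pi> n)) \<le> ereal B0"
    using fin by (cases "SUP n\<in>N. ereal (a n) * prior_sup q (p n) (\<pi> n)") auto
  define B where "B = max B0 0"
  show thesis
  proof
    show "B \<ge> 0" by (simp add: B_def)
    fix n assume n: "n \<in> N"
    have le: "ereal (a n) * prior_sup q (p n) (\<pi> n) \<le> ereal B"
      using SUP_upper[OF n, of "\<lambda>n. ereal (a n) * prior_sup q (p n) (\<pi> n)"] B0
      by (metis B_def ereal_less_eq(3) max.cobounded1 order_trans)
    have up: "ereal (\<pi> n T (1\<^sub>m (p n))) \<le> prior_sup q (p n) (\<pi> n)" if "T \<in> carrier_mat q (p n)" for T
      unfolding prior_sup_def using that by (rule SUP_upper)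
    have "0\<^sub>m q (p n) \<in> carrier_mat q (p n)" by simp
    from up[OF this] have "prior_sup q (p n) (\<pi> n) \<noteq> - \<infinity>" by auto
    moreover have "prior_sup q (p n) (\<pi> n) \<noteq> \<infinity>" using le a[OF n] by auto
    ultimately obtain m where m: "prior_sup q (p n) (\<pi> n) = ereal m" by (cases "prior_sup q (p n) (\<pi> n)") auto
    show "\<exists>m. a n * m \<le> B \<and> (\<forall>T\<in>carrier_mat q (p n). \<pi> n T (1\<^sub>m (p n)) \<le> m)"
      using le up unfolding m by (intro exI[of _ m]) auto
  qed
qed

context model_sequence
begin

lemma Approx_gap:
  assumes n: "n > k" and x: "x \<in> space (P n)" and pos: "0 < rd n j x" "0 < rd n jst x" and w: "w jst > 0" "w j > 0"
  shows "MPIC_Approx w (X n) (Y n x) j - MPIC_Approx w (X n) (Y n x) jst = gap (\<lambda>n. ln (w jst / w j)) n j x"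
proof -
  interpret regression n k "X n" "P n" "p n" jst "\<Theta> n" "\<Sigma> n" "Y n" by (rule reg) fact
  show ?thesis
    using w MPIC_main_rdet[OF x pos(1)[unfolded rd_def]] MPIC_main_rdet[OF x pos(2)[unfolded rd_def]]
    by (simp add: MPIC_Approx_def gap_def rd_def[symmetric] ln_div algebra_simps)
qed

lemma consistent_criterion:
  assumes J: "J \<subseteq> Pow {..<k}" "jst \<in> J" and w: "\<And>n j. n > k \<Longrightarrow> j \<in> J \<Longrightarrow> w n j > 0"
    and meas: "\<And>n j. n > k \<Longrightarrow> j \<in> J \<Longrightarrow> (\<lambda>x. IC n (Y n x) j) \<in> borel_measurable (P n)"
    and close: "\<And>j. j \<in> J \<Longrightarrow> \<exists>c. \<forall>\<^sub>F n in sequentially. \<forall>x\<in>space (P n).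
      MPIC_Approx (w n) (X n) (Y n x) j - c \<le> IC n (Y n x) j \<and> IC n (Y n x) j \<le> MPIC_Approx (w n) (X n) (Y n x) j"
    and ahead: "\<And>j C \<epsilon>. j \<in> J - {jst} \<Longrightarrow> \<epsilon> > 0 \<Longrightarrow>
      \<forall>\<^sub>F n in sequentially. measure (P n) {x\<in>space (P n). \<not> ahead (\<lambda>n. ln (w n jst / w n j)) n j C x} \<le> \<epsilon>"
  shows "consistent P Y J jst IC"
  unfolding consistent_def
proof (rule tendstoI)
  fix e :: real assume e: "e > 0"
  have finJ: "finite J" using J(1) by (rule finite_subset) simp
  have jk: "j \<subseteq> {..<k}" if "j \<in> J" for j using that J by auto
  have "\<exists>c. \<forall>j\<in>J. \<forall>\<^sub>F n in sequentially. \<forall>x\<in>space (P n).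
      MPIC_Approx (w n) (X n) (Y n x) j - c j \<le> IC n (Y n x) j \<and> IC n (Y n x) j \<le> MPIC_Approx (w n) (X n) (Y n x) j"
    by (rule bchoice) (use close in blast)
  then obtain c where c: "\<And>j. j \<in> J \<Longrightarrow> \<forall>\<^sub>F n in sequentially. \<forall>x\<in>space (P n).
      MPIC_Approx (w n) (X n) (Y n x) j - c j \<le> IC n (Y n x) j \<and> IC n (Y n x) j \<le> MPIC_Approx (w n) (X n) (Y n x) j"
    by blast
  define K where "K = real (card J) + 1"
  have K: "K > 0" by (simp add: K_def add_nonneg_pos)
  let ?v = "\<lambda>j n. ln (w n jst / w n j)"
  let ?E = "\<lambda>n j. {x\<in>space (P n). \<not> ahead (?v j) n j (c j) x}"
  have 1: "\<forall>\<^sub>F n in sequentially. \<forall>j\<in>J. \<forall>x\<in>space (P n).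
      MPIC_Approx (w n) (X n) (Y n x) j - c j \<le> IC n (Y n x) j \<and> IC n (Y n x) j \<le> MPIC_Approx (w n) (X n) (Y n x) j"
    using finJ c by (simp add: eventually_ball_finite)
  have 2: "\<forall>\<^sub>F n in sequentially. \<forall>j\<in>J - {jst}. measure (P n) (?E n j) \<le> e / K"
    using finJ e K by (intro eventually_ball_finite ballI ahead) auto
  show "\<forall>\<^sub>F n in sequentially. dist (measure (P n) {x\<in>space (P n). {j. is_arg_min (IC n (Y n x)) (\<lambda>j. j \<in> J) j} = {jst}}) 1 < e"
    using 1 2 eventually_gt_at_top[of k]
  proof eventually_elim
    case (elim n)
    interpret prob_space "P n" by (rule prob_P) fact
    let ?A = "{x\<in>space (P n). \<forall>j\<in>J - {jst}. IC n (Y n x) jst < IC n (Y n x) j}"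
    have argmin: "{j. is_arg_min (IC n (Y n x)) (\<lambda>j. j \<in> J) j} = {jst} \<longleftrightarrow> (\<forall>j\<in>J - {jst}. IC n (Y n x) jst < IC n (Y n x) j)"
      (is "?L \<longleftrightarrow> ?R") for x
    proof
      assume L: ?L
      show ?R
      proof (rule ballI, rule ccontr)
        fix j assume j: "j \<in> J - {jst}" "\<not> IC n (Y n x) jst < IC n (Y n x) j"
        from L have "is_arg_min (IC n (Y n x)) (\<lambda>j. j \<in> J) jst" by blast
        with j have "is_arg_min (IC n (Y n x)) (\<lambda>j. j \<in> J) j" by (auto simp: is_arg_min_linorder)
        with L j show False by blast
      qed
    next
      assume R: ?R
      show ?L
      proof (intro Set.set_eqI iffI)
        fix j assume "j \<in> {j. is_arg_min (IC n (Y n x)) (\<lambda>j. j \<in> J) j}"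
        then have "j \<in> J" "IC n (Y n x) j \<le> IC n (Y n x) jst" using J(2) by (auto simp: is_arg_min_linorder)
        then show "j \<in> {jst}" using R by (auto simp: not_le[symmetric])
      next
        fix j assume "j \<in> {jst}"
        then show "j \<in> {j. is_arg_min (IC n (Y n x)) (\<lambda>j. j \<in> J) j}"
          using R J(2) by (auto simp: is_arg_min_linorder le_less)
      qed
    qed
    have A: "?A \<in> events"
    proof -
      have "{x\<in>space (P n). IC n (Y n x) jst < IC n (Y n x) j} \<in> events" if "j \<in> J" for j
        using meas[OF elim(3) that] meas[OF elim(3) J(2)] by measurable
      then show ?thesis using finJ by (intro sets.sets_Collect_finite_All) auto
    qed
    have "space (P n) - ?A \<subseteq> (\<Union>j\<in>J - {jst}. ?E n j)"
    proof
      fix x assume "x \<in> space (P n) - ?A"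
      then obtain j where x: "x \<in> space (P n)" and j: "j \<in> J" "j \<noteq> jst" and le: "IC n (Y n x) j \<le> IC n (Y n x) jst"
        by (auto simp: not_less)
      have "\<not> ahead (?v j) n j (c j) x"
      proof
        assume ah: "ahead (?v j) n j (c j) x"
        have "MPIC_Approx (w n) (X n) (Y n x) j - MPIC_Approx (w n) (X n) (Y n x) jst = gap (\<lambda>_. ln (w n jst / w n j)) n j x"
          by (rule Approx_gap) (use ah x elim J j w in \<open>auto simp: ahead_def\<close>)
        also have "\<dots> = gap (?v j) n j x" by (simp add: gap_def)
        also have "\<dots> > c j" using ah by (simp add: ahead_def)
        finally have "MPIC_Approx (w n) (X n) (Y n x) jst < MPIC_Approx (w n) (X n) (Y n x) j - c j" by linarith
        also have "\<dots> \<le> IC n (Y n x) j" using elim(1) x j by blast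
        also have "\<dots> \<le> MPIC_Approx (w n) (X n) (Y n x) jst" using elim(1) x J(2) le by (blast intro: order_trans)
        finally show False by simp
      qed
      then show "x \<in> (\<Union>j\<in>J - {jst}. ?E n j)" using x j by blast
    qed
    moreover have E: "?E n j \<in> events" if "j \<in> J" for j
      by (rule ahead_sets) (use that elim jk J in auto)
    ultimately have "prob (space (P n) - ?A) \<le> prob (\<Union>j\<in>J - {jst}. ?E n j)"
      using finJ by (intro finite_measure_mono) auto
    also have "\<dots> \<le> (\<Sum>j\<in>J - {jst}. prob (?E n j))"
      using finJ E by (intro measure_UNION_le) auto
    also have "\<dots> \<le> (\<Sum>j\<in>J - {jst}. e / K)" using elim by (intro sum_mono) auto
    also have "\<dots> \<le> real (card J) * (e / K)"
      using card_mono[OF finJ Diff_subset, of "{jst}"] e K by (simp only: sum_constant) (intro mult_right_mono; simp)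
    also have "\<dots> < K * (e / K)" using e K by (intro mult_strict_right_mono) (auto simp: K_def)
    also have "\<dots> = e" using K by simp
    finally have "1 - prob ?A < e" using prob_compl[OF A] by simp
    then show ?case using prob_le_1[of ?A] by (simp add: argmin dist_real_def)
  qed
qed

lemma MPIC_close:
  assumes j: "j \<subseteq> {..<k}" and w: "\<And>n. n > k \<Longrightarrow> 0 < w n j \<and> w n j < 1"
    and prior: "\<And>n. n > k \<Longrightarrow> prior_density (card j) (p n) (\<pi> n j)"
    and P1: "\<And>n T S. n > k \<Longrightarrow> T \<in> carrier_mat (card j) (p n) \<Longrightarrow> pos_def (p n) S \<Longrightarrow>
        \<pi> n j T S * det S powr (real (card j) / 2) = \<pi> n j (T * inv_sqrt S) (1\<^sub>m (p n))"
    and l: "\<And>n. n > k \<Longrightarrow> 0 < l n" "filterlim l at_top sequentially"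
    and P2: "(SUP n\<in>{k<..}. ereal ((1 - w n j) * l n powr (real (p n * card j) / 2) /
          (w n j * real n powr (real (p n * card j) / 2))) * prior_sup (card j) (p n) (\<pi> n j)) < \<infinity>"
    and X: "liminf (\<lambda>n. ereal (det ((1 / real n) \<cdot>\<^sub>m ((cols_sub (X n) j)\<^sup>T * cols_sub (X n) j)))) > 0"
  shows "\<exists>c. \<forall>\<^sub>F n in sequentially. \<forall>x\<in>space (P n).
      MPIC_Approx (w n) (X n) (Y n x) j - c \<le> MPIC (\<pi> n) (w n) (X n) (Y n x) j
      \<and> MPIC (\<pi> n) (w n) (X n) (Y n x) j \<le> MPIC_Approx (w n) (X n) (Y n x) j"
proof -
  let ?q = "card j"
  let ?a = "\<lambda>n. (1 - w n j) * l n powr (real (p n * ?q) / 2) / (w n j * real n powr (real (p n * ?q) / 2))"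
  have apos: "?a n > 0" if "n \<in> {k<..}" for n using w[of n] l(1)[of n] that by simp
  obtain B where B: "B \<ge> 0" "\<And>n. n \<in> {k<..} \<Longrightarrow> \<exists>m. ?a n * m \<le> B \<and> (\<forall>T\<in>carrier_mat ?q (p n). \<pi> n j T (1\<^sub>m (p n)) \<le> m)"
    using prior_sup_bound[OF P2 apos] by auto
  obtain \<delta> where \<delta>: "0 < ereal \<delta>" "ereal \<delta> < liminf (\<lambda>n. ereal (det ((1 / real n) \<cdot>\<^sub>m ((cols_sub (X n) j)\<^sup>T * cols_sub (X n) j))))"
    using ereal_dense2[OF X] by auto
  have dl: "\<forall>\<^sub>F n in sequentially. \<delta> < det ((1 / real n) \<cdot>\<^sub>m ((cols_sub (X n) j)\<^sup>T * cols_sub (X n) j))"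
    using less_LiminfD[OF \<delta>(2)] by simp
  have "\<forall>\<^sub>F n in sequentially. \<forall>x\<in>space (P n).
      MPIC_Approx (w n) (X n) (Y n x) j - 2 * ln (1 + B) \<le> MPIC (\<pi> n) (w n) (X n) (Y n x) j
      \<and> MPIC (\<pi> n) (w n) (X n) (Y n x) j \<le> MPIC_Approx (w n) (X n) (Y n x) j"
    using dl l(2)[unfolded filterlim_at_top, rule_format, of "2 * pi * max 1 (1 / \<delta>)"] eventually_gt_at_top[of k]
  proof eventually_elim
    case (elim n)
    interpret regression n k "X n" "P n" "p n" jst "\<Theta> n" "\<Sigma> n" "Y n" by (rule reg) fact
    let ?A = "(cols_sub (X n) j)\<^sup>T * cols_sub (X n) j"
    interpret J: full_rank n ?q "cols_sub (X n) j" by (rule cols_sub[OF j])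
    have Ac: "?A \<in> carrier_mat ?q ?q" using J.X by simp
    have dA: "det ?A > 0" by (rule pos_def_det[OF J.XX])
    have n0: "real n > 0" using elim by simp
    define D where "D = det ((1 / real n) \<cdot>\<^sub>m ?A)"
    have D: "real n ^ ?q * D = det ?A" using carrier_matD(2)[OF J.X] n0 by (simp add: D_def det_smult power_divide)
    have "(2 * pi) ^ ?q \<le> l n ^ ?q * D"
    proof (cases "?q = 0")
      case True
      then have "D = 1" using Ac carrier_matD(2)[OF J.X] by (simp add: D_def det_smult)
      with True show ?thesis by simp
    next
      case False
      have "max 1 (1 / \<delta>) \<le> max 1 (1 / \<delta>) ^ ?q" using False by (intro self_le_power) auto
      then have "(2 * pi) ^ ?q * (1 / \<delta>) \<le> (2 * pi) ^ ?q * max 1 (1 / \<delta>) ^ ?q" by (intro mult_left_mono) auto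
      also have "\<dots> = (2 * pi * max 1 (1 / \<delta>)) ^ ?q" by (simp add: power_mult_distrib)
      also have "\<dots> \<le> l n ^ ?q" using elim(2) by (intro power_mono) auto
      finally have "(2 * pi) ^ ?q \<le> l n ^ ?q * \<delta>" using \<delta>(1) by (simp add: field_simps)
      also have "\<dots> \<le> l n ^ ?q * D" using elim(1) l(1)[OF elim(3)] by (intro mult_left_mono) (auto simp: D_def)
      finally show ?thesis .
    qed
    then have "real n ^ ?q * (2 * pi) ^ ?q \<le> real n ^ ?q * (l n ^ ?q * D)" by (intro mult_left_mono) auto
    then have "(2 * pi) ^ ?q * real n ^ ?q \<le> l n ^ ?q * det ?A" unfolding D[symmetric] by (simp add: mult_ac)
    note pb = powr_ratio_bound[OF l(1)[OF elim(3)] dA n0 this, of "p n"]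
    obtain m where m: "?a n * m \<le> B" "\<And>T. T \<in> carrier_mat ?q (p n) \<Longrightarrow> \<pi> n j T (1\<^sub>m (p n)) \<le> m"
      using B(2)[of n] elim by auto
    have one: "pos_def (p n) (1\<^sub>m (p n))" by (rule pos_defI) (auto simp: qf_one intro!: sum_pos2)
    have "0 \<le> \<pi> n j (0\<^sub>m ?q (p n)) (1\<^sub>m (p n))" using prior[OF elim(3)] one by (auto simp: prior_density_def)
    also have "\<dots> \<le> m" by (rule m) simp
    finally have m0: "m \<ge> 0" .
    have "(1 - w n j) / w n j * (m * ((2 * pi) powr (real (p n * ?q) / 2) * det ?A powr (- real (p n) / 2)))
      \<le> (1 - w n j) / w n j * (m * (l n powr (real (p n * ?q) / 2) / real n powr (real (p n * ?q) / 2)))"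
      using w[OF elim(3)] m0 by (intro mult_left_mono pb) auto
    also have "\<dots> = ?a n * m" by simp
    finally have bound: "(1 - w n j) / w n j * (m * ((2 * pi) powr (real (p n * ?q) / 2) * det ?A powr (- real (p n) / 2))) \<le> B"
      using m(1) by linarith
    show ?case
    proof
      fix x assume "x \<in> space (P n)"
      then have Yx: "Y n x \<in> carrier_mat n (p n)" using Y by (auto simp: matrix_normal_def)
      have w': "0 < w n j" "w n j < 1" using w[OF elim(3)] by simp_all
      have P1n: "\<pi> n j T S * det S powr (real (card j) / 2) = \<pi> n j (T * inv_sqrt S) (1\<^sub>m (p n))"
        if "T \<in> carrier_mat (card j) (p n)" "pos_def (p n) S" for T S
        by (rule P1) (use that elim in auto)
      show "MPIC_Approx (w n) (X n) (Y n x) j - 2 * ln (1 + B) \<le> MPIC (\<pi> n) (w n) (X n) (Y n x) j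
          \<and> MPIC (\<pi> n) (w n) (X n) (Y n x) j \<le> MPIC_Approx (w n) (X n) (Y n x) j"
      proof
        show "MPIC_Approx (w n) (X n) (Y n x) j - 2 * ln (1 + B) \<le> MPIC (\<pi> n) (w n) (X n) (Y n x) j"
          by (rule MPIC_bounds(1)[OF j Yx]) (fact prior[OF elim(3)] P1n m(2) w' bound)+
        show "MPIC (\<pi> n) (w n) (X n) (Y n x) j \<le> MPIC_Approx (w n) (X n) (Y n x) j"
          by (rule MPIC_bounds(2)[OF j Yx]) (fact prior[OF elim(3)] P1n m(2) w' bound)+
      qed
    qed
  qed
  then show ?thesis by blast
qed

end

theorem theorem3p2:
  fixes k :: nat and J :: "nat set set" and jst :: "nat set"
    and p :: "nat \<Rightarrow> nat" and c0 :: real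
    and X \<Theta> \<Sigma> :: "nat \<Rightarrow> real mat"
    and P :: "nat \<Rightarrow> 'a measure" and Y :: "nat \<Rightarrow> 'a \<Rightarrow> real mat"
    and w :: "nat \<Rightarrow> nat set \<Rightarrow> real"
    and \<pi> :: "nat \<Rightarrow> nat set \<Rightarrow> real mat \<Rightarrow> real mat \<Rightarrow> real"
    and \<gamma> :: "nat set \<Rightarrow> nat" and \<Gamma> :: "nat \<Rightarrow> nat set \<Rightarrow> real mat"
  assumes models: "J \<subseteq> Pow {..<k}" "jst \<subseteq> {..<k}"
    and dims: "mono p" "\<forall>n. 1 \<le> p n" "(\<lambda>n. real (p n) / real n) \<longlonglongrightarrow> c0" "0 \<le> c0" "c0 < 1"
    and design: "\<forall>n>k. X n \<in> carrier_mat n k \<and> mrank (X n) = k"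
    and parameters: "\<forall>n>k. \<Theta> n \<in> carrier_mat (card jst) (p n) \<and> pos_def (p n) (\<Sigma> n)"
    and data: "\<forall>n>k. prob_space (P n) \<and>
        matrix_normal (P n) n (p n) (Y n) (cols_sub (X n) jst * \<Theta> n) (\<Sigma> n)"
    and weights: "\<forall>n>k. \<forall>j\<in>J. 0 < w n j \<and> w n j < 1"
    and priors: "\<forall>n>k. \<forall>j\<in>J. prior_density (card j) (p n) (\<pi> n j)"
    and P1: "\<forall>n>k. \<forall>j\<in>J. \<forall>T\<in>carrier_mat (card j) (p n). \<forall>S. pos_def (p n) S \<longrightarrow>
        \<pi> n j T S * det S powr (real (card j) / 2) = \<pi> n j (T * inv_sqrt S) (1\<^sub>m (p n))"
    and P2: "\<forall>j\<in>J. \<exists>l :: nat \<Rightarrow> real. (\<forall>n>k. 0 < l n) \<and> filterlim l at_top sequentially \<and>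
        (SUP n\<in>{k<..}.
           ereal ((1 - w n j) * l n powr (real (p n * card j) / 2) /
                  (w n j * real n powr (real (p n * card j) / 2))) *
           prior_sup (card j) (p n) (\<pi> n j)) < \<infinity>"
    and X: "\<forall>j\<in>J. liminf (\<lambda>n. ereal (det ((1 / real n) \<cdot>\<^sub>m
        (transpose_mat (cols_sub (X n) j) * cols_sub (X n) j)))) > 0"
    and A1: "jst \<in> J"
    and A2_rank: "\<forall>j\<in>models_minus J jst. 0 < \<gamma> j \<and>
        (\<forall>n>k. mrank (noncentrality (X n) jst (\<Theta> n) (\<Sigma> n) j) = \<gamma> j)"
    and A2_factor: "\<forall>j\<in>models_minus J jst. \<forall>n>k.
        \<Gamma> n j \<in> carrier_mat (p n) (\<gamma> j) \<and> mrank (\<Gamma> n j) = \<gamma> j \<and>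
        \<Gamma> n j * transpose_mat (\<Gamma> n j) = noncentrality (X n) jst (\<Theta> n) (\<Sigma> n) j"
    and A2_eigenvalue: "\<forall>j\<in>models_minus J jst.
        liminf (\<lambda>n. ereal (min_eigenvalue (transpose_mat (\<Gamma> n j) * \<Gamma> n j) /
          (real n * real (p n)))) > 0"
    and conditions:
      "(\<not> bdd_above (range p) \<and>
        (\<forall>j\<in>models_minus J jst. \<exists>L.
           (\<lambda>n. ereal (ln (w n jst / w n j) / (real n * ln (real (p n))))) \<longlonglongrightarrow> L \<and>
           L > ereal (- real (\<gamma> j) / 2)) \<and>
        (\<forall>j\<in>models_plus J jst - {jst}. \<exists>L.
           (\<lambda>n. ereal (ln (w n jst / w n j) / real (p n))) \<longlonglongrightarrow> L \<and>
           L > ereal (- (1 / 2) * (real (card j) - real (card jst)) *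
                 (log_ratio c0 + (2 - c0) / (1 - c0)\<^sup>2)))) \<or>
       (bdd_above (range p) \<and>
        (\<forall>j\<in>models_minus J jst. \<exists>L.
           (\<lambda>n. ereal (ln (w n jst / w n j) / real n)) \<longlonglongrightarrow> L \<and> L \<ge> 0) \<and>
        (\<forall>j\<in>models_plus J jst - {jst}.
           filterlim (\<lambda>n. ln (w n jst / w n j)) at_top sequentially))"
  shows "consistent P Y J jst (\<lambda>n. MPIC (\<pi> n) (w n) (X n)) \<and>
         consistent P Y J jst (\<lambda>n. MPIC_Approx (w n) (X n))"
proof -
  note X_liminf = X
  have reg: "regression n k (X n) (P n) (p n) jst (\<Theta> n) (\<Sigma> n) (Y n)" if n: "n > k" for n
  proof (intro regression.intro regression_axioms.intro)
    show "full_rank n k (X n)" using design n by (blast intro: mrank_full_inj)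
  qed (use parameters data models dims(2) n in blast)+
  interpret model_sequence k p c0 jst X \<Theta> \<Sigma> P Y
  proof (intro model_sequence.intro model_sequence_axioms.intro)
    show "dims p c0" by unfold_locales (use dims in auto)
  qed (rule reg)
  have jk: "j \<subseteq> {..<k}" if "j \<in> J" for j using that models by auto
  have w0: "w n j > 0" if "n > k" "j \<in> J" for n j using weights that by blast
  have ahead: "\<forall>\<^sub>F n in sequentially. measure (P n) {x\<in>space (P n). \<not> ahead (\<lambda>n. ln (w n jst / w n j)) n j C x} \<le> \<epsilon>"
    if j: "j \<in> J - {jst}" and e: "\<epsilon> > 0" for j and C \<epsilon> :: real
  proof (cases "jst \<subseteq> j")
    case True
    then have jp: "j \<in> models_plus J jst - {jst}" using j by (simp add: models_plus_def)
    from conditions show ?thesis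
    proof (elim disjE conjE)
      assume unb: "\<not> bdd_above (range p)" and plus: "\<forall>j\<in>models_plus J jst - {jst}. \<exists>L.
           (\<lambda>n. ereal (ln (w n jst / w n j) / real (p n))) \<longlonglongrightarrow> L \<and>
           L > ereal (- (1 / 2) * (real (card j) - real (card jst)) *
                 (log_ratio c0 + (2 - c0) / (1 - c0)\<^sup>2))"
      from bspec[OF plus jp] obtain L where L: "(\<lambda>n. ereal (ln (w n jst / w n j) / real (p n))) \<longlonglongrightarrow> L"
        "L > ereal (- (1 / 2) * (real (card j) - real (card jst)) * (log_ratio c0 + (2 - c0) / (1 - c0)\<^sup>2))" by (elim exE conjE)
      show ?thesis by (rule gap_overfit_unbounded[OF unb True _ _ e L]) (use j jk in auto)
    next
      assume bdd: "bdd_above (range p)"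
        and L: "\<forall>j\<in>models_plus J jst - {jst}. filterlim (\<lambda>n. ln (w n jst / w n j)) at_top sequentially"
      show ?thesis by (rule gap_overfit_bounded[OF bdd True _ _ e L[rule_format, OF jp]]) (use j jk in auto)
    qed
  next
    case False
    then have jm: "j \<in> models_minus J jst" using j by (simp add: models_minus_def)
    have \<Gamma>: "\<Gamma> n j \<in> carrier_mat (p n) (\<gamma> j) \<and> \<Gamma> n j * (\<Gamma> n j)\<^sup>T = noncentrality (X n) jst (\<Theta> n) (\<Sigma> n) j" if "n > k" for n
      using A2_factor jm that by blast
    have "liminf (\<lambda>n. ereal (min_eigenvalue ((\<Gamma> n j)\<^sup>T * \<Gamma> n j) / (real n * real (p n)))) > 0"
      using A2_eigenvalue jm by blast
    from ereal_dense2[OF this] obtain c where c: "0 < ereal c"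
      "ereal c < liminf (\<lambda>n. ereal (min_eigenvalue ((\<Gamma> n j)\<^sup>T * \<Gamma> n j) / (real n * real (p n))))" by blast
    have ev: "\<forall>\<^sub>F n in sequentially. c * (real n * real (p n)) \<le> min_eigenvalue ((\<Gamma> n j)\<^sup>T * \<Gamma> n j)"
      using less_LiminfD[OF c(2)] eventually_gt_at_top[of 0]
    proof eventually_elim
      case (elim n)
      then show ?case using p1[of n] by (simp add: pos_less_divide_eq)
    qed
    have c0: "c > 0" using c by simp
    have g: "\<gamma> j > 0" using A2_rank jm by blast
    have j': "j \<subseteq> {..<k}" using j jk by blast
    from conditions show ?thesis
    proof (elim disjE conjE)
      assume unb: "\<not> bdd_above (range p)" and minus: "\<forall>j\<in>models_minus J jst. \<exists>L.
           (\<lambda>n. ereal (ln (w n jst / w n j) / (real n * ln (real (p n))))) \<longlonglongrightarrow> L \<and>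
           L > ereal (- real (\<gamma> j) / 2)"
      from bspec[OF minus jm] obtain L where L: "(\<lambda>n. ereal (ln (w n jst / w n j) / (real n * ln (real (p n))))) \<longlonglongrightarrow> L"
        "L > ereal (- real (\<gamma> j) / 2)" by (elim exE conjE)
      show ?thesis by (rule gap_underfit_unbounded[OF unb models(2) j' e \<Gamma> c0 ev L])
    next
      assume bdd: "bdd_above (range p)" and minus: "\<forall>j\<in>models_minus J jst. \<exists>L.
           (\<lambda>n. ereal (ln (w n jst / w n j) / real n)) \<longlonglongrightarrow> L \<and> L \<ge> 0"
      from bspec[OF minus jm] obtain L where L: "(\<lambda>n. ereal (ln (w n jst / w n j) / real n)) \<longlonglongrightarrow> L" "L \<ge> 0" by (elim exE conjE)
      show ?thesis by (rule gap_underfit_bounded[OF bdd models(2) j' e g \<Gamma> c0 ev L])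
    qed
  qed
  have Approx_meas: "(\<lambda>x. MPIC_Approx (w n) (X n) (Y n x) j) \<in> borel_measurable (P n)" if n: "n > k" "j \<in> J" for n j
  proof -
    interpret regression n k "X n" "P n" "p n" jst "\<Theta> n" "\<Sigma> n" "Y n" by (rule reg) fact
    have "(\<lambda>x. MPIC_main (X n) (Y n x) j) \<in> borel_measurable (P n)" by (rule MPIC_main_measurable[OF mmeas_det[OF Sigma_hat_measurable[OF jk[OF n(2)] Y_measurable]] Y_measurable])
    then show ?thesis unfolding MPIC_Approx_def by (intro borel_measurable_diff borel_measurable_const)
  qed
  have MPIC_meas: "(\<lambda>x. MPIC (\<pi> n) (w n) (X n) (Y n x) j) \<in> borel_measurable (P n)" if n: "n > k" "j \<in> J" for n j
  proof -
    interpret regression n k "X n" "P n" "p n" jst "\<Theta> n" "\<Sigma> n" "Y n" by (rule reg) fact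
    show ?thesis
    proof (rule MPIC_measurable[where \<pi> = "\<pi> n", OF jk[OF n(2)] Y_measurable])
      show "n > 0" using n by simp
      show "prior_density (card j) (p n) (\<pi> n j)" using priors n by blast
    qed (rule P1[rule_format, OF n])
  qed
  have close: "\<exists>c. \<forall>\<^sub>F n in sequentially. \<forall>x\<in>space (P n).
      MPIC_Approx (w n) (X n) (Y n x) j - c \<le> MPIC (\<pi> n) (w n) (X n) (Y n x) j
      \<and> MPIC (\<pi> n) (w n) (X n) (Y n x) j \<le> MPIC_Approx (w n) (X n) (Y n x) j" if j: "j \<in> J" for j
  proof -
    from P2 j obtain l :: "nat \<Rightarrow> real" where l: "\<forall>n>k. 0 < l n" "filterlim l at_top sequentially"
      "(SUP n\<in>{k<..}.
           ereal ((1 - w n j) * l n powr (real (p n * card j) / 2) /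
                  (w n j * real n powr (real (p n * card j) / 2))) *
           prior_sup (card j) (p n) (\<pi> n j)) < \<infinity>" by blast
    show ?thesis
    proof (rule MPIC_close[where w = w and \<pi> = \<pi> and l = l, OF jk[OF j] _ _ _ _ l(2,3)])
      show "liminf (\<lambda>n. ereal (det ((1 / real n) \<cdot>\<^sub>m ((cols_sub (X n) j)\<^sup>T * cols_sub (X n) j)))) > 0"
        using X_liminf j by blast
      show "prior_density (card j) (p n) (\<pi> n j)" if "n > k" for n using priors j that by blast
      show "0 < w n j \<and> w n j < 1" if "n > k" for n using weights j that by blast
      show "\<pi> n j T S * det S powr (real (card j) / 2) = \<pi> n j (T * inv_sqrt S) (1\<^sub>m (p n))"
        if "n > k" "T \<in> carrier_mat (card j) (p n)" "pos_def (p n) S" for n T S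
        by (rule P1[rule_format, OF that(1) j that(2,3)])
      show "0 < l n" if "n > k" for n using l(1) that by blast
    qed
  qed
  have "consistent P Y J jst (\<lambda>n. MPIC (\<pi> n) (w n) (X n))"
  proof (rule consistent_criterion[where w = w, OF models(1) A1])
  qed (fact w0 MPIC_meas close ahead)+
  moreover have "consistent P Y J jst (\<lambda>n. MPIC_Approx (w n) (X n))"
  proof (rule consistent_criterion[where w = w, OF models(1) A1])
    show "\<exists>c. \<forall>\<^sub>F n in sequentially. \<forall>x\<in>space (P n).
      MPIC_Approx (w n) (X n) (Y n x) j - c \<le> MPIC_Approx (w n) (X n) (Y n x) j
      \<and> MPIC_Approx (w n) (X n) (Y n x) j \<le> MPIC_Approx (w n) (X n) (Y n x) j" for j
      by (rule exI[of _ 0]) simp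
  qed (fact w0 Approx_meas ahead)+
  ultimately show ?thesis ..
qed

end
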